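(* Let $p$ be a prime, $q$ a positive power of $p$, $X$ a Noetherian $F$-finite $\mathbf{F}_p$-scheme, and $\mathcal{I}\subset\mathcal{O}_X$ a quasi-coherent ideal sheaf that is locally generated by a single element. Let $(M,C)$ be a coherent $q$-Cartier module on $X$ and let $N\subset M$ be a coherent $\mathcal{O}_X$-submodule. Suppose that there exists an open covering $X=\bigcup_iU_i$ where each $U_i$ is of finite type over an $F$-finite field. Then there exists a constant $L\ge0$ such that $$\#\bigl(\nu_{\mathcal{I}}(q^m;N)\cap[0,q^m)\bigr)\le L\quad\text{for all integers } m\ge1.$$
   Context: An $\mathbf{F}_p$-scheme (or field) is $F$-finite if its Frobenius is finite. A $q$-Cartier module on $X$ is a pair $(M,C)$ with $M$ an $\mathcal{O}_X$-module and $C\colon M\to M$ an additive endomorphism with $C(a^qx)=aC(x)$ for all local sections $a\in\mathcal{O}_X$, $x\in M$ (equivalently an $\mathcal{O}_X$-linear map $F_{q*}M\to M$, $F_q$ the $q$-th power Frobenius). It is coherent if $M$ is coherent over $\mathcal{O}_X$. For an $\mathcal{O}_X$-submodule $N\subset M$, $C^m(N)$ denotes the image sheaf (an $\mathcal{O}_X$-submodule), and for $m\ge1$ $$\nu_{\mathcal{I}}(q^m;N)=\{n\in\mathbf{Z}_{\ge0}\mid C^m(\mathcal{I}^nN)\ne C^m(\mathcal{I}^{n+1}N)\}.$$ *)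

theory Defs
  imports
    "HOL-Algebra.Algebra"
    "HOL-Analysis.Abstract_Topology"
    "HOL-Number_Theory.Residues"
begin

section \<open>Sheaves and ringed spaces\<close>

text \<open>Sheaves on a topological space are given by the sets of sections over all sets of points
  (only the values on open sets matter) and by restriction maps; \<open>r U V\<close> restricts from \<open>U\<close> to
  \<open>V\<close>. The empty open covering of the empty set is allowed in the gluing axiom, so there is
  exactly one section over the empty set.\<close>

definition sheaf_on ::
    "'x topology \<Rightarrow> ('x set \<Rightarrow> 'c set) \<Rightarrow> ('x set \<Rightarrow> 'x set \<Rightarrow> 'c \<Rightarrow> 'c) \<Rightarrow> bool" where
  "sheaf_on T F r \<longleftrightarrow>
     (\<forall>U V. openin T U \<and> openin T V \<and> V \<subseteq> U \<longrightarrow> r U V \<in> F U \<rightarrow> F V) \<and>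
     (\<forall>U. openin T U \<longrightarrow> (\<forall>s\<in>F U. r U U s = s)) \<and>
     (\<forall>U V W. openin T U \<and> openin T V \<and> openin T W \<and> W \<subseteq> V \<and> V \<subseteq> U \<longrightarrow>
        (\<forall>s\<in>F U. r V W (r U V s) = r U W s)) \<and>
     (\<forall>\<U> s. (\<forall>U\<in>\<U>. openin T U \<and> s U \<in> F U) \<and>
        (\<forall>U\<in>\<U>. \<forall>V\<in>\<U>. r U (U \<inter> V) (s U) = r V (U \<inter> V) (s V)) \<longrightarrow>
        (\<exists>!t. t \<in> F (\<Union>\<U>) \<and> (\<forall>U\<in>\<U>. r (\<Union>\<U>) U t = s U)))"

record ('x, 'a) ringed_space =
  rs_top :: "'x topology"
  rs_sec :: "'x set \<Rightarrow> 'a ring"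
  rs_res :: "'x set \<Rightarrow> 'x set \<Rightarrow> 'a \<Rightarrow> 'a"

abbreviation rs_open :: "('x, 'a) ringed_space \<Rightarrow> 'x set \<Rightarrow> bool" where
  "rs_open S \<equiv> openin (rs_top S)"

abbreviation rs_points :: "('x, 'a) ringed_space \<Rightarrow> 'x set" where
  "rs_points S \<equiv> topspace (rs_top S)"

definition ringed_space :: "('x, 'a) ringed_space \<Rightarrow> bool" where
  "ringed_space S \<longleftrightarrow>
     (\<forall>U. rs_open S U \<longrightarrow> cring (rs_sec S U)) \<and>
     (\<forall>U V. rs_open S U \<and> rs_open S V \<and> V \<subseteq> U \<longrightarrow>
        rs_res S U V \<in> ring_hom (rs_sec S U) (rs_sec S V)) \<and>
     sheaf_on (rs_top S) (\<lambda>U. carrier (rs_sec S U)) (rs_res S)"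

text \<open>The germ at \<open>x\<close> of a section \<open>s\<close> over \<open>U\<close> is a unit of the stalk at \<open>x\<close>. Stalks are only
  ever used through this predicate.\<close>

definition germ_unit :: "('x, 'a) ringed_space \<Rightarrow> 'x \<Rightarrow> 'x set \<Rightarrow> 'a \<Rightarrow> bool" where
  "germ_unit S x U s \<longleftrightarrow>
     (\<exists>V. rs_open S V \<and> x \<in> V \<and> V \<subseteq> U \<and> rs_res S U V s \<in> Units (rs_sec S V))"

text \<open>The stalks are local rings: they are nonzero and, if a sum of two germs is a unit, then so
  is one of the two.\<close>

definition locally_ringed_space :: "('x, 'a) ringed_space \<Rightarrow> bool" where
  "locally_ringed_space S \<longleftrightarrow> ringed_space S \<and>
     (\<forall>U x. rs_open S U \<and> x \<in> U \<longrightarrow>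
        \<not> germ_unit S x U \<zero>\<^bsub>rs_sec S U\<^esub> \<and>
        (\<forall>s\<in>carrier (rs_sec S U). \<forall>t\<in>carrier (rs_sec S U).
           germ_unit S x U (s \<oplus>\<^bsub>rs_sec S U\<^esub> t) \<longrightarrow> germ_unit S x U s \<or> germ_unit S x U t))"

definition open_subspace :: "('x, 'a) ringed_space \<Rightarrow> 'x set \<Rightarrow> ('x, 'a) ringed_space" where
  "open_subspace S U = S\<lparr>rs_top := subtopology (rs_top S) U\<rparr>"

text \<open>A morphism \<open>S \<rightarrow> T\<close> is a continuous map on points together with comorphisms
  \<open>\<O>\<^sub>T(V) \<rightarrow> \<O>\<^sub>S(f\<^bsup>-1\<^esup>V)\<close>.\<close>

type_synonym ('x, 'a, 'y, 'b) rs_map = "('x \<Rightarrow> 'y) \<times> ('y set \<Rightarrow> 'b \<Rightarrow> 'a)"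

definition rs_preimage :: "('x, 'a) ringed_space \<Rightarrow> ('x, 'a, 'y, 'b) rs_map \<Rightarrow> 'y set \<Rightarrow> 'x set" where
  "rs_preimage S \<phi> V = {x \<in> rs_points S. fst \<phi> x \<in> V}"

definition rs_morphism ::
    "('x, 'a) ringed_space \<Rightarrow> ('y, 'b) ringed_space \<Rightarrow> ('x, 'a, 'y, 'b) rs_map \<Rightarrow> bool" where
  "rs_morphism S T \<phi> \<longleftrightarrow>
     continuous_map (rs_top S) (rs_top T) (fst \<phi>) \<and>
     (\<forall>V. rs_open T V \<longrightarrow>
        snd \<phi> V \<in> ring_hom (rs_sec T V) (rs_sec S (rs_preimage S \<phi> V))) \<and>
     (\<forall>V W. rs_open T V \<and> rs_open T W \<and> W \<subseteq> V \<longrightarrow> (\<forall>s\<in>carrier (rs_sec T V).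
        snd \<phi> W (rs_res T V W s) =
          rs_res S (rs_preimage S \<phi> V) (rs_preimage S \<phi> W) (snd \<phi> V s)))"

definition rs_isomorphism ::
    "('x, 'a) ringed_space \<Rightarrow> ('y, 'b) ringed_space \<Rightarrow> ('x, 'a, 'y, 'b) rs_map \<Rightarrow> bool" where
  "rs_isomorphism S T \<phi> \<longleftrightarrow> rs_morphism S T \<phi> \<and>
     homeomorphic_map (rs_top S) (rs_top T) (fst \<phi>) \<and>
     (\<forall>V. rs_open T V \<longrightarrow>
        snd \<phi> V \<in> ring_iso (rs_sec T V) (rs_sec S (rs_preimage S \<phi> V)))"

text \<open>The maps induced on stalks are local.\<close>

definition lrs_morphism ::
    "('x, 'a) ringed_space \<Rightarrow> ('y, 'b) ringed_space \<Rightarrow> ('x, 'a, 'y, 'b) rs_map \<Rightarrow> bool" where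
  "lrs_morphism S T \<phi> \<longleftrightarrow> rs_morphism S T \<phi> \<and>
     (\<forall>x V s. x \<in> rs_points S \<and> rs_open T V \<and> fst \<phi> x \<in> V \<and> s \<in> carrier (rs_sec T V) \<and>
        germ_unit S x (rs_preimage S \<phi> V) (snd \<phi> V s) \<longrightarrow> germ_unit T (fst \<phi> x) V s)"


section \<open>Spectra and schemes\<close>

text \<open>The fraction \<open>a/s\<close> in the localization of \<open>A\<close> at the prime ideal \<open>P\<close>, as the class of
  all pairs \<open>(b, t)\<close> equivalent to \<open>(a, s)\<close>.\<close>

definition loc_frac :: "'a ring \<Rightarrow> 'a set \<Rightarrow> 'a \<Rightarrow> 'a \<Rightarrow> ('a \<times> 'a) set" where
  "loc_frac A P a s = {(b, t). b \<in> carrier A \<and> t \<in> carrier A - P \<and>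
     (\<exists>u\<in>carrier A - P. u \<otimes>\<^bsub>A\<^esub> (a \<otimes>\<^bsub>A\<^esub> t \<ominus>\<^bsub>A\<^esub> b \<otimes>\<^bsub>A\<^esub> s) = \<zero>\<^bsub>A\<^esub>)}"

definition loc_mult :: "'a ring \<Rightarrow> 'a set \<Rightarrow> ('a \<times> 'a) set \<Rightarrow> ('a \<times> 'a) set \<Rightarrow> ('a \<times> 'a) set" where
  "loc_mult A P x y = (\<Union>(a, s)\<in>x. \<Union>(b, t)\<in>y. loc_frac A P (a \<otimes>\<^bsub>A\<^esub> b) (s \<otimes>\<^bsub>A\<^esub> t))"

definition loc_add :: "'a ring \<Rightarrow> 'a set \<Rightarrow> ('a \<times> 'a) set \<Rightarrow> ('a \<times> 'a) set \<Rightarrow> ('a \<times> 'a) set" where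
  "loc_add A P x y = (\<Union>(a, s)\<in>x. \<Union>(b, t)\<in>y.
     loc_frac A P (a \<otimes>\<^bsub>A\<^esub> t \<oplus>\<^bsub>A\<^esub> b \<otimes>\<^bsub>A\<^esub> s) (s \<otimes>\<^bsub>A\<^esub> t))"

definition loc_ring :: "'a ring \<Rightarrow> 'a set \<Rightarrow> ('a \<times> 'a) set ring" where
  "loc_ring A P =
     \<lparr>carrier = {loc_frac A P a s | a s. a \<in> carrier A \<and> s \<in> carrier A - P},
      monoid.mult = loc_mult A P,
      monoid.one = loc_frac A P \<one>\<^bsub>A\<^esub> \<one>\<^bsub>A\<^esub>,
      ring.zero = loc_frac A P \<zero>\<^bsub>A\<^esub> \<one>\<^bsub>A\<^esub>,
      ring.add = loc_add A P\<rparr>"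

text \<open>The topology is generated by the basic open sets \<open>D(f)\<close>.\<close>

definition zariski_topology :: "'a ring \<Rightarrow> 'a set topology" where
  "zariski_topology A = topology_generated_by ((\<lambda>f. {P. primeideal P A \<and> f \<notin> P}) ` carrier A)"

text \<open>Sections over \<open>U\<close> are the families of elements of the local rings at the points of \<open>U\<close> that
  locally are given by one fraction \<open>a/f\<close>.\<close>

definition spec_sections :: "'a ring \<Rightarrow> 'a set set \<Rightarrow> ('a set \<Rightarrow> ('a \<times> 'a) set) set" where
  "spec_sections A U = {s \<in> (\<Pi>\<^sub>E P\<in>U. carrier (loc_ring A P)).
     \<forall>P\<in>U. \<exists>V a f. openin (zariski_topology A) V \<and> P \<in> V \<and> V \<subseteq> U \<and>
       a \<in> carrier A \<and> f \<in> carrier A \<and> (\<forall>Q\<in>V. f \<notin> Q \<and> s Q = loc_frac A Q a f)}"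

definition Spec :: "'a ring \<Rightarrow> ('a set, 'a set \<Rightarrow> ('a \<times> 'a) set) ringed_space" where
  "Spec A =
     \<lparr>rs_top = zariski_topology A,
      rs_sec = (\<lambda>U.
        \<lparr>carrier = spec_sections A U,
         monoid.mult = \<lambda>s t. \<lambda>P\<in>U. s P \<otimes>\<^bsub>loc_ring A P\<^esub> t P,
         monoid.one = \<lambda>P\<in>U. \<one>\<^bsub>loc_ring A P\<^esub>,
         ring.zero = \<lambda>P\<in>U. \<zero>\<^bsub>loc_ring A P\<^esub>,
         ring.add = \<lambda>s t. \<lambda>P\<in>U. s P \<oplus>\<^bsub>loc_ring A P\<^esub> t P\<rparr>),
      rs_res = (\<lambda>U V s. restrict s V)\<rparr>"

text \<open>Requiring the coordinate ring \<open>A\<close> to live in the type of the sections of \<open>S\<close> is no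
  restriction, since \<open>A\<close> is isomorphic to the ring of global sections. An isomorphism of ringed
  spaces between locally ringed spaces is automatically local.\<close>

definition affine_scheme :: "('x, 'a) ringed_space \<Rightarrow> bool" where
  "affine_scheme S \<longleftrightarrow> (\<exists>(A :: 'a ring) \<phi>. cring A \<and> rs_isomorphism S (Spec A) \<phi>)"

definition affine_open :: "('x, 'a) ringed_space \<Rightarrow> 'x set \<Rightarrow> bool" where
  "affine_open S U \<longleftrightarrow> rs_open S U \<and> affine_scheme (open_subspace S U)"

definition scheme :: "('x, 'a) ringed_space \<Rightarrow> bool" where
  "scheme S \<longleftrightarrow> locally_ringed_space S \<and> (\<forall>x\<in>rs_points S. \<exists>U. affine_open S U \<and> x \<in> U)"

definition noetherian_scheme :: "('x, 'a) ringed_space \<Rightarrow> bool" where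
  "noetherian_scheme S \<longleftrightarrow> scheme S \<and>
     (\<exists>\<U>. finite \<U> \<and> (\<forall>U\<in>\<U>. affine_open S U \<and> noetherian_ring (rs_sec S U)) \<and>
       \<Union>\<U> = rs_points S)"

definition ring_hom_finite :: "'a ring \<Rightarrow> 'b ring \<Rightarrow> ('a \<Rightarrow> 'b) \<Rightarrow> bool" where
  "ring_hom_finite R S h \<longleftrightarrow> h \<in> ring_hom R S \<and>
     (\<exists>B. finite B \<and> B \<subseteq> carrier S \<and>
       (\<forall>s\<in>carrier S. \<exists>c\<in>B \<rightarrow> carrier R. s = (\<Oplus>\<^bsub>S\<^esub>b\<in>B. h (c b) \<otimes>\<^bsub>S\<^esub> b)))"

definition ring_hom_finite_type :: "'a ring \<Rightarrow> 'b ring \<Rightarrow> ('a \<Rightarrow> 'b) \<Rightarrow> bool" where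
  "ring_hom_finite_type R S h \<longleftrightarrow> h \<in> ring_hom R S \<and>
     (\<exists>B. finite B \<and> B \<subseteq> carrier S \<and> carrier S = generate_ring S (h ` carrier R \<union> B))"

definition finite_morphism ::
    "('x, 'a) ringed_space \<Rightarrow> ('y, 'b) ringed_space \<Rightarrow> ('x, 'a, 'y, 'b) rs_map \<Rightarrow> bool" where
  "finite_morphism S T \<phi> \<longleftrightarrow> lrs_morphism S T \<phi> \<and>
     (\<exists>\<V>. \<Union>\<V> = rs_points T \<and> (\<forall>V\<in>\<V>. affine_open T V \<and> affine_open S (rs_preimage S \<phi> V) \<and>
        ring_hom_finite (rs_sec T V) (rs_sec S (rs_preimage S \<phi> V)) (snd \<phi> V)))"

definition finite_type_morphism ::
    "('x, 'a) ringed_space \<Rightarrow> ('y, 'b) ringed_space \<Rightarrow> ('x, 'a, 'y, 'b) rs_map \<Rightarrow> bool" where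
  "finite_type_morphism S T \<phi> \<longleftrightarrow> lrs_morphism S T \<phi> \<and>
     (\<exists>\<V>. \<Union>\<V> = rs_points T \<and> (\<forall>V\<in>\<V>. affine_open T V \<and>
        (\<exists>\<U>. finite \<U> \<and> \<Union>\<U> = rs_preimage S \<phi> V \<and> (\<forall>U\<in>\<U>. affine_open S U \<and>
           ring_hom_finite_type (rs_sec T V) (rs_sec S U)
             (\<lambda>a. rs_res S (rs_preimage S \<phi> V) U (snd \<phi> V a))))))"

definition Fp_scheme :: "nat \<Rightarrow> ('x, 'a) ringed_space \<Rightarrow> bool" where
  "Fp_scheme p S \<longleftrightarrow> scheme S \<and> (\<exists>\<phi>. lrs_morphism S (Spec (residue_ring (int p))) \<phi>)"

definition frobenius :: "nat \<Rightarrow> ('x, 'a) ringed_space \<Rightarrow> ('x, 'a, 'x, 'a) rs_map" where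
  "frobenius p S = ((\<lambda>x. x), (\<lambda>V a. a [^]\<^bsub>rs_sec S V\<^esub> p))"

definition F_finite_scheme :: "nat \<Rightarrow> ('x, 'a) ringed_space \<Rightarrow> bool" where
  "F_finite_scheme p S \<longleftrightarrow> Fp_scheme p S \<and> finite_morphism S S (frobenius p S)"

definition F_finite_field :: "nat \<Rightarrow> 'a ring \<Rightarrow> bool" where
  "F_finite_field p k \<longleftrightarrow> field k \<and> [p] \<cdot>\<^bsub>k\<^esub> \<one>\<^bsub>k\<^esub> = \<zero>\<^bsub>k\<^esub> \<and>
     ring_hom_finite k k (\<lambda>a. a [^]\<^bsub>k\<^esub> p)"


section \<open>Sheaves of modules\<close>

record ('x, 'a, 'b) module_sheaf =
  ms_sec :: "'x set \<Rightarrow> ('a, 'b) module"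
  ms_res :: "'x set \<Rightarrow> 'x set \<Rightarrow> 'b \<Rightarrow> 'b"

definition module_sheaf :: "('x, 'a) ringed_space \<Rightarrow> ('x, 'a, 'b) module_sheaf \<Rightarrow> bool" where
  "module_sheaf S M \<longleftrightarrow>
     (\<forall>U. rs_open S U \<longrightarrow> Module.module (rs_sec S U) (ms_sec M U)) \<and>
     (\<forall>U V. rs_open S U \<and> rs_open S V \<and> V \<subseteq> U \<longrightarrow>
        (\<forall>x\<in>carrier (ms_sec M U). \<forall>y\<in>carrier (ms_sec M U).
           ms_res M U V (x \<oplus>\<^bsub>ms_sec M U\<^esub> y) = ms_res M U V x \<oplus>\<^bsub>ms_sec M V\<^esub> ms_res M U V y) \<and>
        (\<forall>a\<in>carrier (rs_sec S U). \<forall>x\<in>carrier (ms_sec M U).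
           ms_res M U V (a \<odot>\<^bsub>ms_sec M U\<^esub> x) = rs_res S U V a \<odot>\<^bsub>ms_sec M V\<^esub> ms_res M U V x)) \<and>
     sheaf_on (rs_top S) (\<lambda>U. carrier (ms_sec M U)) (ms_res M)"

definition structure_module :: "('x, 'a) ringed_space \<Rightarrow> ('x, 'a, 'a) module_sheaf" where
  "structure_module S =
     \<lparr>ms_sec = (\<lambda>U. ring.extend (rs_sec S U) \<lparr>smult = monoid.mult (rs_sec S U)\<rparr>),
      ms_res = rs_res S\<rparr>"

text \<open>Submodules are represented by their sets of sections.\<close>

definition sub_sheaf ::
    "('x, 'a) ringed_space \<Rightarrow> ('x, 'a, 'b) module_sheaf \<Rightarrow> ('x set \<Rightarrow> 'b set) \<Rightarrow> bool" where
  "sub_sheaf S M N \<longleftrightarrow>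
     (\<forall>U. rs_open S U \<longrightarrow> submodule (N U) (rs_sec S U) (ms_sec M U)) \<and>
     sheaf_on (rs_top S) N (ms_res M)"

definition restrict_module ::
    "('x, 'a, 'b) module_sheaf \<Rightarrow> ('x set \<Rightarrow> 'b set) \<Rightarrow> ('x, 'a, 'b) module_sheaf" where
  "restrict_module M N = M\<lparr>ms_sec := \<lambda>U. (ms_sec M U)\<lparr>carrier := N U\<rparr>\<rparr>"

definition ideal_sheaf :: "('x, 'a) ringed_space \<Rightarrow> ('x set \<Rightarrow> 'a set) \<Rightarrow> bool" where
  "ideal_sheaf S I \<longleftrightarrow> sub_sheaf S (structure_module S) I"

text \<open>The family \<open>g\<close> of sections over the open set \<open>U\<close>, indexed by \<open>J\<close>, defines a surjection
  \<open>\<O>\<^sub>U\<^bsup>(J)\<^esup> \<rightarrow> M|\<^sub>U\<close> of sheaves.\<close>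

definition ms_generated ::
    "('x, 'a) ringed_space \<Rightarrow> ('x, 'a, 'b) module_sheaf \<Rightarrow> 'x set \<Rightarrow> 'j set \<Rightarrow> ('j \<Rightarrow> 'b) \<Rightarrow> bool" where
  "ms_generated S M U J g \<longleftrightarrow> g \<in> J \<rightarrow> carrier (ms_sec M U) \<and>
     (\<forall>W s x. rs_open S W \<and> W \<subseteq> U \<and> s \<in> carrier (ms_sec M W) \<and> x \<in> W \<longrightarrow>
        (\<exists>V K. rs_open S V \<and> x \<in> V \<and> V \<subseteq> W \<and> finite K \<and> K \<subseteq> J \<and>
          (\<exists>c\<in>K \<rightarrow> carrier (rs_sec S V).
             ms_res M W V s = (\<Oplus>\<^bsub>ms_sec M V\<^esub>j\<in>K. c j \<odot>\<^bsub>ms_sec M V\<^esub> ms_res M U V (g j)))))"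

text \<open>Relations over \<open>W\<close> between the members of \<open>g\<close>, that is, sections over \<open>W\<close> with finite
  support of the kernel of \<open>\<O>\<^sub>U\<^bsup>(J)\<^esup> \<rightarrow> M|\<^sub>U\<close>. (Every section of \<open>\<O>\<^sub>U\<^bsup>(J)\<^esup>\<close> has finite support locally.)\<close>

definition ms_relations ::
    "('x, 'a) ringed_space \<Rightarrow> ('x, 'a, 'b) module_sheaf \<Rightarrow> 'x set \<Rightarrow> 'j set \<Rightarrow> ('j \<Rightarrow> 'b) \<Rightarrow>
      'x set \<Rightarrow> ('j \<Rightarrow> 'a) set" where
  "ms_relations S M U J g W = {c \<in> J \<rightarrow> carrier (rs_sec S W).
     finite {j \<in> J. c j \<noteq> \<zero>\<^bsub>rs_sec S W\<^esub>} \<and>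
     (\<Oplus>\<^bsub>ms_sec M W\<^esub>j\<in>{j \<in> J. c j \<noteq> \<zero>\<^bsub>rs_sec S W\<^esub>}. c j \<odot>\<^bsub>ms_sec M W\<^esub> ms_res M U W (g j)) =
       \<zero>\<^bsub>ms_sec M W\<^esub>}"

text \<open>The set \<open>R\<close> of relations over \<open>U\<close> generates the kernel of \<open>\<O>\<^sub>U\<^bsup>(J)\<^esup> \<rightarrow> M|\<^sub>U\<close> as a sheaf of
  modules.\<close>

definition ms_relations_generated ::
    "('x, 'a) ringed_space \<Rightarrow> ('x, 'a, 'b) module_sheaf \<Rightarrow> 'x set \<Rightarrow> 'j set \<Rightarrow> ('j \<Rightarrow> 'b) \<Rightarrow>
      ('j \<Rightarrow> 'a) set \<Rightarrow> bool" where
  "ms_relations_generated S M U J g R \<longleftrightarrow> R \<subseteq> ms_relations S M U J g U \<and>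
     (\<forall>W c x. rs_open S W \<and> W \<subseteq> U \<and> c \<in> ms_relations S M U J g W \<and> x \<in> W \<longrightarrow>
        (\<exists>V K. rs_open S V \<and> x \<in> V \<and> V \<subseteq> W \<and> finite K \<and> K \<subseteq> R \<and>
          (\<exists>d\<in>K \<rightarrow> carrier (rs_sec S V). \<forall>j\<in>J.
             rs_res S W V (c j) =
               (\<Oplus>\<^bsub>rs_sec S V\<^esub>k\<in>K. d k \<otimes>\<^bsub>rs_sec S V\<^esub> rs_res S U V (k j)))))"

text \<open>Locally there is a presentation \<open>\<O>\<^sub>U\<^bsup>(J')\<^esup> \<rightarrow> \<O>\<^sub>U\<^bsup>(J)\<^esup> \<rightarrow> M|\<^sub>U \<rightarrow> 0\<close>. Families of generators
  and of relations may be replaced by the sets of their members.\<close>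

definition quasi_coherent :: "('x, 'a) ringed_space \<Rightarrow> ('x, 'a, 'b) module_sheaf \<Rightarrow> bool" where
  "quasi_coherent S M \<longleftrightarrow> module_sheaf S M \<and>
     (\<forall>x\<in>rs_points S. \<exists>U G R. rs_open S U \<and> x \<in> U \<and>
        ms_generated S M U G (\<lambda>g. g) \<and> ms_relations_generated S M U G (\<lambda>g. g) R)"

text \<open>Finite type, and every homomorphism \<open>\<O>\<^sub>U\<^sup>n \<rightarrow> M|\<^sub>U\<close> has a kernel of finite type.\<close>

definition coherent :: "('x, 'a) ringed_space \<Rightarrow> ('x, 'a, 'b) module_sheaf \<Rightarrow> bool" where
  "coherent S M \<longleftrightarrow> module_sheaf S M \<and>
     (\<forall>x\<in>rs_points S. \<exists>U (n::nat) g. rs_open S U \<and> x \<in> U \<and> ms_generated S M U {..<n} g) \<and>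
     (\<forall>U (n::nat) g. rs_open S U \<and> g \<in> {..<n} \<rightarrow> carrier (ms_sec M U) \<longrightarrow>
        (\<forall>x\<in>U. \<exists>V R. rs_open S V \<and> x \<in> V \<and> V \<subseteq> U \<and> finite R \<and>
           ms_relations_generated S M V {..<n} (\<lambda>j. ms_res M U V (g j)) R))"

definition locally_principal :: "('x, 'a) ringed_space \<Rightarrow> ('x set \<Rightarrow> 'a set) \<Rightarrow> bool" where
  "locally_principal S I \<longleftrightarrow> (\<forall>x\<in>rs_points S. \<exists>U f. rs_open S U \<and> x \<in> U \<and>
     ms_generated S (restrict_module (structure_module S) I) U {()} (\<lambda>_. f))"

text \<open>The submodule \<open>I N\<close> of \<open>M\<close>, sheafifying \<open>U \<mapsto> I(U) N(U)\<close>.\<close>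

definition ideal_mult ::
    "('x, 'a) ringed_space \<Rightarrow> ('x, 'a, 'b) module_sheaf \<Rightarrow> ('x set \<Rightarrow> 'a set) \<Rightarrow>
      ('x set \<Rightarrow> 'b set) \<Rightarrow> 'x set \<Rightarrow> 'b set" where
  "ideal_mult S M I N U = {s \<in> carrier (ms_sec M U). \<forall>x\<in>U. \<exists>V. rs_open S V \<and> x \<in> V \<and> V \<subseteq> U \<and>
     (\<exists>(n::nat). \<exists>a\<in>{..<n} \<rightarrow> I V. \<exists>y\<in>{..<n} \<rightarrow> N V.
        ms_res M U V s = (\<Oplus>\<^bsub>ms_sec M V\<^esub>i\<in>{..<n}. a i \<odot>\<^bsub>ms_sec M V\<^esub> y i))}"

primrec ideal_power ::
    "('x, 'a) ringed_space \<Rightarrow> ('x set \<Rightarrow> 'a set) \<Rightarrow> nat \<Rightarrow> 'x set \<Rightarrow> 'a set" where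
  "ideal_power S I 0 = (\<lambda>U. carrier (rs_sec S U))"
| "ideal_power S I (Suc n) = ideal_mult S (structure_module S) I (ideal_power S I n)"


section \<open>Cartier modules\<close>

definition cartier_module ::
    "nat \<Rightarrow> ('x, 'a) ringed_space \<Rightarrow> ('x, 'a, 'b) module_sheaf \<Rightarrow> ('x set \<Rightarrow> 'b \<Rightarrow> 'b) \<Rightarrow> bool" where
  "cartier_module q S M C \<longleftrightarrow> module_sheaf S M \<and>
     (\<forall>U. rs_open S U \<longrightarrow>
        C U \<in> carrier (ms_sec M U) \<rightarrow> carrier (ms_sec M U) \<and>
        (\<forall>x\<in>carrier (ms_sec M U). \<forall>y\<in>carrier (ms_sec M U).
           C U (x \<oplus>\<^bsub>ms_sec M U\<^esub> y) = C U x \<oplus>\<^bsub>ms_sec M U\<^esub> C U y) \<and>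
        (\<forall>a\<in>carrier (rs_sec S U). \<forall>x\<in>carrier (ms_sec M U).
           C U ((a [^]\<^bsub>rs_sec S U\<^esub> q) \<odot>\<^bsub>ms_sec M U\<^esub> x) = a \<odot>\<^bsub>ms_sec M U\<^esub> C U x)) \<and>
     (\<forall>U V. rs_open S U \<and> rs_open S V \<and> V \<subseteq> U \<longrightarrow>
        (\<forall>x\<in>carrier (ms_sec M U). ms_res M U V (C U x) = C V (ms_res M U V x)))"

text \<open>The image sheaf \<open>C\<^sup>m(N)\<close>: sections of \<open>M\<close> that locally are images of sections of \<open>N\<close>.\<close>

definition cartier_image ::
    "('x, 'a) ringed_space \<Rightarrow> ('x, 'a, 'b) module_sheaf \<Rightarrow> ('x set \<Rightarrow> 'b \<Rightarrow> 'b) \<Rightarrow> nat \<Rightarrow>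
      ('x set \<Rightarrow> 'b set) \<Rightarrow> 'x set \<Rightarrow> 'b set" where
  "cartier_image S M C m N U = {s \<in> carrier (ms_sec M U). \<forall>x\<in>U. \<exists>V. rs_open S V \<and> x \<in> V \<and> V \<subseteq> U \<and>
     ms_res M U V s \<in> (C V ^^ m) ` N V}"

text \<open>\<open>cartier_nu S M C I N m\<close> is \<open>\<nu>\<^sub>I(q\<^sup>m; N)\<close> for a \<open>q\<close>-Cartier module \<open>(M, C)\<close>. Two sheaves
  differ if they differ on some open set.\<close>

definition cartier_nu ::
    "('x, 'a) ringed_space \<Rightarrow> ('x, 'a, 'b) module_sheaf \<Rightarrow> ('x set \<Rightarrow> 'b \<Rightarrow> 'b) \<Rightarrow>
      ('x set \<Rightarrow> 'a set) \<Rightarrow> ('x set \<Rightarrow> 'b set) \<Rightarrow> nat \<Rightarrow> nat set" where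
  "cartier_nu S M C I N m = {n. \<exists>U. rs_open S U \<and>
     cartier_image S M C m (ideal_mult S M (ideal_power S I n) N) U \<noteq>
     cartier_image S M C m (ideal_mult S M (ideal_power S I (Suc n)) N) U}"

end

theory Submission
  imports Defs
begin

text \<open>The bound is the dimension of a vector space. In the affine situation let \<open>R\<close> be generated by
  finitely many elements over an F-finite field \<open>K\<close>, let \<open>M\<close> be generated by a finite set \<open>G\<close>, let
  \<open>N\<close> be spanned by a finite set \<open>H\<close>, and let the ideal be \<open>(f)\<close>. Filter \<open>M\<close> by degree: \<open>Fil G D\<close> is
  the \<open>K\<close>-span of the products of monomials of degree at most \<open>D\<close> with members of \<open>G\<close>. As \<open>C\<close> takes
  \<open>a\<^sup>qx\<close> to \<open>aC(x)\<close> and \<open>K\<close> is finite over its \<open>q\<close>-th powers, \<open>C\<close> divides degrees by \<open>q\<close> up to an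
  additive constant (\<open>C_Fil\<close>). Hence \<open>C\<^sup>m\<close> divides them by \<open>q\<^sup>m\<close> up to a constant that does not
  depend on \<open>m\<close> (\<open>C_pow_Fil\<close>). On the other hand \<open>C\<^sup>m(f\<^sup>nN)\<close> is generated over \<open>R\<close> by the elements
  \<open>C\<^sup>m(cxf\<^sup>nh)\<close>, where \<open>c \<in> K\<close>, \<open>h \<in> H\<close> and \<open>x\<close> is a monomial with exponents less than \<open>q\<^sup>m\<close>. For
  \<open>n \<le> q\<^sup>m\<close> the degree of \<open>cxf\<^sup>nh\<close> is \<open>O(q\<^sup>m)\<close>, so \<open>C\<^sup>m(f\<^sup>nN)\<close> is generated by its intersection with
  one space \<open>Fil G E\<close>, with \<open>E\<close> independent of \<open>m\<close> and \<open>n\<close>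
  (\<open>trace_generated_in_bounded_degree\<close>). For fixed \<open>m\<close> these intersections form a decreasing chain of
  \<open>K\<close>-subspaces of a finite-dimensional space, and such a chain has at most as many strict steps as
  the space has generators (\<open>card_jumps_le\<close>). This is \<open>trace_jumps_bounded\<close>.

  The scheme is quasi-compact and equality of image sheaves is a local question
  (\<open>cartier_image_subset\<close>), so it suffices to bound the jumps near a point. Let \<open>U\<close> be an affine
  neighbourhood of finite type over an F-finite field and \<open>R = \<O>(U)\<close>. The argument is run on the
  \<open>R\<close>-module of sections of \<open>M\<close> over a small neighbourhood \<open>D\<close> of the point, and it
  needs a finite set of sections over \<open>D\<close> whose \<open>R\<close>-span is stable under \<open>C\<close>. If sections \<open>G\<close> generate
  the sheaf, then \<open>C\<close> maps their \<open>R\<close>-span into the \<open>R\<close>-span of finitely many sections, and near the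
  point these are combinations of \<open>G\<close> with a common denominator \<open>u \<in> R\<close>. Then the span of \<open>u\<^bsup>-2\<^esup>G\<close> is
  stable: for \<open>y\<close> in it, \<open>uC(y) = C(u\<^sup>qy)\<close> lies in the image under \<open>C\<close> of the span of \<open>G\<close>, so
  \<open>u\<^sup>2C(y)\<close> lies in the span of \<open>G\<close> (\<open>exists_stable_chart\<close>). Finally, local coefficients are
  fractions of elements of \<open>R\<close>, so an equality between two modules \<open>C\<^sup>m(f\<^sup>nN)\<close> over \<open>R\<close> gives the
  equality of the corresponding image sheaves on \<open>D\<close> (\<open>image_le_if_trace_eq\<close>).\<close>


section \<open>Linear combinations with restricted coefficients\<close>

text \<open>The coefficients are restricted to a set \<open>A\<close> because several kinds of spans occur: over the
  whole ring, an ideal, the field of scalars, and the set of \<open>q\<close>-th powers of scalars. The carrier of \<open>M\<close> does not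
  enter, so passing to a submodule leaves spans unchanged.\<close>

inductive_set lspan :: "'a set \<Rightarrow> ('a, 'b, 'm) module_scheme \<Rightarrow> 'b set \<Rightarrow> 'b set"
  for A M G where
    lspan_zero: "\<zero>\<^bsub>M\<^esub> \<in> lspan A M G"
  | lspan_step: "a \<in> A \<Longrightarrow> g \<in> G \<Longrightarrow> x \<in> lspan A M G \<Longrightarrow> a \<odot>\<^bsub>M\<^esub> g \<oplus>\<^bsub>M\<^esub> x \<in> lspan A M G"

lemma lspan_mono:
  assumes "A \<subseteq> A'" "G \<subseteq> G'"
  shows "lspan A M G \<subseteq> lspan A' M G'"
proof
  fix x assume "x \<in> lspan A M G"
  then show "x \<in> lspan A' M G'"
    by induction (use assms in \<open>auto intro: lspan.intros\<close>)
qed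

context Module.module
begin

abbreviation smult_M (infixl "\<bullet>" 70) where "a \<bullet> x \<equiv> a \<odot>\<^bsub>M\<^esub> x"
abbreviation add_M (infixl "\<boxplus>" 65) where "x \<boxplus> y \<equiv> x \<oplus>\<^bsub>M\<^esub> y"

lemma lspan_closed:
  assumes "A \<subseteq> carrier R" "G \<subseteq> carrier M"
  shows "lspan A M G \<subseteq> carrier M"
proof
  fix x assume "x \<in> lspan A M G"
  then show "x \<in> carrier M"
    by induction (use assms in auto)
qed

lemma lspan_add:
  assumes "A \<subseteq> carrier R" "G \<subseteq> carrier M" "x \<in> lspan A M G" "y \<in> lspan A M G"
  shows "x \<boxplus> y \<in> lspan A M G"
  using assms(3)
proof induction
  case lspan_zero
  show ?case using assms(4) lspan_closed[OF assms(1,2)] by (simp add: subset_iff)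
next
  case (lspan_step a g x)
  have "a \<in> carrier R" "g \<in> carrier M" "x \<in> carrier M" "y \<in> carrier M"
    using lspan_step assms lspan_closed[OF assms(1,2)] by auto
  then have "a \<bullet> g \<boxplus> x \<boxplus> y = a \<bullet> g \<boxplus> (x \<boxplus> y)"
    by (simp add: M.a_assoc)
  then show ?case using lspan_step lspan.lspan_step by metis
qed

lemma lspan_smult_incl:
  assumes "A \<subseteq> carrier R" "G \<subseteq> carrier M" "a \<in> A" "g \<in> G"
  shows "a \<bullet> g \<in> lspan A M G"
proof -
  have "a \<bullet> g \<boxplus> \<zero>\<^bsub>M\<^esub> \<in> lspan A M G"
    using assms by (intro lspan.intros)
  moreover have "a \<bullet> g \<in> carrier M"
    using assms by auto
  ultimately show ?thesis by simp
qed

lemma lspan_incl: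
  assumes "A \<subseteq> carrier R" "G \<subseteq> carrier M" "\<one> \<in> A" "g \<in> G"
  shows "g \<in> lspan A M G"
proof -
  have "g \<in> carrier M" using assms by auto
  then show ?thesis using lspan_smult_incl[OF assms] by simp
qed

lemma lspan_least:
  assumes "x \<in> lspan A M G" "\<zero>\<^bsub>M\<^esub> \<in> Z" "\<And>x y. x \<in> Z \<Longrightarrow> y \<in> Z \<Longrightarrow> x \<boxplus> y \<in> Z"
    "\<And>a g. a \<in> A \<Longrightarrow> g \<in> G \<Longrightarrow> a \<bullet> g \<in> Z"
  shows "x \<in> Z"
  using assms(1) by induction (use assms in auto)

lemma lspan_smult:
  assumes "A \<subseteq> carrier R" "G \<subseteq> carrier M" "c \<in> carrier R" "\<And>a. a \<in> A \<Longrightarrow> c \<otimes> a \<in> A"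
    "x \<in> lspan A M G"
  shows "c \<bullet> x \<in> lspan A M G"
  using assms(5)
proof induction
  case lspan_zero
  then show ?case using assms by (simp add: lspan.intros)
next
  case (lspan_step a g x)
  have "a \<in> carrier R" "g \<in> carrier M" "x \<in> carrier M"
    using lspan_step assms lspan_closed[OF assms(1,2)] by auto
  then have "c \<bullet> (a \<bullet> g \<boxplus> x) = (c \<otimes> a) \<bullet> g \<boxplus> c \<bullet> x"
    using assms by (simp add: smult_r_distr smult_assoc1)
  then show ?case using lspan_step lspan.lspan_step assms by metis
qed

lemma lspan_R_smult:
  "G \<subseteq> carrier M \<Longrightarrow> c \<in> carrier R \<Longrightarrow> x \<in> lspan (carrier R) M G \<Longrightarrow>
    c \<bullet> x \<in> lspan (carrier R) M G"
  by (rule lspan_smult) auto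

lemma lspan_R_incl: "G \<subseteq> carrier M \<Longrightarrow> g \<in> G \<Longrightarrow> g \<in> lspan (carrier R) M G"
  by (rule lspan_incl) auto

lemma lspan_singleton:
  assumes "g \<in> carrier M" "x \<in> lspan (carrier R) M {g}"
  shows "\<exists>c\<in>carrier R. x = c \<bullet> g"
  using assms(2)
proof induction
  case lspan_zero
  show ?case using assms(1) by (intro bexI[of _ "\<zero>"]) auto
next
  case (lspan_step a g' x)
  then obtain c where "c \<in> carrier R" "x = c \<bullet> g" by blast
  then show ?case using lspan_step assms(1) by (intro bexI[of _ "a \<oplus> c"]) (auto simp: smult_l_distr)
qed

lemma lspan_subset_lspan:
  assumes "G \<subseteq> carrier M" "G' \<subseteq> lspan (carrier R) M G"
  shows "lspan (carrier R) M G' \<subseteq> lspan (carrier R) M G"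
proof
  fix x assume "x \<in> lspan (carrier R) M G'"
  then show "x \<in> lspan (carrier R) M G"
    by (rule lspan_least)
      (use assms in \<open>auto intro!: lspan_zero lspan_add lspan_smult\<close>)
qed

lemma finsum_in_lspan:
  assumes "A \<subseteq> carrier R" "G \<subseteq> carrier M" "finite T"
    and "c \<in> T \<rightarrow> A" "g \<in> T \<rightarrow> G"
  shows "(\<Oplus>\<^bsub>M\<^esub>j\<in>T. c j \<bullet> g j) \<in> lspan A M G"
  using assms(3-5)
proof (induction T)
  case empty
  then show ?case by (simp add: lspan.intros)
next
  case (insert t T)
  have "(\<Oplus>\<^bsub>M\<^esub>j\<in>insert t T. c j \<bullet> g j) = c t \<bullet> g t \<boxplus> (\<Oplus>\<^bsub>M\<^esub>j\<in>T. c j \<bullet> g j)"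
    using insert assms(1,2) by (intro M.finsum_insert) (auto simp: Pi_def subset_iff)
  then show ?case using insert by (auto intro: lspan.intros)
qed

lemma lspan_as_finsum:
  assumes "A \<subseteq> carrier R" "G \<subseteq> carrier M" "x \<in> lspan A M G"
  shows "\<exists>(n::nat). \<exists>a\<in>{..<n} \<rightarrow> A. \<exists>y\<in>{..<n} \<rightarrow> G. x = (\<Oplus>\<^bsub>M\<^esub>i\<in>{..<n}. a i \<bullet> y i)"
  using assms(3)
proof induction
  case lspan_zero
  show ?case by (intro exI[of _ 0]) auto
next
  case (lspan_step c g x)
  then obtain n :: nat and a y where n: "a \<in> {..<n} \<rightarrow> A" "y \<in> {..<n} \<rightarrow> G"
    and x: "x = (\<Oplus>\<^bsub>M\<^esub>i\<in>{..<n}. a i \<bullet> y i)"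
    by blast
  have cl: "c \<bullet> g \<in> carrier M" "\<And>i. i < n \<Longrightarrow> a i \<bullet> y i \<in> carrier M"
    using lspan_step n assms(1,2) by (auto simp: Pi_def subset_iff)
  have "(\<Oplus>\<^bsub>M\<^esub>i\<in>{..<Suc n}. (a(n := c)) i \<bullet> (y(n := g)) i)
      = c \<bullet> g \<boxplus> (\<Oplus>\<^bsub>M\<^esub>i\<in>{..<n}. (a(n := c)) i \<bullet> (y(n := g)) i)"
    unfolding lessThan_Suc using cl by (subst M.finsum_insert) auto
  also have "(\<Oplus>\<^bsub>M\<^esub>i\<in>{..<n}. (a(n := c)) i \<bullet> (y(n := g)) i) = x"
    unfolding x using cl by (intro M.finsum_cong') auto
  finally show ?case
    using n lspan_step(1,2)
    by (intro exI[of _ "Suc n"] bexI[of _ "a(n := c)"] bexI[of _ "y(n := g)"])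
      (auto simp: Pi_def less_Suc_eq)
qed

end

text \<open>Transport of spans along an additive map that is compatible with a change of coefficients, such as a
  ring homomorphism, the Frobenius, or the restriction to a smaller open set.\<close>

lemma lspan_hom:
  assumes "Module.module R M" "A \<subseteq> carrier R" "G \<subseteq> carrier M" "x \<in> lspan A M G"
    and "\<phi> \<zero>\<^bsub>M\<^esub> = \<zero>\<^bsub>M'\<^esub>"
    and "\<And>x y. x \<in> carrier M \<Longrightarrow> y \<in> carrier M \<Longrightarrow> \<phi> (x \<oplus>\<^bsub>M\<^esub> y) = \<phi> x \<oplus>\<^bsub>M'\<^esub> \<phi> y"
    and "\<And>a g. a \<in> A \<Longrightarrow> g \<in> G \<Longrightarrow> \<exists>a'\<in>A'. \<exists>g'\<in>G'. \<phi> (a \<odot>\<^bsub>M\<^esub> g) = a' \<odot>\<^bsub>M'\<^esub> g'"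
  shows "\<phi> x \<in> lspan A' M' G'"
  using assms(4)
proof induction
  case lspan_zero
  then show ?case using assms by (simp add: lspan.intros)
next
  case (lspan_step a g x)
  interpret Module.module R M by fact
  have "a \<odot>\<^bsub>M\<^esub> g \<in> carrier M" "x \<in> carrier M"
    using lspan_step assms(2,3) lspan_closed[OF assms(2,3)] by auto
  then have "\<phi> (a \<odot>\<^bsub>M\<^esub> g \<oplus>\<^bsub>M\<^esub> x) = \<phi> (a \<odot>\<^bsub>M\<^esub> g) \<oplus>\<^bsub>M'\<^esub> \<phi> x"
    using assms by auto
  then show ?case using assms(7)[OF lspan_step(1,2)] lspan_step(4)
    by (auto intro: lspan.intros)
qed


section \<open>Chains of subspaces\<close>

locale scalar_field = Module.module R M for R (structure) and M (structure) +
  fixes K :: "'a set"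
  assumes K_subring: "subring K R"
    and K_inverse: "\<And>c. c \<in> K \<Longrightarrow> c \<noteq> \<zero> \<Longrightarrow> \<exists>d\<in>K. d \<otimes> c = \<one>"
begin

lemma K_closed: "K \<subseteq> carrier R"
  using K_subring by (rule subringE(1))

lemma K_ops: "\<zero> \<in> K" "\<one> \<in> K" "c \<in> K \<Longrightarrow> \<ominus> c \<in> K" "c \<in> K \<Longrightarrow> d \<in> K \<Longrightarrow> c \<otimes> d \<in> K"
  "c \<in> K \<Longrightarrow> d \<in> K \<Longrightarrow> c \<oplus> d \<in> K"
  using subringE[OF K_subring] by auto

definition subspace :: "'c set \<Rightarrow> bool" where
  "subspace V \<longleftrightarrow> V \<subseteq> carrier M \<and> \<zero>\<^bsub>M\<^esub> \<in> V \<and> (\<forall>x\<in>V. \<forall>y\<in>V. x \<boxplus> y \<in> V) \<and>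
     (\<forall>c\<in>K. \<forall>x\<in>V. c \<bullet> x \<in> V)"

lemma subspace_lspan: "G \<subseteq> carrier M \<Longrightarrow> subspace (lspan K M G)"
  unfolding subspace_def using K_closed K_ops lspan_closed[OF K_closed]
  by (auto intro!: lspan_add lspan_smult lspan_zero)

lemma subspace_Int: "subspace V \<Longrightarrow> subspace W \<Longrightarrow> subspace (V \<inter> W)"
  unfolding subspace_def by auto

text \<open>The positions of the leading vectors of elements of \<open>V\<close>, as in a row echelon form with respect to
  the sequence \<open>b\<close>.\<close>

definition pivots :: "nat \<Rightarrow> (nat \<Rightarrow> 'c) \<Rightarrow> 'c set \<Rightarrow> nat set" where
  "pivots r b V = {i. i < r \<and> (\<exists>y\<in>lspan K M (b ` {..<i}). b i \<boxplus> y \<in> V)}"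

lemma lspan_Suc:
  assumes "b ` {..<Suc i} \<subseteq> carrier M" "w \<in> lspan K M (b ` {..<Suc i})"
  shows "\<exists>c\<in>K. \<exists>y\<in>lspan K M (b ` {..<i}). w = c \<bullet> b i \<boxplus> y"
  using assms(2)
proof induction
  case lspan_zero
  have "\<zero>\<^bsub>M\<^esub> = \<zero> \<bullet> b i \<boxplus> \<zero>\<^bsub>M\<^esub>" using assms by auto
  then show ?case using K_ops lspan.lspan_zero by metis
next
  case (lspan_step a g x)
  then obtain c y where cy: "c \<in> K" "y \<in> lspan K M (b ` {..<i})" "x = c \<bullet> b i \<boxplus> y"
    by auto
  have bi: "b i \<in> carrier M" and bs: "b ` {..<i} \<subseteq> carrier M" using assms by auto
  have car: "a \<in> carrier R" "c \<in> carrier R" "g \<in> carrier M" "y \<in> carrier M"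
    using lspan_step cy K_closed assms lspan_closed[OF K_closed bs] by auto
  show ?case
  proof (cases "g = b i")
    case True
    have "a \<bullet> g \<boxplus> x = (a \<oplus> c) \<bullet> b i \<boxplus> y"
      using True cy car bi by (simp add: smult_l_distr M.a_assoc)
    then show ?thesis using cy lspan_step(1) K_ops by metis
  next
    case False
    then have "g \<in> b ` {..<i}" using lspan_step(2) by (auto simp: less_Suc_eq)
    then have "a \<bullet> g \<boxplus> y \<in> lspan K M (b ` {..<i})"
      using lspan_step(1) cy by (intro lspan.lspan_step)
    moreover have "a \<bullet> g \<boxplus> x = c \<bullet> b i \<boxplus> (a \<bullet> g \<boxplus> y)"
      using cy car bi by (simp add: M.a_ac)
    ultimately show ?thesis using cy by metis
  qed
qed

text \<open>Gaussian elimination: if the leading vector of \<open>w \<in> W\<close> is \<open>b i\<close>, then a multiple of an element of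
  \<open>V\<close> with the same leading vector can be subtracted, and the difference is an element of \<open>W\<close> that
  involves only earlier vectors. So induction on \<open>i\<close> applies.\<close>

lemma subspace_eqI_pivots:
  assumes b: "b ` {..<r} \<subseteq> carrier M" and V: "subspace V" and W: "subspace W"
    and VW: "V \<subseteq> W" and Wb: "W \<subseteq> lspan K M (b ` {..<r})"
    and piv: "pivots r b W \<subseteq> pivots r b V"
  shows "V = W"
proof -
  have "i \<le> r \<Longrightarrow> W \<inter> lspan K M (b ` {..<i}) \<subseteq> V" for i
  proof (induction i)
    case 0
    have "x = \<zero>\<^bsub>M\<^esub>" if "x \<in> lspan K M (b ` {..<0})" for x
      using that by cases auto
    then show ?case using V unfolding subspace_def by auto
  next
    case (Suc i)
    have bi: "b i \<in> carrier M" and bs: "b ` {..<i} \<subseteq> carrier M"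
      and bSi: "b ` {..<Suc i} \<subseteq> carrier M" using b Suc by auto
    have lc: "lspan K M (b ` {..<i}) \<subseteq> carrier M" using lspan_closed[OF K_closed bs] .
    show ?case
    proof
      fix w assume w: "w \<in> W \<inter> lspan K M (b ` {..<Suc i})"
      then obtain c y where c: "c \<in> K" "y \<in> lspan K M (b ` {..<i})" and weq: "w = c \<bullet> b i \<boxplus> y"
        using lspan_Suc[OF bSi] by blast
      have cR: "c \<in> carrier R" and yM: "y \<in> carrier M" using c K_closed lc by auto
      show "w \<in> V"
      proof (cases "c = \<zero>")
        case True
        then have "w = y" using weq bi yM by simp
        then show ?thesis using w c Suc by auto
      next
        case False
        then obtain d where d: "d \<in> K" "d \<otimes> c = \<one>" using K_inverse c by blast
        have dR: "d \<in> carrier R" using d K_closed by auto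
        have "d \<bullet> w = b i \<boxplus> d \<bullet> y"
          using weq dR cR yM bi d by (simp add: smult_r_distr smult_assoc1[symmetric])
        moreover have "d \<bullet> w \<in> W" using W w d unfolding subspace_def by auto
        moreover have "d \<bullet> y \<in> lspan K M (b ` {..<i})"
          using subspace_lspan[OF bs] c d unfolding subspace_def by auto
        ultimately have "i \<in> pivots r b W" using Suc unfolding pivots_def by auto
        then obtain z where z: "z \<in> lspan K M (b ` {..<i})" "b i \<boxplus> z \<in> V"
          using piv unfolding pivots_def by auto
        have zM: "z \<in> carrier M" using z lc by auto
        let ?v = "c \<bullet> (b i \<boxplus> z)"
        have vV: "?v \<in> V" using V z c unfolding subspace_def by auto
        let ?t = "y \<boxplus> (\<ominus> c) \<bullet> z"
        have t_lspan: "?t \<in> lspan K M (b ` {..<i})"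
          using subspace_lspan[OF bs] c z K_ops unfolding subspace_def by auto
        have tM: "?t \<in> carrier M" using t_lspan lc by auto
        have "?v \<boxplus> ?t = (c \<bullet> b i \<boxplus> y) \<boxplus> (c \<bullet> z \<boxplus> (\<ominus> c) \<bullet> z)"
          using cR yM zM bi by (simp add: smult_r_distr M.a_ac)
        also have "c \<bullet> z \<boxplus> (\<ominus> c) \<bullet> z = \<zero>\<^bsub>M\<^esub>"
          using cR zM by (simp add: smult_l_minus M.r_neg)
        finally have weq2: "w = ?v \<boxplus> ?t" using weq cR yM bi by simp
        have vM: "?v \<in> carrier M" using cR bi zM by auto
        have "?t = (\<ominus> \<one>) \<bullet> ?v \<boxplus> w"
        proof -
          have "(\<ominus> \<one>) \<bullet> ?v \<boxplus> w = (\<ominus>\<^bsub>M\<^esub> ?v \<boxplus> ?v) \<boxplus> ?t"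
            unfolding weq2 using vM tM by (simp add: smult_l_minus M.a_assoc)
          then show ?thesis using vM tM by (simp add: M.l_neg)
        qed
        moreover have "(\<ominus> \<one>) \<bullet> ?v \<boxplus> w \<in> W"
          using W w vV VW K_ops unfolding subspace_def by blast
        ultimately have "?t \<in> V" using Suc t_lspan by auto
        then show ?thesis using weq2 vV V unfolding subspace_def by auto
      qed
    qed
  qed
  then show ?thesis using VW Wb by blast
qed

text \<open>Each strict step of the chain loses a pivot, and no pivot is lost twice.\<close>

lemma card_jumps_le:
  assumes b: "b ` {..<r} \<subseteq> carrier M" and V: "\<And>n. subspace (V n)"
    and dec: "\<And>n. V (Suc n) \<subseteq> V n" and Vb: "\<And>n. V n \<subseteq> lspan K M (b ` {..<r})"
  shows "finite {n. V n \<noteq> V (Suc n)}" "card {n. V n \<noteq> V (Suc n)} \<le> r"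
proof -
  let ?J = "{n. V n \<noteq> V (Suc n)}"
  have anti: "V n \<subseteq> V m" if "m \<le> n" for m n
    using that dec by (rule lift_Suc_antimono_le[rotated])
  have "\<exists>i. i \<in> pivots r b (V n) \<and> i \<notin> pivots r b (V (Suc n))" if "n \<in> ?J" for n
    using subspace_eqI_pivots[OF b V[of "Suc n"] V[of n] dec Vb] that by blast
  then obtain \<iota> where \<iota>: "\<And>n. n \<in> ?J \<Longrightarrow> \<iota> n \<in> pivots r b (V n) \<and> \<iota> n \<notin> pivots r b (V (Suc n))"
    by metis
  have "\<iota> m \<noteq> \<iota> n" if "m \<in> ?J" "n \<in> ?J" "m < n" for m n
  proof -
    have "V n \<subseteq> V (Suc m)" using that by (intro anti) auto
    then have "pivots r b (V n) \<subseteq> pivots r b (V (Suc m))" unfolding pivots_def by blast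
    then show ?thesis using \<iota>[OF that(1)] \<iota>[OF that(2)] by auto
  qed
  then have inj: "inj_on \<iota> ?J"
    by (intro linorder_inj_onI) auto
  have sub: "\<iota> ` ?J \<subseteq> {..<r}" using \<iota> unfolding pivots_def by auto
  show "finite ?J" using inj_on_finite[OF inj sub] by simp
  show "card ?J \<le> r" using card_inj_on_le[OF inj sub] by simp
qed

end

section \<open>Cartier maps over a ring that is finitely generated over a field\<close>

locale cartier_map = Module.module R M for R (structure) and M (structure) +
  fixes q :: nat and C :: "'c \<Rightarrow> 'c"
  assumes q: "q \<ge> 2"
    and C_closed: "\<And>x. x \<in> carrier M \<Longrightarrow> C x \<in> carrier M"
    and C_add: "\<And>x y. x \<in> carrier M \<Longrightarrow> y \<in> carrier M \<Longrightarrow> C (x \<boxplus> y) = C x \<boxplus> C y"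
    and C_smult: "\<And>a x. a \<in> carrier R \<Longrightarrow> x \<in> carrier M \<Longrightarrow>
      C ((a [^] q) \<bullet> x) = a \<bullet> C x"
begin

lemma C_zero: "C \<zero>\<^bsub>M\<^esub> = \<zero>\<^bsub>M\<^esub>"
  using C_add[of "\<zero>\<^bsub>M\<^esub>" "\<zero>\<^bsub>M\<^esub>"] C_closed[of "\<zero>\<^bsub>M\<^esub>"] by (simp add: M.add.l_cancel_one')

lemma C_pow_closed: "x \<in> carrier M \<Longrightarrow> (C ^^ m) x \<in> carrier M"
  by (induction m) (auto simp: C_closed)

lemma C_pow_zero: "(C ^^ m) \<zero>\<^bsub>M\<^esub> = \<zero>\<^bsub>M\<^esub>"
  by (induction m) (auto simp: C_zero)

lemma C_pow_add:
  "x \<in> carrier M \<Longrightarrow> y \<in> carrier M \<Longrightarrow> (C ^^ m) (x \<boxplus> y) = (C ^^ m) x \<boxplus> (C ^^ m) y"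
  by (induction m) (auto simp: C_add C_pow_closed)

lemma C_pow_smult:
  assumes "x \<in> carrier M"
  shows "a \<in> carrier R \<Longrightarrow> (C ^^ m) ((a [^] (q ^ m)) \<bullet> x) = a \<bullet> (C ^^ m) x"
proof (induction m arbitrary: a)
  case 0
  then show ?case using assms by simp
next
  case (Suc m)
  have "a [^] (q ^ Suc m) = (a [^] q) [^] (q ^ m)"
    using Suc by (simp add: R.nat_pow_pow)
  then show ?case using Suc assms by (simp add: C_smult C_pow_closed)
qed

text \<open>This is \<open>C\<^sup>m(f\<^sup>nN)\<close>, where \<open>N\<close> is the submodule spanned by \<open>H\<close>.\<close>

definition trace :: "'a \<Rightarrow> 'c set \<Rightarrow> nat \<Rightarrow> nat \<Rightarrow> 'c set" where
  "trace f H m n = (C ^^ m) ` lspan (carrier R) M ((\<lambda>h. (f [^] n) \<bullet> h) ` H)"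

lemma trace_closed:
  assumes "f \<in> carrier R" "H \<subseteq> carrier M"
  shows "trace f H m n \<subseteq> carrier M"
    and "\<zero>\<^bsub>M\<^esub> \<in> trace f H m n"
    and "x \<in> trace f H m n \<Longrightarrow> y \<in> trace f H m n \<Longrightarrow> x \<boxplus> y \<in> trace f H m n"
    and "a \<in> carrier R \<Longrightarrow> x \<in> trace f H m n \<Longrightarrow> a \<bullet> x \<in> trace f H m n"
proof -
  let ?F = "(\<lambda>h. (f [^] n) \<bullet> h) ` H"
  let ?L = "lspan (carrier R) M ?F"
  have F: "?F \<subseteq> carrier M" using assms by auto
  have L: "?L \<subseteq> carrier M" using lspan_closed[OF _ F] by auto
  show "trace f H m n \<subseteq> carrier M" unfolding trace_def using L C_pow_closed by auto
  show "\<zero>\<^bsub>M\<^esub> \<in> trace f H m n" unfolding trace_def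
    using C_pow_zero lspan_zero by (metis image_eqI)
  show "x \<boxplus> y \<in> trace f H m n" if xy: "x \<in> trace f H m n" "y \<in> trace f H m n"
  proof -
    obtain s t where st: "s \<in> ?L" "t \<in> ?L" "x = (C ^^ m) s" "y = (C ^^ m) t"
      using xy unfolding trace_def by blast
    have "x \<boxplus> y = (C ^^ m) (s \<boxplus> t)" using st L C_pow_add[of s t m] by (simp add: subset_iff)
    then show ?thesis unfolding trace_def using lspan_add[OF _ F st(1,2)] by auto
  qed
  show "a \<bullet> x \<in> trace f H m n" if a: "a \<in> carrier R" and x: "x \<in> trace f H m n"
  proof -
    obtain s where s: "s \<in> ?L" "x = (C ^^ m) s"
      using x unfolding trace_def by blast
    have "a \<bullet> x = (C ^^ m) ((a [^] (q ^ m)) \<bullet> s)" using s L C_pow_smult[of s a m] a by (simp add: subset_iff)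
    then show ?thesis unfolding trace_def using lspan_R_smult[OF F _ s(1)] a by auto
  qed
qed

lemma trace_Suc:
  assumes "f \<in> carrier R" "H \<subseteq> carrier M"
  shows "trace f H m (Suc n) \<subseteq> trace f H m n"
proof -
  have F: "(\<lambda>h. (f [^] n) \<bullet> h) ` H \<subseteq> carrier M" using assms by auto
  have "(f [^] Suc n) \<bullet> h \<in> lspan (carrier R) M ((\<lambda>h. (f [^] n) \<bullet> h) ` H)" if "h \<in> H" for h
  proof -
    have "(f [^] Suc n) \<bullet> h = f \<bullet> ((f [^] n) \<bullet> h)"
      using assms that by (simp add: smult_assoc1[symmetric] m_comm subset_iff)
    then show ?thesis using that F assms by (auto intro!: lspan_R_smult[OF _ _ lspan_R_incl])
  qed
  then show ?thesis unfolding trace_def by (intro image_mono lspan_subset_lspan[OF F]) auto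
qed

end

text \<open>F-finiteness of the field \<open>K\<close> is stated through its action on \<open>M\<close>: the multiples of \<open>y\<close> by scalars are
  combinations of the finitely many elements \<open>by\<close>, \<open>b \<in> B\<close>, whose coefficients are \<open>q\<close>-th powers.
  This is the form in which \<open>C\<close> can use it.\<close>

locale cartier_algebra = scalar_field R M K + cartier_map R M q C
  for R (structure) and M (structure) and K q C +
  fixes T B :: "'a set"
  assumes T: "finite T" "T \<subseteq> carrier R"
    and generated: "carrier R = generate_ring R (K \<union> T)"
    and B: "finite B" "B \<subseteq> carrier R"
    and F_finite: "\<And>c y. c \<in> K \<Longrightarrow> y \<in> carrier M \<Longrightarrow>
      c \<bullet> y \<in> lspan ((\<lambda>a. a [^] q) ` K) M ((\<lambda>b. b \<bullet> y) ` B)"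
begin

definition mon :: "('a \<Rightarrow> nat) \<Rightarrow> 'a" where
  "mon e = (\<Otimes>x\<in>T. x [^] e x)"

definition deg :: "('a \<Rightarrow> nat) \<Rightarrow> nat" where
  "deg e = (\<Sum>x\<in>T. e x)"

lemma mon_closed [simp, intro]: "mon e \<in> carrier R"
  unfolding mon_def using T by (intro finprod_closed) auto

lemma mon_zero: "mon (\<lambda>_. 0) = \<one>"
  unfolding mon_def using T by (intro finprod_one_eqI) auto

lemma mon_add: "mon (\<lambda>x. d x + e x) = mon d \<otimes> mon e"
proof -
  have "mon (\<lambda>x. d x + e x) = (\<Otimes>x\<in>T. x [^] d x \<otimes> x [^] e x)"
    unfolding mon_def using T by (intro finprod_cong') (auto simp: nat_pow_mult subset_iff)
  also have "\<dots> = mon d \<otimes> mon e"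
    unfolding mon_def using T by (intro finprod_multf) auto
  finally show ?thesis .
qed

lemma mon_pow: "mon (\<lambda>x. n * e x) = mon e [^] (n::nat)"
proof (induction n)
  case (Suc n)
  have "mon (\<lambda>x. Suc n * e x) = mon (\<lambda>x. e x + n * e x)" by (simp add: algebra_simps)
  then show ?case using Suc by (simp add: mon_add m_comm)
qed (simp add: mon_zero)

lemma mon_single:
  assumes "x \<in> T"
  shows "mon (\<lambda>y. if x = y then 1 else 0) = x"
proof -
  have "mon (\<lambda>y. if x = y then 1 else 0) = (\<Otimes>y\<in>T. if x = y then y else \<one>)"
    unfolding mon_def using T by (intro finprod_cong') auto
  also have "\<dots> = x"
    using finprod_singleton[OF assms T(1), of "\<lambda>y. y"] T(2) by auto
  finally show ?thesis .
qed

lemma deg_single: "x \<in> T \<Longrightarrow> deg (\<lambda>y. if x = y then 1 else 0) = 1"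
  unfolding deg_def using T by simp

lemma deg_add: "deg (\<lambda>x. d x + e x) = deg d + deg e"
  unfolding deg_def by (simp add: sum.distrib)

lemma mon_restrict: "mon (restrict e T) = mon e"
  unfolding mon_def using T by (intro finprod_cong') auto

text \<open>Division of exponents with remainder splits off an \<open>n\<close>-th power. With \<open>n = q\<^sup>m\<close> this is the factor
  that can be taken out of \<open>C\<^sup>m\<close>; the remaining monomial has bounded exponents.\<close>

lemma mon_div_mod: "mon e = mon (\<lambda>x. e x div n) [^] n \<otimes> mon (\<lambda>x. e x mod n)"
  by (simp add: mon_pow[symmetric] mon_add[symmetric])

lemma sum_div_le: "(\<Sum>x\<in>Y. e x div n) \<le> (\<Sum>x\<in>Y. e x) div (n::nat)"
proof (cases "finite Y")
  case True
  then show ?thesis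
  proof (induction Y)
    case (insert y Y)
    have "e y div n + (\<Sum>x\<in>Y. e x) div n \<le> (e y + (\<Sum>x\<in>Y. e x)) div n"
      by (subst div_add1_eq[of "e y"]) simp
    then show ?case using insert by simp
  qed simp
qed simp

lemma deg_div: "deg (\<lambda>x. e x div n) \<le> deg e div n"
  unfolding deg_def by (rule sum_div_le)

lemma deg_mod: "n > 0 \<Longrightarrow> deg (\<lambda>x. e x mod n) \<le> card T * n"
  unfolding deg_def using sum_bounded_above[of T "\<lambda>x. e x mod n" n]
  by (simp add: less_imp_le)

definition mons_upto :: "'c set \<Rightarrow> nat \<Rightarrow> 'c set" where
  "mons_upto G D = {mon e \<bullet> g | e g. g \<in> G \<and> deg e \<le> D}"

text \<open>The degree filtration: the image of the vectors of polynomials of degree at most \<open>D\<close> over \<open>K\<close> in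
  the variables \<open>T\<close>, with one component for each member of \<open>G\<close>.\<close>

definition Fil :: "'c set \<Rightarrow> nat \<Rightarrow> 'c set" where
  "Fil G D = lspan K M (mons_upto G D)"

lemma mons_upto_closed: "G \<subseteq> carrier M \<Longrightarrow> mons_upto G D \<subseteq> carrier M"
  unfolding mons_upto_def by auto

lemma subspace_Fil: "G \<subseteq> carrier M \<Longrightarrow> subspace (Fil G D)"
  unfolding Fil_def by (intro subspace_lspan mons_upto_closed)

lemma Fil_mono: "D \<le> D' \<Longrightarrow> Fil G D \<subseteq> Fil G D'"
  unfolding Fil_def
proof (rule lspan_mono)
  assume "D \<le> D'"
  then show "mons_upto G D \<subseteq> mons_upto G D'" unfolding mons_upto_def by (blast intro: le_trans)
qed simp

text \<open>Only the exponents of the members of \<open>T\<close> matter, and each of them is at most \<open>D\<close>.\<close>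

lemma finite_mons_upto: "finite G \<Longrightarrow> finite (mons_upto G D)"
proof -
  assume G: "finite G"
  have "mons_upto G D \<subseteq> (\<lambda>(e, g). mon e \<bullet> g) ` ((T \<rightarrow>\<^sub>E {..D}) \<times> G)"
  proof
    fix y assume "y \<in> mons_upto G D"
    then obtain e g where eg: "g \<in> G" "deg e \<le> D" "y = mon e \<bullet> g"
      unfolding mons_upto_def by auto
    have "e x \<le> D" if "x \<in> T" for x
      using that eg(2) T member_le_sum[of x T e] unfolding deg_def by auto
    then have "(restrict e T, g) \<in> (T \<rightarrow>\<^sub>E {..D}) \<times> G" using eg by auto
    moreover have "y = (\<lambda>(e, g). mon e \<bullet> g) (restrict e T, g)"
      using eg by (simp add: mon_restrict)
    ultimately show "y \<in> (\<lambda>(e, g). mon e \<bullet> g) ` ((T \<rightarrow>\<^sub>E {..D}) \<times> G)" by blast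
  qed
  moreover have "finite ((T \<rightarrow>\<^sub>E {..D}) \<times> G)" using T G by (intro finite_cartesian_product finite_PiE) auto
  ultimately show ?thesis by (meson finite_imageI finite_subset)
qed

lemma Fil_mon:
  assumes G: "G \<subseteq> carrier M" and z: "z \<in> Fil G D"
  shows "mon e \<bullet> z \<in> Fil G (D + deg e)"
  using z unfolding Fil_def
proof (rule lspan_hom[OF module_axioms K_closed mons_upto_closed[OF G]])
  fix c m assume c: "c \<in> K" and "m \<in> mons_upto G D"
  then obtain e' g where m: "g \<in> G" "deg e' \<le> D" "m = mon e' \<bullet> g"
    unfolding mons_upto_def by auto
  let ?e = "\<lambda>x. e' x + e x"
  have cR: "c \<in> carrier R" and gM: "g \<in> carrier M" using c K_closed m G by auto
  have "mon e \<bullet> (c \<bullet> m) = c \<bullet> (mon ?e \<bullet> g)"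
    unfolding mon_add m(3) using cR gM by (simp add: smult_assoc1[symmetric] m_ac)
  moreover have "mon ?e \<bullet> g \<in> mons_upto G (D + deg e)"
    unfolding mons_upto_def using m deg_add[of e' e]
    by (auto intro!: exI[of _ ?e] exI[of _ g])
  ultimately show "\<exists>a'\<in>K. \<exists>g'\<in>mons_upto G (D + deg e). mon e \<bullet> (c \<bullet> m) = a' \<bullet> g'"
    using c by blast
qed (auto simp: smult_r_distr)

text \<open>A bound \<open>\<delta>\<close> for the degree of \<open>a\<close>, by induction over the generation of \<open>R\<close> by \<open>K\<close> and \<open>T\<close>.\<close>

lemma Fil_smult:
  assumes G: "G \<subseteq> carrier M" and a: "a \<in> carrier R"
  shows "\<exists>\<delta>. \<forall>D. \<forall>y\<in>Fil G D. a \<bullet> y \<in> Fil G (D + \<delta>)"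
proof -
  have sub: "subspace (Fil G D)" for D using subspace_Fil[OF G] .
  have cl: "Fil G D \<subseteq> carrier M" for D using sub unfolding subspace_def by auto
  have KX: "K \<union> T \<subseteq> carrier R" using K_closed T by auto
  have "a \<in> generate_ring R (K \<union> T)" using a generated by simp
  then show ?thesis
  proof (induction rule: generate_ring.induct)
    case one
    show ?case using cl by (intro exI[of _ 0]) (simp add: subset_iff)
  next
    case (incl h)
    then consider "h \<in> K" | "h \<in> T" by auto
    then show ?case
    proof cases
      case 1
      then show ?thesis using sub unfolding subspace_def by (intro exI[of _ 0]) auto
    next
      case 2
      have "h \<bullet> y \<in> Fil G (D + 1)" if "y \<in> Fil G D" for y D
        using Fil_mon[OF G that, of "\<lambda>x. if h = x then 1 else 0"] 2
        by (simp add: mon_single deg_single)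
      then show ?thesis by blast
    qed
  next
    case (a_inv h)
    then obtain \<delta> where \<delta>: "\<forall>D. \<forall>y\<in>Fil G D. h \<bullet> y \<in> Fil G (D + \<delta>)" by blast
    have hR: "h \<in> carrier R" using a_inv generate_ring_in_carrier[OF KX] by auto
    have "(\<ominus> h) \<bullet> y \<in> Fil G (D + \<delta>)" if "y \<in> Fil G D" for y D
    proof -
      have y: "y \<in> carrier M" using that cl by auto
      have "(\<ominus> \<one>) \<bullet> (h \<bullet> y) \<in> Fil G (D + \<delta>)"
        using \<delta> that sub[of "D + \<delta>"] K_ops unfolding subspace_def by blast
      moreover have "(\<ominus> \<one>) \<bullet> (h \<bullet> y) = (\<ominus> h) \<bullet> y"
        using hR y by (simp add: smult_l_minus)
      ultimately show ?thesis by simp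
    qed
    then show ?case by blast
  next
    case (eng_add h1 h2)
    then obtain \<delta>1 \<delta>2 where \<delta>: "\<forall>D. \<forall>y\<in>Fil G D. h1 \<bullet> y \<in> Fil G (D + \<delta>1)"
      "\<forall>D. \<forall>y\<in>Fil G D. h2 \<bullet> y \<in> Fil G (D + \<delta>2)" by blast
    have hR: "h1 \<in> carrier R" "h2 \<in> carrier R"
      using eng_add generate_ring_in_carrier[OF KX] by auto
    have "(h1 \<oplus> h2) \<bullet> y \<in> Fil G (D + (\<delta>1 + \<delta>2))" if "y \<in> Fil G D" for y D
    proof -
      have "h1 \<bullet> y \<in> Fil G (D + (\<delta>1 + \<delta>2))" "h2 \<bullet> y \<in> Fil G (D + (\<delta>1 + \<delta>2))"
        using \<delta> that Fil_mono[of "D + \<delta>1" "D + (\<delta>1 + \<delta>2)" G] Fil_mono[of "D + \<delta>2" "D + (\<delta>1 + \<delta>2)" G]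
        by auto
      moreover have "y \<in> carrier M" using that cl by auto
      ultimately show ?thesis using sub[of "D + (\<delta>1 + \<delta>2)"] hR unfolding subspace_def
        by (simp add: smult_l_distr)
    qed
    then show ?case by blast
  next
    case (eng_mult h1 h2)
    then obtain \<delta>1 \<delta>2 where \<delta>: "\<forall>D. \<forall>y\<in>Fil G D. h1 \<bullet> y \<in> Fil G (D + \<delta>1)"
      "\<forall>D. \<forall>y\<in>Fil G D. h2 \<bullet> y \<in> Fil G (D + \<delta>2)" by blast
    have hR: "h1 \<in> carrier R" "h2 \<in> carrier R"
      using eng_mult generate_ring_in_carrier[OF KX] by auto
    have "(h1 \<otimes> h2) \<bullet> y \<in> Fil G (D + (\<delta>2 + \<delta>1))" if "y \<in> Fil G D" for y D
    proof -
      have "h1 \<bullet> (h2 \<bullet> y) \<in> Fil G (D + (\<delta>2 + \<delta>1))"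
        using \<delta> that by (metis add.assoc)
      moreover have "y \<in> carrier M" using that cl by auto
      ultimately show ?thesis using hR by (simp add: smult_assoc1)
    qed
    then show ?case by blast
  qed
qed

lemma Fil_subset_lspan: 
  assumes G: "G \<subseteq> carrier M"
  shows "Fil G D \<subseteq> lspan (carrier R) M G"
proof
  fix y assume "y \<in> Fil G D"
  then show "y \<in> lspan (carrier R) M G" unfolding Fil_def
  proof (rule lspan_least)
    fix c m assume "c \<in> K" "m \<in> mons_upto G D"
    then show "c \<bullet> m \<in> lspan (carrier R) M G"
      unfolding mons_upto_def using G K_closed
      by (auto intro!: lspan_R_smult[OF _ _ lspan_R_smult[OF _ _ lspan_R_incl]])
  qed (use G in \<open>auto intro: lspan_zero lspan_add\<close>)
qed

lemma lspan_eq_Fil: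
  assumes G: "G \<subseteq> carrier M"
  shows "lspan (carrier R) M G = (\<Union>D. Fil G D)"
proof
  have sub: "subspace (Fil G D)" for D using subspace_Fil[OF G] .
  show "lspan (carrier R) M G \<subseteq> (\<Union>D. Fil G D)"
  proof
    fix y assume "y \<in> lspan (carrier R) M G"
    then show "y \<in> (\<Union>D. Fil G D)"
    proof (rule lspan_least)
      show "\<zero>\<^bsub>M\<^esub> \<in> (\<Union>D. Fil G D)" using sub unfolding subspace_def by auto
    next
      fix x y assume "x \<in> (\<Union>D. Fil G D)" "y \<in> (\<Union>D. Fil G D)"
      then obtain D D' where "x \<in> Fil G D" "y \<in> Fil G D'" by auto
      then have "x \<in> Fil G (max D D')" "y \<in> Fil G (max D D')"
        using Fil_mono[of D "max D D'" G] Fil_mono[of D' "max D D'" G] by auto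
      then have "x \<boxplus> y \<in> Fil G (max D D')" using sub unfolding subspace_def by auto
      then show "x \<boxplus> y \<in> (\<Union>D. Fil G D)" by blast
    next
      fix a g assume a: "a \<in> carrier R" and g: "g \<in> G"
      have gM: "g \<in> carrier M" using g G by auto
      have "mon (\<lambda>_. 0) \<bullet> g \<in> mons_upto G 0"
        unfolding mons_upto_def deg_def using g by (auto intro!: exI[of _ "\<lambda>_. 0"])
      then have "g \<in> mons_upto G 0" using gM by (simp add: mon_zero)
      then have "g \<in> Fil G 0" unfolding Fil_def
        using K_closed K_ops mons_upto_closed[OF G] by (intro lspan_incl) auto
      then show "a \<bullet> g \<in> (\<Union>D. Fil G D)" using Fil_smult[OF G a] by blast
    qed
  qed
  show "(\<Union>D. Fil G D) \<subseteq> lspan (carrier R) M G" using Fil_subset_lspan[OF G] by auto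
qed

lemma finite_subset_Fil:
  assumes G: "G \<subseteq> carrier M" and Y: "finite Y" "Y \<subseteq> lspan (carrier R) M G"
  shows "\<exists>D. Y \<subseteq> Fil G D"
  using Y
proof (induction Y)
  case (insert y Y)
  then obtain D D' where "Y \<subseteq> Fil G D" "y \<in> Fil G D'" using lspan_eq_Fil[OF G] by auto
  then have "insert y Y \<subseteq> Fil G (max D D')"
    using Fil_mono[of D "max D D'" G] Fil_mono[of D' "max D D'" G] by auto
  then show ?case by blast
qed simp

text \<open>Finitely many values that determine \<open>C\<close> on the span of \<open>G\<close>: every scalar is a combination of \<open>B\<close>
  with \<open>q\<close>-th powers as coefficients, every monomial is a \<open>q\<close>-th power times a monomial with exponents
  less than \<open>q\<close>, and \<open>q\<close>-th powers come out of \<open>C\<close>.\<close>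

definition gens :: "'c set \<Rightarrow> 'c set" where
  "gens G = {C (b \<bullet> (mon r \<bullet> g)) | b r g. b \<in> B \<and> r \<in> T \<rightarrow>\<^sub>E {..<q} \<and> g \<in> G}"

lemma finite_gens:
  assumes "finite G"
  shows "finite (gens G)"
proof -
  have "gens G = (\<lambda>(b, r, g). C (b \<bullet> (mon r \<bullet> g))) ` (B \<times> (T \<rightarrow>\<^sub>E {..<q}) \<times> G)"
    unfolding gens_def by force
  then show ?thesis using assms B T by (auto intro!: finite_imageI finite_cartesian_product finite_PiE)
qed

lemma gens_closed: "G \<subseteq> carrier M \<Longrightarrow> gens G \<subseteq> carrier M"
  unfolding gens_def using B by (auto intro!: C_closed smult_closed)

text \<open>An induction principle for the values of \<open>C\<close> on elements of bounded degree: it suffices to treat the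
  multiples of \<open>gens G\<close> by scalars and by monomials of degree at most \<open>D div q\<close>.\<close>

lemma C_Fil_least:
  assumes G: "G \<subseteq> carrier M" and y: "y \<in> Fil G D"
    and Z: "\<zero>\<^bsub>M\<^esub> \<in> Z" "\<And>x y. x \<in> Z \<Longrightarrow> y \<in> Z \<Longrightarrow> x \<boxplus> y \<in> Z"
    and gZ: "\<And>a e z. a \<in> K \<Longrightarrow> deg e \<le> D div q \<Longrightarrow> z \<in> gens G \<Longrightarrow> a \<bullet> (mon e \<bullet> z) \<in> Z"
  shows "C y \<in> Z"
proof -
  have qK: "(\<lambda>a. a [^] q) ` K \<subseteq> carrier R" using K_closed by auto
  have mono: "C (c \<bullet> m) \<in> Z" if c: "c \<in> K" and "m \<in> mons_upto G D" for c m
  proof -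
    obtain e g where g: "g \<in> G" and e: "deg e \<le> D" and m: "m = mon e \<bullet> g"
      using \<open>m \<in> mons_upto G D\<close> unfolding mons_upto_def by auto
    have gM: "g \<in> carrier M" using g G by auto
    have mM: "m \<in> carrier M" using m gM by simp
    have BM: "(\<lambda>b. b \<bullet> m) ` B \<subseteq> carrier M" using B mM by auto
    let ?d = "\<lambda>x. e x div q" and ?r = "\<lambda>x. e x mod q"
    have C_val: "C ((a [^] q) \<bullet> (b \<bullet> m)) \<in> Z" if a: "a \<in> K" and b: "b \<in> B" for a b
    proof -
      let ?w = "b \<bullet> (mon ?r \<bullet> g)"
      have aR: "a \<in> carrier R" and bR: "b \<in> carrier R" using a b K_closed B by auto
      have "b \<bullet> m = (mon ?d [^] q) \<bullet> ?w"
        unfolding m mon_div_mod[of e q] using bR gM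
        by (simp add: smult_assoc1[symmetric] m_ac)
      then have "C ((a [^] q) \<bullet> (b \<bullet> m)) = a \<bullet> (mon ?d \<bullet> C ?w)"
        using aR bR gM by (simp add: C_smult)
      moreover have "C ?w \<in> gens G"
        unfolding gens_def using b g q
        by (auto intro!: exI[of _ b] exI[of _ "restrict ?r T"] exI[of _ g] simp: mon_restrict)
      moreover have "deg ?d \<le> D div q"
        using deg_div[of e q] div_le_mono[OF e, of q] by simp
      ultimately show ?thesis using gZ a by metis
    qed
    let ?Z = "{z \<in> carrier M. C z \<in> Z}"
    have "c \<bullet> m \<in> lspan ((\<lambda>a. a [^] q) ` K) M ((\<lambda>b. b \<bullet> m) ` B)"
      using F_finite[OF c mM] .
    then have "c \<bullet> m \<in> ?Z"
    proof (rule lspan_least)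
      fix a g assume "a \<in> (\<lambda>a. a [^] q) ` K" "g \<in> (\<lambda>b. b \<bullet> m) ` B"
      then show "a \<bullet> g \<in> ?Z" using C_val K_closed B mM
        by (auto simp: subset_iff)
    qed (use Z C_zero C_add in auto)
    then show ?thesis by simp
  qed
  let ?Z = "{z \<in> carrier M. C z \<in> Z}"
  have "y \<in> ?Z"
    using y unfolding Fil_def
  proof (rule lspan_least)
    fix c m assume "c \<in> K" "m \<in> mons_upto G D"
    then show "c \<bullet> m \<in> ?Z" using mono K_closed mons_upto_closed[OF G, of D] by (simp add: subset_iff)
  qed (use Z C_zero C_add in auto)
  then show ?thesis by simp
qed

lemma C_lspan_gens:
  assumes G: "G \<subseteq> carrier M" and y: "y \<in> lspan (carrier R) M G"
  shows "C y \<in> lspan (carrier R) M (gens G)"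
proof -
  obtain D where "y \<in> Fil G D" using y lspan_eq_Fil[OF G] by auto
  then show ?thesis
    by (rule C_Fil_least[OF G])
      (use gens_closed[OF G] K_closed in
        \<open>auto intro!: lspan_zero lspan_add lspan_R_smult[OF _ _ lspan_R_smult[OF _ _ lspan_R_incl]]\<close>)
qed

text \<open>The constant \<open>k\<close> bounds the degrees of the finitely many elements of \<open>gens G\<close>.\<close>

lemma C_Fil:
  assumes G: "G \<subseteq> carrier M" "finite G" and stable: "\<And>y. y \<in> lspan (carrier R) M G \<Longrightarrow> C y \<in> lspan (carrier R) M G"
  shows "\<exists>k. \<forall>D. \<forall>y\<in>Fil G D. C y \<in> Fil G (D div q + k)"
proof -
  have "gens G \<subseteq> lspan (carrier R) M G"
    unfolding gens_def using G B
    by (auto intro!: stable lspan_R_smult[OF _ _ lspan_R_smult[OF _ _ lspan_R_incl]])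
  then obtain k where k: "gens G \<subseteq> Fil G k"
    using finite_subset_Fil[OF G(1) finite_gens[OF G(2)]] by blast
  have sub: "subspace (Fil G D)" for D using subspace_Fil[OF G(1)] .
  have "C y \<in> Fil G (D div q + k)" if "y \<in> Fil G D" for y D
    using that
  proof (rule C_Fil_least[OF G(1)])
    fix a e z assume a: "a \<in> K" and e: "deg e \<le> D div q" and z: "z \<in> gens G"
    have "mon e \<bullet> z \<in> Fil G (k + D div q)"
    proof -
      have "mon e \<bullet> z \<in> Fil G (k + deg e)"
        using z k by (intro Fil_mon[OF G(1)]) auto
      then show ?thesis using Fil_mono[of "k + deg e" "k + D div q" G] e by auto
    qed
    then show "a \<bullet> (mon e \<bullet> z) \<in> Fil G (D div q + k)"
      using sub[of "D div q + k"] a unfolding subspace_def by (simp add: add.commute)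
  qed (use sub in \<open>auto simp: subspace_def\<close>)
  then show ?thesis by blast
qed

text \<open>The additive term \<open>2 * k\<close> does not grow under the step \<open>t \<mapsto> t div q + k\<close>, as \<open>q\<close> is at least \<open>2\<close>. This
  keeps the bound independent of \<open>m\<close>.\<close>

lemma C_pow_Fil:
  assumes k: "\<forall>D. \<forall>y\<in>Fil G D. C y \<in> Fil G (D div q + k)"
  shows "y \<in> Fil G (q ^ m * a + 2 * k) \<Longrightarrow> (C ^^ m) y \<in> Fil G (a + 2 * k)"
proof (induction m arbitrary: y)
  case (Suc m)
  have "(q ^ Suc m * a + 2 * k) div q = q ^ m * a + 2 * k div q"
    using q by (simp add: mult.assoc)
  moreover have "2 * k div q \<le> 2 * k div 2" using q by (intro div_le_mono2) auto
  ultimately have "(q ^ Suc m * a + 2 * k) div q + k \<le> q ^ m * a + 2 * k" by simp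
  moreover have "C y \<in> Fil G ((q ^ Suc m * a + 2 * k) div q + k)" using k Suc.prems by blast
  ultimately have "C y \<in> Fil G (q ^ m * a + 2 * k)" using Fil_mono by blast
  then show ?case using Suc.IH by (simp add: funpow_Suc_right del: funpow.simps)
qed simp

text \<open>With \<open>Q = q\<^sup>m\<close>, the element \<open>C\<^sup>m(cxf\<^sup>nh)\<close> is the product of the monomial with exponents \<open>e div Q\<close> and
  of \<open>C\<^sup>m(cx'f\<^sup>nh)\<close>, where \<open>e\<close> are the exponents of \<open>x\<close> and \<open>x'\<close> has the exponents \<open>e mod Q\<close>. The degree of
  \<open>cx'f\<^sup>nh\<close> is at most \<open>Q\<close> times a constant, and \<open>C_pow_Fil\<close> applies.\<close>

lemma trace_generated_in_bounded_degree:
  assumes G: "G \<subseteq> carrier M" "finite G"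
    and stable: "\<And>y. y \<in> lspan (carrier R) M G \<Longrightarrow> C y \<in> lspan (carrier R) M G"
    and H: "H \<subseteq> lspan (carrier R) M G" "finite H" and f: "f \<in> carrier R"
  shows "\<exists>E. \<forall>m n. n \<le> q ^ m \<longrightarrow>
    trace f H m n \<subseteq> lspan (carrier R) M (trace f H m n \<inter> Fil G E)"
proof -
  have HM: "H \<subseteq> carrier M" using H lspan_closed[OF _ G(1)] by blast
  have sub: "subspace (Fil G D)" for D using subspace_Fil[OF G(1)] .
  obtain \<eta> where \<eta>: "H \<subseteq> Fil G \<eta>" using finite_subset_Fil[OF G(1) H(2,1)] by blast
  obtain \<delta> where \<delta>: "\<forall>D. \<forall>y\<in>Fil G D. f \<bullet> y \<in> Fil G (D + \<delta>)"
    using Fil_smult[OF G(1) f] by blast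
  obtain k where k: "\<forall>D. \<forall>y\<in>Fil G D. C y \<in> Fil G (D div q + k)"
    using C_Fil[OF G stable] by blast
  have f_pow: "(f [^] n) \<bullet> h \<in> Fil G (\<eta> + n * \<delta>)" if "h \<in> H" for h and n :: nat
  proof (induction n)
    case 0
    show ?case using that \<eta> HM by (simp add: subset_iff)
  next
    case (Suc n)
    have "(f [^] Suc n) \<bullet> h = f \<bullet> ((f [^] n) \<bullet> h)"
      using f that HM by (simp add: smult_assoc1[symmetric] m_comm subset_iff)
    then show ?case using \<delta> Suc by (simp add: algebra_simps) (metis add.assoc add.commute)
  qed
  let ?E = "\<eta> + \<delta> + card T + 2 * k"
  have "trace f H m n \<subseteq> lspan (carrier R) M (trace f H m n \<inter> Fil G ?E)" if n: "n \<le> q ^ m" for m n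
  proof
    let ?Q = "q ^ m" and ?S = "lspan (carrier R) M (trace f H m n \<inter> Fil G ?E)"
    let ?F = "(\<lambda>h. (f [^] n) \<bullet> h) ` H"
    have Q: "?Q > 0" using q by simp
    have F: "?F \<subseteq> carrier M" using f HM by auto
    have SM: "trace f H m n \<inter> Fil G ?E \<subseteq> carrier M" using trace_closed(1)[OF f HM] by auto
    fix z assume "z \<in> trace f H m n"
    then obtain y where z: "z = (C ^^ m) y" and "y \<in> lspan (carrier R) M ?F"
      unfolding trace_def by auto
    then obtain D where "y \<in> Fil ?F D" using lspan_eq_Fil[OF F] by auto
    then have "y \<in> lspan K M (mons_upto ?F D)" unfolding Fil_def .
    then have "y \<in> {y \<in> carrier M. (C ^^ m) y \<in> ?S}"
    proof (rule lspan_least)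
      fix c u assume c: "c \<in> K" and "u \<in> mons_upto ?F D"
      then obtain e h where h: "h \<in> H" and u: "u = mon e \<bullet> ((f [^] n) \<bullet> h)"
        unfolding mons_upto_def by auto
      let ?h = "(f [^] n) \<bullet> h" and ?d = "\<lambda>x. e x div ?Q" and ?r = "\<lambda>x. e x mod ?Q"
      let ?w = "c \<bullet> (mon ?r \<bullet> ?h)"
      have cR: "c \<in> carrier R" and hM: "?h \<in> carrier M" using c K_closed h F by auto
      have "c \<bullet> u = (mon ?d [^] ?Q) \<bullet> ?w"
        unfolding u mon_div_mod[of e ?Q] using cR hM
        by (simp add: smult_assoc1[symmetric] m_ac)
      then have Cu: "(C ^^ m) (c \<bullet> u) = mon ?d \<bullet> (C ^^ m) ?w"
        using cR hM by (simp add: C_pow_smult)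
      have "?w \<in> lspan (carrier R) M ?F"
        using F h cR by (intro lspan_R_smult[OF _ _ lspan_R_smult[OF _ _ lspan_R_incl]]) auto
      then have in_trace: "(C ^^ m) ?w \<in> trace f H m n" unfolding trace_def by blast
      have "mon ?r \<bullet> ?h \<in> Fil G (\<eta> + n * \<delta> + deg ?r)"
        using f_pow[OF h] by (rule Fil_mon[OF G(1)])
      then have "?w \<in> Fil G (\<eta> + n * \<delta> + deg ?r)" using sub c unfolding subspace_def by blast
      moreover have "\<eta> + n * \<delta> + deg ?r \<le> ?Q * (\<eta> + \<delta> + card T) + 2 * k"
      proof -
        have "\<eta> \<le> ?Q * \<eta>" "n * \<delta> \<le> ?Q * \<delta>" "deg ?r \<le> ?Q * card T"
          using Q n deg_mod[OF Q, of e] by (auto simp: mult.commute)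
        then show ?thesis unfolding distrib_left by linarith
      qed
      ultimately have "?w \<in> Fil G (?Q * (\<eta> + \<delta> + card T) + 2 * k)" using Fil_mono by blast
      then have "(C ^^ m) ?w \<in> Fil G ?E" using C_pow_Fil[OF k] by blast
      then have "(C ^^ m) (c \<bullet> u) \<in> ?S"
        unfolding Cu using in_trace SM by (intro lspan_R_smult[OF _ _ lspan_R_incl]) auto
      moreover have "c \<bullet> u \<in> carrier M" using cR u hM by simp
      ultimately show "c \<bullet> u \<in> {y \<in> carrier M. (C ^^ m) y \<in> ?S}" by simp
    qed (use SM C_pow_zero C_pow_add lspan_zero in \<open>auto intro: lspan_zero lspan_add\<close>)
    then show "z \<in> ?S" using z by simp
  qed
  then show ?thesis by blast
qed

text \<open>Two consecutive submodules agree as soon as they meet \<open>Fil G E\<close> in the same subspace, and those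
  subspaces form a decreasing chain.\<close>

theorem trace_jumps_bounded:
  assumes G: "G \<subseteq> carrier M" "finite G"
    and stable: "\<And>y. y \<in> lspan (carrier R) M G \<Longrightarrow> C y \<in> lspan (carrier R) M G"
    and H: "H \<subseteq> lspan (carrier R) M G" "finite H" and f: "f \<in> carrier R"
  shows "\<exists>L. \<forall>m. card {n \<in> {0..<q ^ m}. trace f H m n \<noteq> trace f H m (Suc n)} \<le> L"
proof -
  have HM: "H \<subseteq> carrier M" using H lspan_closed[OF _ G(1)] by blast
  obtain E where E: "\<And>m n. n \<le> q ^ m \<Longrightarrow>
      trace f H m n \<subseteq> lspan (carrier R) M (trace f H m n \<inter> Fil G E)"
    using trace_generated_in_bounded_degree[OF assms] by blast
  obtain b where b: "bij_betw b {0..<card (mons_upto G E)} (mons_upto G E)"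
    using ex_bij_betw_nat_finite[OF finite_mons_upto[OF G(2)]] by blast
  let ?r = "card (mons_upto G E)"
  have img: "b ` {..<?r} = mons_upto G E" using b by (simp add: bij_betw_def lessThan_atLeast0)
  let ?V = "\<lambda>m n. trace f H m n \<inter> Fil G E"
  have "card {n \<in> {0..<q ^ m}. trace f H m n \<noteq> trace f H m (Suc n)} \<le> ?r" for m
  proof -
    have sub: "subspace (?V m n)" for n
      using trace_closed[OF f HM, where m = m and n = n] K_closed
      by (intro subspace_Int subspace_Fil[OF G(1)]) (auto simp: subspace_def)
    have dec: "?V m (Suc n) \<subseteq> ?V m n" for n using trace_Suc[OF f HM] by blast
    have bM: "b ` {..<?r} \<subseteq> carrier M" unfolding img using mons_upto_closed[OF G(1)] .
    have Vb: "?V m n \<subseteq> lspan K M (b ` {..<?r})" for n unfolding img by (simp add: Fil_def)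
    note jumps = card_jumps_le[of b ?r "?V m", OF bM sub dec Vb]
    have "trace f H m n = trace f H m (Suc n)" if n: "n < q ^ m" and eq: "?V m n = ?V m (Suc n)" for n
    proof
      have "trace f H m n \<subseteq> lspan (carrier R) M (?V m (Suc n))" using E[of n m] n eq by simp
      also have "\<dots> \<subseteq> trace f H m (Suc n)"
      proof
        fix x assume "x \<in> lspan (carrier R) M (?V m (Suc n))"
        then show "x \<in> trace f H m (Suc n)"
          by (rule lspan_least) (use trace_closed[OF f HM, where m = m and n = "Suc n"] in auto)
      qed
      finally show "trace f H m n \<subseteq> trace f H m (Suc n)" .
    qed (rule trace_Suc[OF f HM])
    then have "{n \<in> {0..<q ^ m}. trace f H m n \<noteq> trace f H m (Suc n)} \<subseteq> {n. ?V m n \<noteq> ?V m (Suc n)}"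
      by auto
    then show ?thesis using jumps card_mono le_trans by meson
  qed
  then show ?thesis by blast
qed

end

section \<open>Affine schemes\<close>

lemma primeideal_basics:
  fixes A (structure)
  assumes "primeideal P A"
  shows "P \<subseteq> carrier A" "\<one> \<notin> P" "\<zero> \<in> P"
    "\<And>a b. a \<in> P \<Longrightarrow> b \<in> P \<Longrightarrow> a \<oplus> b \<in> P"
    "\<And>a b. a \<in> P \<Longrightarrow> b \<in> carrier A \<Longrightarrow> a \<otimes> b \<in> P"
    "\<And>a b. a \<in> carrier A \<Longrightarrow> b \<in> P \<Longrightarrow> a \<otimes> b \<in> P"
    "\<And>a b. a \<in> carrier A \<Longrightarrow> b \<in> carrier A \<Longrightarrow> a \<notin> P \<Longrightarrow> b \<notin> P \<Longrightarrow> a \<otimes> b \<notin> P"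
proof -
  interpret primeideal P A by fact
  show "P \<subseteq> carrier A" "\<zero> \<in> P" using a_subset by auto
  show "\<one> \<notin> P" using one_imp_carrier I_notcarr by blast
  show "a \<oplus> b \<in> P" if "a \<in> P" "b \<in> P" for a b using that by simp
  show "a \<otimes> b \<in> P" if "a \<in> P" "b \<in> carrier A" for a b using that I_r_closed by simp
  show "a \<otimes> b \<in> P" if "a \<in> carrier A" "b \<in> P" for a b using that I_l_closed by simp
  show "a \<otimes> b \<notin> P" if "a \<in> carrier A" "b \<in> carrier A" "a \<notin> P" "b \<notin> P" for a b
    using that I_prime by blast
qed

definition basic_open :: "'a ring \<Rightarrow> 'a \<Rightarrow> 'a set set" where
  "basic_open A f = {P. primeideal P A \<and> f \<notin> P}"

lemma basic_open_add:
  fixes A (structure)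
  shows "basic_open A (f \<oplus> g) \<subseteq> basic_open A f \<union> basic_open A g"
  unfolding basic_open_def by (auto dest: primeideal_basics(4))

lemma basic_open_mult:
  fixes A (structure)
  shows "f \<in> carrier A \<Longrightarrow> g \<in> carrier A \<Longrightarrow> basic_open A (f \<otimes> g) \<subseteq> basic_open A f \<inter> basic_open A g"
  unfolding basic_open_def by (auto dest: primeideal_basics(5,6))

lemma topspace_zariski:
  fixes A (structure)
  shows "cring A \<Longrightarrow> topspace (zariski_topology A) = {P. primeideal P A}"
proof -
  assume "cring A"
  then interpret cring A .
  have "P \<in> basic_open A \<one>" if "primeideal P A" for P
    using primeideal_basics[OF that] that by (auto simp: basic_open_def)
  then show ?thesis
    using topology_generated_by_topspace unfolding zariski_topology_def basic_open_def by auto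
qed

lemma basic_open_neighbourhood:
  fixes A (structure)
  assumes "openin (zariski_topology A) V" "P \<in> V" and P: "primeideal P A"
  shows "\<exists>f\<in>carrier A. P \<in> basic_open A f \<and> basic_open A f \<subseteq> V"
proof -
  have "generate_topology_on ((\<lambda>f. {P. primeideal P A \<and> f \<notin> P}) ` carrier A) V"
    using assms(1) unfolding zariski_topology_def by (rule openin_topology_generated_by)
  then show ?thesis using assms(2)
  proof induction
    case (Int V W)
    then obtain f g where fg: "f \<in> carrier A" "g \<in> carrier A" "P \<in> basic_open A f" "P \<in> basic_open A g"
      "basic_open A f \<subseteq> V" "basic_open A g \<subseteq> W" by blast
    interpret primeideal P A by fact
    have "basic_open A (f \<otimes> g) \<subseteq> basic_open A f \<inter> basic_open A g"
      using fg by (intro basic_open_mult)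
    moreover have "P \<in> basic_open A (f \<otimes> g)"
      using fg primeideal_basics(7)[OF P, of f g] P unfolding basic_open_def by simp
    ultimately show ?case using fg by (intro bexI[of _ "f \<otimes> g"]) auto
  next
    case (UN K)
    then show ?case by (meson Union_iff Union_upper subset_trans)
  next
    case (Basis s)
    then show ?case unfolding basic_open_def by auto
  qed auto
qed

text \<open>An ideal that is maximal among the proper ideals containing \<open>J\<close> is prime.\<close>

lemma exists_primeideal:
  fixes A (structure)
  assumes "cring A" "ideal J A" "\<one> \<notin> J"
  shows "\<exists>P. primeideal P A \<and> J \<subseteq> P"
proof -
  interpret cring A by fact
  let ?\<A> = "{P. ideal P A \<and> J \<subseteq> P \<and> \<one> \<notin> P}"
  have "\<exists>P\<in>?\<A>. \<forall>Q\<in>?\<A>. P \<subseteq> Q \<longrightarrow> Q = P"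
  proof (rule subset_Zorn_nonempty)
    show "?\<A> \<noteq> {}" using assms by blast
  next
    fix \<C> assume ne: "\<C> \<noteq> {}" and ch: "subset.chain ?\<A> \<C>"
    have "subset.chain {I. ideal I A} \<C>" using ch unfolding subset.chain_def by auto
    then have "ideal (\<Union>\<C>) A" using chain_Union_is_ideal[of \<C>] ne by simp
    moreover have "\<C> \<subseteq> ?\<A>" using ch unfolding subset.chain_def by auto
    ultimately show "\<Union>\<C> \<in> ?\<A>" using ne by blast
  qed
  then obtain P where P_in: "P \<in> ?\<A>" and max: "\<forall>Q\<in>?\<A>. P \<subseteq> Q \<longrightarrow> Q = P" ..
  then have P: "ideal P A" "J \<subseteq> P" "\<one> \<notin> P" by auto
  have "maximalideal P A"
  proof (rule maximalidealI)
    show "carrier A \<noteq> P" using P by auto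
    fix Q assume Q: "ideal Q A" "P \<subseteq> Q" "Q \<subseteq> carrier A"
    show "Q = P \<or> Q = carrier A"
    proof (cases "\<one> \<in> Q")
      case True
      then show ?thesis using ideal.one_imp_carrier[OF Q(1)] by simp
    next
      case False
      then have "Q \<in> ?\<A>" using Q P by auto
      then show ?thesis using max Q(2) by simp
    qed
  qed fact
  then show ?thesis using maximalideal_prime P by blast
qed

text \<open>The elements \<open>f\<close> for which \<open>D(f)\<close> is covered by finitely many members of the open covering form an
  ideal \<open>J\<close>. A prime containing \<open>J\<close> would lie in some member \<open>U\<close> of the covering and hence in some
  \<open>D(f) \<subseteq> U\<close>, but then \<open>f \<in> J\<close>.\<close>

lemma compact_space_zariski:
  fixes A (structure)
  assumes "cring A"
  shows "compact_space (zariski_topology A)"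
  unfolding compact_space_alt
proof (intro allI impI)
  interpret cring A by fact
  fix \<U> assume \<U>: "(\<forall>U\<in>\<U>. openin (zariski_topology A) U) \<and> topspace (zariski_topology A) \<subseteq> \<Union>\<U>"
  define J where "J = {f \<in> carrier A. \<exists>\<F>. finite \<F> \<and> \<F> \<subseteq> \<U> \<and> basic_open A f \<subseteq> \<Union>\<F>}"
  have ideal_J: "ideal J A"
  proof (rule idealI[OF ring_axioms])
    have add: "f \<oplus> g \<in> J" if f: "f \<in> J" and g: "g \<in> J" for f g
    proof -
      obtain \<F> \<G> where fin: "finite \<F>" "\<F> \<subseteq> \<U>" "basic_open A f \<subseteq> \<Union>\<F>" "finite \<G>" "\<G> \<subseteq> \<U>" "basic_open A g \<subseteq> \<Union>\<G>"
        using f g unfolding J_def by blast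
      have "basic_open A (f \<oplus> g) \<subseteq> basic_open A f \<union> basic_open A g"
        by (rule basic_open_add)
      then have "basic_open A (f \<oplus> g) \<subseteq> \<Union>(\<F> \<union> \<G>)" using fin by blast
      moreover have "finite (\<F> \<union> \<G>)" "\<F> \<union> \<G> \<subseteq> \<U>" using fin by auto
      moreover have "f \<oplus> g \<in> carrier A" using f g unfolding J_def by auto
      ultimately show ?thesis unfolding J_def by blast
    qed
    have mult: "x \<otimes> f \<in> J" if f: "f \<in> J" and x: "x \<in> carrier A" for f x
    proof -
      obtain \<F> where fin: "finite \<F>" "\<F> \<subseteq> \<U>" "basic_open A f \<subseteq> \<Union>\<F>"
        using f unfolding J_def by blast
      have "basic_open A (x \<otimes> f) \<subseteq> basic_open A f"
        using basic_open_mult[of x A f] x f unfolding J_def by blast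
      moreover have "x \<otimes> f \<in> carrier A" using f x unfolding J_def by auto
      ultimately show ?thesis using fin unfolding J_def by blast
    qed
    show "x \<otimes> f \<in> J" if "f \<in> J" "x \<in> carrier A" for f x using mult that .
    show "f \<otimes> x \<in> J" if "f \<in> J" "x \<in> carrier A" for f x
    proof -
      have "f \<otimes> x = x \<otimes> f" using that unfolding J_def by (intro m_comm) auto
      then show ?thesis using mult that by simp
    qed
    have "basic_open A \<zero> = {}" unfolding basic_open_def by (auto dest: primeideal_basics(3))
    then have zero: "\<zero> \<in> J" unfolding J_def by auto
    show "subgroup J (add_monoid A)"
    proof (rule add.subgroupI)
      show "J \<subseteq> carrier A" unfolding J_def by auto
      show "J \<noteq> {}" using zero by auto
      show "f \<oplus> g \<in> J" if "f \<in> J" "g \<in> J" for f g using add that .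
      show "\<ominus> f \<in> J" if f: "f \<in> J" for f
      proof -
        have "(\<ominus> \<one>) \<otimes> f \<in> J" using mult[OF f] by auto
        moreover have "f \<in> carrier A" using f unfolding J_def by auto
        ultimately show ?thesis by (simp add: l_minus)
      qed
    qed
  qed
  have "\<one> \<in> J"
  proof (rule ccontr)
    assume "\<one> \<notin> J"
    then obtain P where P: "primeideal P A" "J \<subseteq> P"
      using exists_primeideal[OF assms ideal_J] by blast
    then obtain U where U: "U \<in> \<U>" "P \<in> U" using \<U> topspace_zariski[OF assms] by auto
    then obtain f where f: "f \<in> carrier A" "P \<in> basic_open A f" "basic_open A f \<subseteq> U"
      using basic_open_neighbourhood[of A U P] P \<U> by blast
    then have "f \<in> J" unfolding J_def using U by (auto intro!: exI[of _ "{U}"])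
    then show False using P f unfolding basic_open_def by auto
  qed
  moreover have "basic_open A \<one> = topspace (zariski_topology A)"
    using topspace_zariski[OF assms] unfolding basic_open_def by (auto dest: primeideal_basics(2))
  ultimately show "\<exists>\<F>. finite \<F> \<and> \<F> \<subseteq> \<U> \<and> topspace (zariski_topology A) \<subseteq> \<Union>\<F>"
    unfolding J_def by auto
qed

text \<open>Membership without subtraction, so that only commutativity and associativity are needed to calculate
  with fractions.\<close>

lemma loc_frac_iff:
  fixes A (structure)
  assumes "cring A" "a \<in> carrier A" "s \<in> carrier A"
  shows "(b, t) \<in> loc_frac A P a s \<longleftrightarrow> b \<in> carrier A \<and> t \<in> carrier A - P \<and>
    (\<exists>u\<in>carrier A - P. u \<otimes> (a \<otimes> t) = u \<otimes> (b \<otimes> s))"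
proof -
  interpret cring A by fact
  have "(u \<otimes> (a \<otimes> t \<ominus> b \<otimes> s) = \<zero>) = (u \<otimes> (a \<otimes> t) = u \<otimes> (b \<otimes> s))"
    if "u \<in> carrier A" "b \<in> carrier A" "t \<in> carrier A" for u
  proof -
    have "u \<otimes> (a \<otimes> t \<ominus> b \<otimes> s) = u \<otimes> (a \<otimes> t) \<ominus> u \<otimes> (b \<otimes> s)"
      using that assms by (simp add: minus_eq r_distr r_minus)
    then show ?thesis using that assms by simp
  qed
  then show ?thesis unfolding loc_frac_def by auto
qed

lemma loc_frac_eqI:
  fixes A (structure)
  assumes A: "cring A" and P: "primeideal P A"
    and ab: "a \<in> carrier A" "b \<in> carrier A" and st: "s \<in> carrier A - P" "t \<in> carrier A - P"
    and u: "u \<in> carrier A - P" "u \<otimes> (a \<otimes> t) = u \<otimes> (b \<otimes> s)"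
  shows "loc_frac A P a s = loc_frac A P b t"
proof -
  interpret cring A by fact
  have sub: "loc_frac A P a s \<subseteq> loc_frac A P b t"
    if ab: "a \<in> carrier A" "b \<in> carrier A" and st: "s \<in> carrier A - P" "t \<in> carrier A - P"
      and eq: "u \<otimes> (a \<otimes> t) = u \<otimes> (b \<otimes> s)" for a b s t
  proof
    fix x assume x: "x \<in> loc_frac A P a s"
    obtain c w where cw: "x = (c, w)" by fastforce
    obtain v where c: "c \<in> carrier A" and w: "w \<in> carrier A" "w \<notin> P" and v: "v \<in> carrier A" "v \<notin> P"
      and eq': "v \<otimes> (a \<otimes> w) = v \<otimes> (c \<otimes> s)"
      using x st ab unfolding cw by (auto simp: loc_frac_iff[OF A])
    have cl: "s \<in> carrier A" "t \<in> carrier A" "u \<in> carrier A" using st u by auto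
    note cl = cl ab c w(1) v(1)
    let ?z = "u \<otimes> (v \<otimes> s)"
    have z: "?z \<in> carrier A - P" using primeideal_basics(7)[OF P] cl st u w v by auto
    have "?z \<otimes> (b \<otimes> w) = (v \<otimes> w) \<otimes> (u \<otimes> (b \<otimes> s))" using cl by (simp add: m_ac)
    also have "\<dots> = (v \<otimes> w) \<otimes> (u \<otimes> (a \<otimes> t))" using eq by simp
    also have "\<dots> = (u \<otimes> t) \<otimes> (v \<otimes> (a \<otimes> w))" using cl by (simp add: m_ac)
    also have "\<dots> = (u \<otimes> t) \<otimes> (v \<otimes> (c \<otimes> s))" using eq' by simp
    also have "\<dots> = ?z \<otimes> (c \<otimes> t)" using cl by (simp add: m_ac)
    finally show "x \<in> loc_frac A P b t" using z c w cl unfolding cw by (auto simp: loc_frac_iff[OF A])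
  qed
  show ?thesis using sub[OF ab st u(2)] sub[OF ab(2,1) st(2,1) u(2)[symmetric]] by blast
qed

lemma loc_frac_self:
  assumes "cring A" "primeideal P A" "a \<in> carrier A" "s \<in> carrier A - P"
  shows "(a, s) \<in> loc_frac A P a s"
proof -
  interpret cring A by fact
  show ?thesis using assms primeideal_basics(2)[OF assms(2)] by (auto simp: loc_frac_iff[OF assms(1)])
qed

context
  fixes A :: "'a ring" (structure) and P a b s t
  assumes A: "cring A" and P: "primeideal P A"
    and ab: "a \<in> carrier A" "b \<in> carrier A" and st: "s \<in> carrier A - P" "t \<in> carrier A - P"
begin

interpretation cring A by (fact A)

lemma loc_mult_frac: "loc_mult A P (loc_frac A P a s) (loc_frac A P b t) =
    loc_frac A P (a \<otimes> b) (s \<otimes> t)"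
proof -
  have eq: "loc_frac A P (a' \<otimes> b') (s' \<otimes> t') = loc_frac A P (a \<otimes> b) (s \<otimes> t)"
    if "(a', s') \<in> loc_frac A P a s" "(b', t') \<in> loc_frac A P b t" for a' s' b' t'
  proof -
    obtain u v where cl: "a' \<in> carrier A" "b' \<in> carrier A" "s' \<in> carrier A" "t' \<in> carrier A" "u \<in> carrier A" "v \<in> carrier A"
      and np: "s' \<notin> P" "t' \<notin> P" "u \<notin> P" "v \<notin> P"
      and e: "u \<otimes> (a \<otimes> s') = u \<otimes> (a' \<otimes> s)" "v \<otimes> (b \<otimes> t') = v \<otimes> (b' \<otimes> t)"
      using \<open>(a', s') \<in> _\<close> \<open>(b', t') \<in> _\<close> ab st by (auto simp: loc_frac_iff[OF A])
    have st': "s \<in> carrier A" "t \<in> carrier A" using st by auto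
    have "(u \<otimes> v) \<otimes> ((a' \<otimes> b') \<otimes> (s \<otimes> t)) =
      (u \<otimes> (a' \<otimes> s)) \<otimes> (v \<otimes> (b' \<otimes> t))" using cl st' ab by (simp add: m_ac)
    also have "\<dots> = (u \<otimes> v) \<otimes> ((a \<otimes> b) \<otimes> (s' \<otimes> t'))"
      unfolding e[symmetric] using cl st' ab by (simp add: m_ac)
    finally show ?thesis
      using cl np st ab st' primeideal_basics(7)[OF P]
      by (intro loc_frac_eqI[OF A P, where u = "u \<otimes> v"]) auto
  qed
  have "loc_frac A P (a \<otimes> b) (s \<otimes> t) \<subseteq> loc_mult A P (loc_frac A P a s) (loc_frac A P b t)"
    unfolding loc_mult_def using loc_frac_self[OF A P ab(1) st(1)] loc_frac_self[OF A P ab(2) st(2)] by fast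
  moreover have "loc_mult A P (loc_frac A P a s) (loc_frac A P b t) \<subseteq> loc_frac A P (a \<otimes> b) (s \<otimes> t)"
    unfolding loc_mult_def using eq by fastforce
  ultimately show ?thesis by blast
qed

lemma loc_add_frac: "loc_add A P (loc_frac A P a s) (loc_frac A P b t) =
    loc_frac A P (a \<otimes> t \<oplus> b \<otimes> s) (s \<otimes> t)"
proof -
  have eq: "loc_frac A P (a' \<otimes> t' \<oplus> b' \<otimes> s') (s' \<otimes> t') = loc_frac A P (a \<otimes> t \<oplus> b \<otimes> s) (s \<otimes> t)"
    if "(a', s') \<in> loc_frac A P a s" "(b', t') \<in> loc_frac A P b t" for a' s' b' t'
  proof -
    obtain u v where cl: "a' \<in> carrier A" "b' \<in> carrier A" "s' \<in> carrier A" "t' \<in> carrier A" "u \<in> carrier A" "v \<in> carrier A"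
      and np: "s' \<notin> P" "t' \<notin> P" "u \<notin> P" "v \<notin> P"
      and e: "u \<otimes> (a \<otimes> s') = u \<otimes> (a' \<otimes> s)" "v \<otimes> (b \<otimes> t') = v \<otimes> (b' \<otimes> t)"
      using \<open>(a', s') \<in> _\<close> \<open>(b', t') \<in> _\<close> ab st by (auto simp: loc_frac_iff[OF A])
    have st': "s \<in> carrier A" "t \<in> carrier A" using st by auto
    have "(u \<otimes> v) \<otimes> ((a' \<otimes> t' \<oplus> b' \<otimes> s') \<otimes> (s \<otimes> t)) =
      (v \<otimes> (t \<otimes> t')) \<otimes> (u \<otimes> (a' \<otimes> s)) \<oplus> (u \<otimes> (s \<otimes> s')) \<otimes> (v \<otimes> (b' \<otimes> t))"
      using cl st' ab by (simp add: m_ac l_distr r_distr)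
    also have "\<dots> = (u \<otimes> v) \<otimes> ((a \<otimes> t \<oplus> b \<otimes> s) \<otimes> (s' \<otimes> t'))"
      unfolding e[symmetric] using cl st' ab by (simp add: m_ac l_distr r_distr)
    finally show ?thesis
      using cl np st ab st' primeideal_basics(7)[OF P]
      by (intro loc_frac_eqI[OF A P, where u = "u \<otimes> v"]) auto
  qed
  have "loc_frac A P (a \<otimes> t \<oplus> b \<otimes> s) (s \<otimes> t) \<subseteq> loc_add A P (loc_frac A P a s) (loc_frac A P b t)"
    unfolding loc_add_def using loc_frac_self[OF A P ab(1) st(1)] loc_frac_self[OF A P ab(2) st(2)] by fast
  moreover have "loc_add A P (loc_frac A P a s) (loc_frac A P b t) \<subseteq> loc_frac A P (a \<otimes> t \<oplus> b \<otimes> s) (s \<otimes> t)"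
    unfolding loc_add_def using eq by fastforce
  ultimately show ?thesis by blast
qed

end

definition frac_section :: "'a ring \<Rightarrow> 'a set set \<Rightarrow> 'a \<Rightarrow> 'a \<Rightarrow> 'a set \<Rightarrow> ('a \<times> 'a) set" where
  "frac_section A V a f = (\<lambda>P\<in>V. loc_frac A P a f)"

lemma Spec_simps:
  "rs_top (Spec A) = zariski_topology A"
  "carrier (rs_sec (Spec A) V) = spec_sections A V"
  "s \<otimes>\<^bsub>rs_sec (Spec A) V\<^esub> t = (\<lambda>P\<in>V. loc_mult A P (s P) (t P))"
  "s \<oplus>\<^bsub>rs_sec (Spec A) V\<^esub> t = (\<lambda>P\<in>V. loc_add A P (s P) (t P))"
  "\<one>\<^bsub>rs_sec (Spec A) V\<^esub> = frac_section A V \<one>\<^bsub>A\<^esub> \<one>\<^bsub>A\<^esub>"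
  "rs_res (Spec A) V W s = restrict s W"
  by (auto simp: Spec_def loc_ring_def frac_section_def)

lemma frac_section_closed:
  assumes "openin (zariski_topology A) V" "a \<in> carrier A" "f \<in> carrier A" "\<And>P. P \<in> V \<Longrightarrow> f \<notin> P"
  shows "frac_section A V a f \<in> spec_sections A V"
proof -
  have "frac_section A V a f \<in> (\<Pi>\<^sub>E P\<in>V. carrier (loc_ring A P))"
    using assms(2-4) unfolding frac_section_def loc_ring_def by auto
  moreover have "\<forall>Q\<in>V. f \<notin> Q \<and> frac_section A V a f Q = loc_frac A Q a f"
    using assms(4) unfolding frac_section_def by simp
  ultimately show ?thesis using assms(1-3) unfolding spec_sections_def by blast
qed

text \<open>Locally a section of the structure sheaf over an open subset of an affine open set \<open>U\<close> is a quotient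
  \<open>a/u\<close> of two functions on \<open>U\<close>. On the spectrum this is the definition of a section; the denominator
  becomes a unit because \<open>1/u\<close> is a section as well.\<close>

lemma affine_open_fractions:
  assumes S: "ringed_space S" and U: "affine_open S U"
    and W: "rs_open S W" "W \<subseteq> U" and y: "y \<in> W" and s: "s \<in> carrier (rs_sec S W)"
  shows "\<exists>D u a. rs_open S D \<and> y \<in> D \<and> D \<subseteq> W \<and> u \<in> carrier (rs_sec S U) \<and> a \<in> carrier (rs_sec S U) \<and>
    rs_res S U D u \<in> Units (rs_sec S D) \<and>
    rs_res S U D u \<otimes>\<^bsub>rs_sec S D\<^esub> rs_res S W D s = rs_res S U D a"
proof -
  let ?S = "open_subspace S U"
  have Uo: "rs_open S U" using U unfolding affine_open_def by blast
  obtain A :: "'b ring" and \<phi> where A: "cring A" and \<phi>: "rs_isomorphism ?S (Spec A) \<phi>"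
    using U unfolding affine_open_def affine_scheme_def by blast
  interpret cring A by fact
  let ?Z = "zariski_topology A" and ?h = "fst \<phi>"
  let ?pre = "rs_preimage ?S \<phi>"
  have top: "topspace (rs_top ?S) = U" and op: "openin (rs_top ?S) V \<longleftrightarrow> rs_open S V \<and> V \<subseteq> U" for V
    using Uo openin_subset[OF Uo] by (auto simp: open_subspace_def openin_open_subtopology)
  have sec: "rs_sec ?S = rs_sec S" and res: "rs_res ?S = rs_res S" by (auto simp: open_subspace_def)
  have hm: "homeomorphic_map (rs_top ?S) ?Z ?h"
    and cont: "continuous_map (rs_top ?S) ?Z ?h"
    and iso: "\<And>V. openin ?Z V \<Longrightarrow> snd \<phi> V \<in> ring_iso (rs_sec (Spec A) V) (rs_sec S (?pre V))"
    and nat: "\<And>V W s. openin ?Z V \<Longrightarrow> openin ?Z W \<Longrightarrow> W \<subseteq> V \<Longrightarrow> s \<in> spec_sections A V \<Longrightarrow>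
      snd \<phi> W (restrict s W) = rs_res S (?pre V) (?pre W) (snd \<phi> V s)"
    using \<phi> unfolding rs_isomorphism_def rs_morphism_def by (auto simp: Spec_simps sec res)
  have pre: "?pre V = {x \<in> U. ?h x \<in> V}" for V unfolding rs_preimage_def top ..
  have pre_open: "rs_open S (?pre V)" if "openin ?Z V" for V
    using openin_continuous_map_preimage[OF cont that] unfolding pre top op by blast
  have inj: "inj_on ?h U" using homeomorphic_imp_injective_map[OF hm] unfolding top .
  have himg: "?h x \<in> topspace ?Z" if "x \<in> U" for x
    using cont that unfolding continuous_map_def top by blast
  have hW: "openin ?Z (?h ` W)" using homeomorphic_map_openness[OF hm] W op top by auto
  have preW: "?pre (?h ` W) = W" unfolding pre using inj W by (auto dest: inj_onD)
  obtain \<sigma> where \<sigma>: "\<sigma> \<in> spec_sections A (?h ` W)" and s_eq: "s = snd \<phi> (?h ` W) \<sigma>"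
    using iso[OF hW] s unfolding preW ring_iso_def bij_betw_def by (auto simp: Spec_simps)
  obtain V a f where V: "openin ?Z V" "?h y \<in> V" "V \<subseteq> ?h ` W" and af: "a \<in> carrier A" "f \<in> carrier A"
    and frac: "\<And>Q. Q \<in> V \<Longrightarrow> f \<notin> Q \<and> \<sigma> Q = loc_frac A Q a f"
  proof -
    have "\<exists>V a f. openin ?Z V \<and> ?h y \<in> V \<and> V \<subseteq> ?h ` W \<and> a \<in> carrier A \<and> f \<in> carrier A \<and>
        (\<forall>Q\<in>V. f \<notin> Q \<and> \<sigma> Q = loc_frac A Q a f)"
      using \<sigma> y by (simp add: spec_sections_def)
    then show thesis using that by metis
  qed
  let ?T = "topspace ?Z" and ?D = "?pre V"
  have T: "openin ?Z ?T" "V \<subseteq> ?T" using V openin_subset by auto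
  have prime: "primeideal P A" if "P \<in> ?T" for P using that topspace_zariski[OF A] by simp
  have preT: "?pre ?T = U" unfolding pre using himg by blast
  have D: "rs_open S ?D" "?D \<subseteq> W" "y \<in> ?D"
    using pre_open[OF V(1)] V W y preW unfolding pre by auto
  let ?u = "snd \<phi> ?T (frac_section A ?T f \<one>\<^bsub>A\<^esub>)" and ?a = "snd \<phi> ?T (frac_section A ?T a \<one>\<^bsub>A\<^esub>)"
  have global: "frac_section A ?T g \<one>\<^bsub>A\<^esub> \<in> spec_sections A ?T"
    and local: "frac_section A V g \<one>\<^bsub>A\<^esub> \<in> spec_sections A V" if "g \<in> carrier A" for g
    using that T V primeideal_basics(2)[OF prime] by (auto intro!: frac_section_closed)
  have hom: "snd \<phi> V \<in> ring_hom (rs_sec (Spec A) V) (rs_sec S (?pre V))" if "openin ?Z V" for V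
    using iso[OF that] unfolding ring_iso_def by blast
  have glob_closed: "snd \<phi> ?T (frac_section A ?T g \<one>\<^bsub>A\<^esub>) \<in> carrier (rs_sec S U)" if "g \<in> carrier A" for g
    using ring_hom_memE(1)[OF hom[OF T(1)]] global[OF that] unfolding preT by (simp add: Spec_simps)
  have glob_res: "rs_res S U ?D (snd \<phi> ?T (frac_section A ?T g \<one>\<^bsub>A\<^esub>)) = snd \<phi> V (frac_section A V g \<one>\<^bsub>A\<^esub>)"
    if "g \<in> carrier A" for g
  proof -
    have "restrict (frac_section A ?T g \<one>\<^bsub>A\<^esub>) V = frac_section A V g \<one>\<^bsub>A\<^esub>"
      using T(2) unfolding frac_section_def by (intro ext) (auto simp: restrict_def)
    then show ?thesis using nat[OF T(1) V(1) T(2) global[OF that]] unfolding preT by simp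
  qed
  have inv_f: "frac_section A V \<one>\<^bsub>A\<^esub> f \<in> spec_sections A V"
    using V af frac by (intro frac_section_closed) auto
  have Vf: "f \<in> carrier A - P" "\<one>\<^bsub>A\<^esub> \<in> carrier A - P" if "P \<in> V" for P
    using that frac af T primeideal_basics(2)[OF prime] by auto
  have VP: "primeideal P A" if "P \<in> V" for P using prime T(2) that by blast
  have f_unit: "frac_section A V f \<one>\<^bsub>A\<^esub> \<otimes>\<^bsub>rs_sec (Spec A) V\<^esub> frac_section A V \<one>\<^bsub>A\<^esub> f = \<one>\<^bsub>rs_sec (Spec A) V\<^esub>"
    unfolding Spec_simps frac_section_def
  proof (rule restrict_ext)
    fix P assume P: "P \<in> V"
    have "loc_frac A P (f \<otimes>\<^bsub>A\<^esub> \<one>\<^bsub>A\<^esub>) (\<one>\<^bsub>A\<^esub> \<otimes>\<^bsub>A\<^esub> f) = loc_frac A P \<one>\<^bsub>A\<^esub> \<one>\<^bsub>A\<^esub>"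
      using Vf[OF P] by (intro loc_frac_eqI[OF A VP[OF P], where u = "\<one>\<^bsub>A\<^esub>"]) auto
    then show "loc_mult A P ((\<lambda>P\<in>V. loc_frac A P f \<one>\<^bsub>A\<^esub>) P) ((\<lambda>P\<in>V. loc_frac A P \<one>\<^bsub>A\<^esub> f) P) =
      loc_frac A P \<one>\<^bsub>A\<^esub> \<one>\<^bsub>A\<^esub>"
      using P loc_mult_frac[OF A VP[OF P] af(2) one_closed Vf(2)[OF P] Vf(1)[OF P]] by simp
  qed
  have f_mult: "frac_section A V f \<one>\<^bsub>A\<^esub> \<otimes>\<^bsub>rs_sec (Spec A) V\<^esub> restrict \<sigma> V = frac_section A V a \<one>\<^bsub>A\<^esub>"
    unfolding Spec_simps frac_section_def
  proof (rule restrict_ext)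
    fix P assume P: "P \<in> V"
    have "loc_frac A P (f \<otimes>\<^bsub>A\<^esub> a) (\<one>\<^bsub>A\<^esub> \<otimes>\<^bsub>A\<^esub> f) = loc_frac A P a \<one>\<^bsub>A\<^esub>"
      using Vf[OF P] af by (intro loc_frac_eqI[OF A VP[OF P], where u = "\<one>\<^bsub>A\<^esub>"]) (auto simp: m_comm)
    then show "loc_mult A P ((\<lambda>P\<in>V. loc_frac A P f \<one>\<^bsub>A\<^esub>) P) (restrict \<sigma> V P) = loc_frac A P a \<one>\<^bsub>A\<^esub>"
      using P frac[OF P] loc_mult_frac[OF A VP[OF P] af(2,1) Vf(2)[OF P] Vf(1)[OF P]] by simp
  qed
  have restr: "restrict \<sigma> V \<in> spec_sections A V"
  proof -
    have "restrict \<sigma> V = frac_section A V a f" using frac unfolding frac_section_def by (auto intro!: restrict_ext)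
    then show ?thesis using V af frac frac_section_closed[of A V a f] by auto
  qed
  have Dcr: "cring (rs_sec S ?D)" using S D unfolding ringed_space_def by blast
  interpret D: cring "rs_sec S ?D" by fact
  note homV = ring_hom_memE[OF hom[OF V(1)], unfolded Spec_simps(2)]
  have "rs_res S U ?D ?u \<otimes>\<^bsub>rs_sec S ?D\<^esub> snd \<phi> V (frac_section A V \<one>\<^bsub>A\<^esub> f) = \<one>\<^bsub>rs_sec S ?D\<^esub>"
    unfolding glob_res[OF af(2)] using homV(2)[OF local[OF af(2)] inv_f] homV(4) f_unit by simp
  then have unit: "rs_res S U ?D ?u \<in> Units (rs_sec S ?D)"
    using homV(1)[OF inv_f] homV(1)[OF local[OF af(2)]] glob_res[OF af(2)]
    unfolding Units_def by (auto simp: D.m_comm intro!: bexI[of _ "snd \<phi> V (frac_section A V \<one>\<^bsub>A\<^esub> f)"])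
  have "rs_res S W ?D s = snd \<phi> V (restrict \<sigma> V)"
    using nat[OF hW V(1) V(3) \<sigma>] unfolding preW s_eq by simp
  then have "rs_res S U ?D ?u \<otimes>\<^bsub>rs_sec S ?D\<^esub> rs_res S W ?D s = rs_res S U ?D ?a"
    unfolding glob_res[OF af(2)] glob_res[OF af(1)]
    using homV(2)[OF local[OF af(2)] restr] f_mult by simp
  then show ?thesis using D unit glob_closed af by blast
qed

lemma affine_open_compactin:
  assumes "affine_open S U"
  shows "compactin (rs_top S) U"
proof -
  have Uo: "rs_open S U" using assms unfolding affine_open_def by blast
  obtain A :: "'b ring" and \<phi> where A: "cring A" and \<phi>: "rs_isomorphism (open_subspace S U) (Spec A) \<phi>"
    using assms unfolding affine_open_def affine_scheme_def by blast
  have "homeomorphic_map (subtopology (rs_top S) U) (zariski_topology A) (fst \<phi>)"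
    using \<phi> unfolding rs_isomorphism_def by (auto simp: Spec_simps open_subspace_def)
  then have "compact_space (subtopology (rs_top S) U)"
    using homeomorphic_compact_space[OF homeomorphic_map_imp_homeomorphic_space] compact_space_zariski[OF A]
    by blast
  then show ?thesis
    using openin_subset[OF Uo] unfolding compact_space_def compactin_subtopology by (auto simp: Int_absorb1)
qed

text \<open>The only prime ideal is \<open>0\<close>, and at this point \<open>a/t\<close> is the constant \<open>at\<^bsup>-1\<^esup>\<close>.\<close>

lemma Spec_field_constants:
  assumes k: "field k" and V: "openin (zariski_topology k) V"
  shows "(\<lambda>a. frac_section k V a \<one>\<^bsub>k\<^esub>) \<in> ring_hom k (rs_sec (Spec k) V)"
    and "carrier (rs_sec (Spec k) V) = (\<lambda>a. frac_section k V a \<one>\<^bsub>k\<^esub>) ` carrier k"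
proof -
  interpret field k by fact
  have k': "cring k" by (rule is_cring)
  have prime: "primeideal P k" if "P \<in> V" for P
    using that openin_subset[OF V] topspace_zariski[OF k'] by auto
  have one: "\<one>\<^bsub>k\<^esub> \<in> carrier k - P" if "P \<in> V" for P using primeideal_basics(2)[OF prime[OF that]] by simp
  have P0: "P = {\<zero>\<^bsub>k\<^esub>}" if "P \<in> V" for P
  proof -
    have "ideal P k" using prime[OF that] by (simp add: primeideal_def)
    then show ?thesis using all_ideals one[OF that] by blast
  qed
  have closed: "frac_section k V a \<one>\<^bsub>k\<^esub> \<in> spec_sections k V" if "a \<in> carrier k" for a
    using that one by (intro frac_section_closed[OF V]) auto
  show "(\<lambda>a. frac_section k V a \<one>\<^bsub>k\<^esub>) \<in> ring_hom k (rs_sec (Spec k) V)"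
  proof (rule ring_hom_memI)
    fix a b assume a: "a \<in> carrier k" and b: "b \<in> carrier k"
    show "frac_section k V (a \<otimes>\<^bsub>k\<^esub> b) \<one>\<^bsub>k\<^esub> = frac_section k V a \<one>\<^bsub>k\<^esub> \<otimes>\<^bsub>rs_sec (Spec k) V\<^esub> frac_section k V b \<one>\<^bsub>k\<^esub>"
      unfolding Spec_simps frac_section_def
      by (rule restrict_ext) (use loc_mult_frac[OF k' prime a b one one] in simp)
    show "frac_section k V (a \<oplus>\<^bsub>k\<^esub> b) \<one>\<^bsub>k\<^esub> = frac_section k V a \<one>\<^bsub>k\<^esub> \<oplus>\<^bsub>rs_sec (Spec k) V\<^esub> frac_section k V b \<one>\<^bsub>k\<^esub>"
      unfolding Spec_simps frac_section_def
      by (rule restrict_ext) (use loc_add_frac[OF k' prime a b one one] a b in simp)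
  qed (use closed in \<open>auto simp: Spec_simps\<close>)
  have "\<exists>a\<in>carrier k. s = frac_section k V a \<one>\<^bsub>k\<^esub>" if s: "s \<in> spec_sections k V" for s
  proof (cases "V = {}")
    case True
    then have "s = frac_section k V \<zero>\<^bsub>k\<^esub> \<one>\<^bsub>k\<^esub>"
      using s unfolding spec_sections_def frac_section_def by (auto simp: PiE_def extensional_def)
    then show ?thesis by blast
  next
    case False
    then obtain P where P: "P \<in> V" by blast
    obtain a t where at: "a \<in> carrier k" "t \<in> carrier k - P" "s P = loc_frac k P a t"
      using s P unfolding spec_sections_def loc_ring_def by (auto simp: PiE_def Pi_def)
    have t: "t \<in> carrier k" "t \<noteq> \<zero>\<^bsub>k\<^esub>" using at(2) P0[OF P] by auto
    then have it: "inv\<^bsub>k\<^esub> t \<in> carrier k" "inv\<^bsub>k\<^esub> t \<otimes>\<^bsub>k\<^esub> t = \<one>\<^bsub>k\<^esub>" using field_Units by auto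
    have "loc_frac k P a t = loc_frac k P (a \<otimes>\<^bsub>k\<^esub> inv\<^bsub>k\<^esub> t) \<one>\<^bsub>k\<^esub>"
      using at one[OF P] it t
      by (intro loc_frac_eqI[OF k' prime[OF P], where u = "\<one>\<^bsub>k\<^esub>"]) (auto simp: m_assoc)
    moreover have "Q = P" if "Q \<in> V" for Q using P0 that P by blast
    ultimately have "s Q = frac_section k V (a \<otimes>\<^bsub>k\<^esub> inv\<^bsub>k\<^esub> t) \<one>\<^bsub>k\<^esub> Q" for Q
      using s at(3) unfolding spec_sections_def frac_section_def
      by (cases "Q \<in> V") (auto simp: PiE_def extensional_def)
    then show ?thesis using at(1) it by blast
  qed
  then show "carrier (rs_sec (Spec k) V) = (\<lambda>a. frac_section k V a \<one>\<^bsub>k\<^esub>) ` carrier k"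
    using closed unfolding Spec_simps by blast
qed

section \<open>Sheaves of modules\<close>

lemma ring_hom_nat_pow:
  assumes "h \<in> ring_hom R S" "cring R" "cring S" "x \<in> carrier R"
  shows "h (x [^]\<^bsub>R\<^esub> (n::nat)) = h x [^]\<^bsub>S\<^esub> n"
proof -
  interpret R: cring R by fact
  interpret S: cring S by fact
  show ?thesis using ring_hom_memE[OF assms(1)] assms(4) by (induction n) auto
qed

lemma ring_hom_Units:
  assumes "h \<in> ring_hom R S" "u \<in> Units R"
  shows "h u \<in> Units S"
proof -
  obtain v where v: "v \<in> carrier R" "v \<otimes>\<^bsub>R\<^esub> u = \<one>\<^bsub>R\<^esub>" "u \<otimes>\<^bsub>R\<^esub> v = \<one>\<^bsub>R\<^esub>" and u: "u \<in> carrier R"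
    using assms(2) unfolding Units_def by auto
  have "h v \<otimes>\<^bsub>S\<^esub> h u = \<one>\<^bsub>S\<^esub>" "h u \<otimes>\<^bsub>S\<^esub> h v = \<one>\<^bsub>S\<^esub>"
    using ring_hom_memE(2)[OF assms(1) v(1) u] ring_hom_memE(2)[OF assms(1) u v(1)] ring_hom_memE(4)[OF assms(1)]
    by (simp_all add: v)
  moreover have "h v \<in> carrier S" "h u \<in> carrier S"
    using ring_hom_memE(1)[OF assms(1)] u v by blast+
  ultimately show ?thesis unfolding Units_def by (intro CollectI conjI bexI[of _ "h v"])
qed

lemma
  assumes "sheaf_on T F r"
  shows sheaf_on_closed: "openin T V \<Longrightarrow> openin T W \<Longrightarrow> W \<subseteq> V \<Longrightarrow> s \<in> F V \<Longrightarrow> r V W s \<in> F W"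
    and sheaf_on_id: "openin T V \<Longrightarrow> s \<in> F V \<Longrightarrow> r V V s = s"
    and sheaf_on_comp: "openin T U \<Longrightarrow> openin T V \<Longrightarrow> openin T W \<Longrightarrow> W \<subseteq> V \<Longrightarrow> V \<subseteq> U \<Longrightarrow> s \<in> F U \<Longrightarrow>
      r V W (r U V s) = r U W s"
proof -
  note sheaf = assms[unfolded sheaf_on_def]
  show "openin T V \<Longrightarrow> openin T W \<Longrightarrow> W \<subseteq> V \<Longrightarrow> s \<in> F V \<Longrightarrow> r V W s \<in> F W"
    using sheaf[THEN conjunct1] by blast
  show "openin T V \<Longrightarrow> s \<in> F V \<Longrightarrow> r V V s = s"
    using sheaf[THEN conjunct2, THEN conjunct1] by blast
  show "openin T U \<Longrightarrow> openin T V \<Longrightarrow> openin T W \<Longrightarrow> W \<subseteq> V \<Longrightarrow> V \<subseteq> U \<Longrightarrow> s \<in> F U \<Longrightarrow>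
      r V W (r U V s) = r U W s"
    using sheaf[THEN conjunct2, THEN conjunct2, THEN conjunct1] by blast
qed

locale sheaf_of_modules =
  fixes S :: "('x, 'a) ringed_space" and M :: "('x, 'a, 'b) module_sheaf"
  assumes ringed: "ringed_space S" and sheaf: "module_sheaf S M"
begin

abbreviation "\<O> \<equiv> rs_sec S"
abbreviation "\<M> \<equiv> ms_sec M"
abbreviation sec_span where "sec_span V \<equiv> lspan (carrier (\<O> V)) (\<M> V)"

lemma ringed_sheaf_on: "sheaf_on (rs_top S) (\<lambda>U. carrier (\<O> U)) (rs_res S)"
  using ringed[unfolded ringed_space_def, THEN conjunct2, THEN conjunct2] by simp

lemma module_sheaf_on: "sheaf_on (rs_top S) (\<lambda>U. carrier (\<M> U)) (ms_res M)"
  using sheaf[unfolded module_sheaf_def, THEN conjunct2, THEN conjunct2] by simp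

lemma cring_sec: "rs_open S V \<Longrightarrow> cring (\<O> V)"
  using ringed[unfolded ringed_space_def, THEN conjunct1] by simp

lemma res_hom: "rs_open S V \<Longrightarrow> rs_open S W \<Longrightarrow> W \<subseteq> V \<Longrightarrow> rs_res S V W \<in> ring_hom (\<O> V) (\<O> W)"
  using ringed[unfolded ringed_space_def, THEN conjunct2, THEN conjunct1] by simp

lemma res_closed: "rs_open S V \<Longrightarrow> rs_open S W \<Longrightarrow> W \<subseteq> V \<Longrightarrow> a \<in> carrier (\<O> V) \<Longrightarrow>
    rs_res S V W a \<in> carrier (\<O> W)"
  by (rule ring_hom_memE(1)[OF res_hom])

lemma res_id: "rs_open S V \<Longrightarrow> a \<in> carrier (\<O> V) \<Longrightarrow> rs_res S V V a = a"
  by (rule sheaf_on_id[OF ringed_sheaf_on])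

lemma res_res: "rs_open S U \<Longrightarrow> rs_open S V \<Longrightarrow> rs_open S W \<Longrightarrow> W \<subseteq> V \<Longrightarrow> V \<subseteq> U \<Longrightarrow>
    a \<in> carrier (\<O> U) \<Longrightarrow> rs_res S V W (rs_res S U V a) = rs_res S U W a"
  by (rule sheaf_on_comp[OF ringed_sheaf_on])

lemma res_pow: "rs_open S V \<Longrightarrow> rs_open S W \<Longrightarrow> W \<subseteq> V \<Longrightarrow> a \<in> carrier (\<O> V) \<Longrightarrow>
    rs_res S V W (a [^]\<^bsub>\<O> V\<^esub> (n::nat)) = rs_res S V W a [^]\<^bsub>\<O> W\<^esub> n"
  by (rule ring_hom_nat_pow[OF res_hom cring_sec cring_sec])

lemma module_sec: "rs_open S V \<Longrightarrow> Module.module (\<O> V) (\<M> V)"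
  using sheaf[unfolded module_sheaf_def, THEN conjunct1] by simp

lemma mres_closed: "rs_open S V \<Longrightarrow> rs_open S W \<Longrightarrow> W \<subseteq> V \<Longrightarrow> x \<in> carrier (\<M> V) \<Longrightarrow>
    ms_res M V W x \<in> carrier (\<M> W)"
  by (rule sheaf_on_closed[OF module_sheaf_on])

lemma mres_id: "rs_open S V \<Longrightarrow> x \<in> carrier (\<M> V) \<Longrightarrow> ms_res M V V x = x"
  by (rule sheaf_on_id[OF module_sheaf_on])

lemma mres_res: "rs_open S U \<Longrightarrow> rs_open S V \<Longrightarrow> rs_open S W \<Longrightarrow> W \<subseteq> V \<Longrightarrow> V \<subseteq> U \<Longrightarrow>
    x \<in> carrier (\<M> U) \<Longrightarrow> ms_res M V W (ms_res M U V x) = ms_res M U W x"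
  by (rule sheaf_on_comp[OF module_sheaf_on])

lemma mres_add: "rs_open S V \<Longrightarrow> rs_open S W \<Longrightarrow> W \<subseteq> V \<Longrightarrow> x \<in> carrier (\<M> V) \<Longrightarrow>
    y \<in> carrier (\<M> V) \<Longrightarrow>
    ms_res M V W (x \<oplus>\<^bsub>\<M> V\<^esub> y) = ms_res M V W x \<oplus>\<^bsub>\<M> W\<^esub> ms_res M V W y"
  using sheaf[unfolded module_sheaf_def, THEN conjunct2, THEN conjunct1] by simp

lemma mres_smult: "rs_open S V \<Longrightarrow> rs_open S W \<Longrightarrow> W \<subseteq> V \<Longrightarrow> a \<in> carrier (\<O> V) \<Longrightarrow>
    x \<in> carrier (\<M> V) \<Longrightarrow>
    ms_res M V W (a \<odot>\<^bsub>\<M> V\<^esub> x) = rs_res S V W a \<odot>\<^bsub>\<M> W\<^esub> ms_res M V W x"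
  using sheaf[unfolded module_sheaf_def, THEN conjunct2, THEN conjunct1] by simp

lemma mres_zero:
  assumes "rs_open S V" "rs_open S W" "W \<subseteq> V"
  shows "ms_res M V W \<zero>\<^bsub>\<M> V\<^esub> = \<zero>\<^bsub>\<M> W\<^esub>"
proof -
  interpret V: Module.module "\<O> V" "\<M> V" by (rule module_sec[OF assms(1)])
  interpret W: Module.module "\<O> W" "\<M> W" by (rule module_sec[OF assms(2)])
  have "ms_res M V W \<zero>\<^bsub>\<M> V\<^esub> \<oplus>\<^bsub>\<M> W\<^esub> ms_res M V W \<zero>\<^bsub>\<M> V\<^esub> = ms_res M V W \<zero>\<^bsub>\<M> V\<^esub>"
    using mres_add[OF assms V.M.zero_closed V.M.zero_closed] by simp
  then show ?thesis
    using mres_closed[OF assms V.M.zero_closed] by (simp add: W.M.add.l_cancel_one)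
qed

lemma mres_lspan:
  assumes VW: "rs_open S V" "rs_open S W" "W \<subseteq> V"
    and "A \<subseteq> carrier (\<O> V)" "G \<subseteq> carrier (\<M> V)"
    and "rs_res S V W ` A \<subseteq> A'" "ms_res M V W ` G \<subseteq> G'"
    and "x \<in> lspan A (\<M> V) G"
  shows "ms_res M V W x \<in> lspan A' (\<M> W) G'"
  using module_sec[OF VW(1)] assms(4,5,8)
proof (rule lspan_hom)
  fix a g assume "a \<in> A" "g \<in> G"
  then have "ms_res M V W (a \<odot>\<^bsub>\<M> V\<^esub> g) = rs_res S V W a \<odot>\<^bsub>\<M> W\<^esub> ms_res M V W g"
    and "rs_res S V W a \<in> A'" "ms_res M V W g \<in> G'"
    using mres_smult[OF VW, of a g] assms(4-7) by auto
  then show "\<exists>a'\<in>A'. \<exists>g'\<in>G'. ms_res M V W (a \<odot>\<^bsub>\<M> V\<^esub> g) = a' \<odot>\<^bsub>\<M> W\<^esub> g'" by blast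
qed (use VW mres_zero mres_add in auto)

lemma mres_lspan_sec:
  assumes VW: "rs_open S V" "rs_open S W" "W \<subseteq> V" and "G \<subseteq> carrier (\<M> V)"
    and "x \<in> sec_span V G"
  shows "ms_res M V W x \<in> sec_span W (ms_res M V W ` G)"
  using res_closed[OF VW] assms by (intro mres_lspan[OF VW _ _ _ _ assms(5)]) auto

end

lemma module_self:
  assumes "cring R"
  shows "Module.module R (ring.extend R \<lparr>smult = monoid.mult R\<rparr>)"
proof -
  interpret cring R by fact
  show ?thesis
  proof (rule moduleI)
    show "abelian_group (ring.extend R \<lparr>smult = (\<otimes>\<^bsub>R\<^esub>)\<rparr>)"
      by (rule abelian_groupI) (auto simp: ring.defs a_assoc a_comm a_lcomm intro: l_neg bexI[of _ "\<ominus>\<^bsub>R\<^esub> _"])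
  qed (auto simp: ring.defs l_distr r_distr m_assoc assms)
qed

lemma structure_module_sheaf:
  assumes "ringed_space S"
  shows "module_sheaf S (structure_module S)"
  unfolding module_sheaf_def
proof (intro conjI allI impI)
  show "Module.module (rs_sec S U) (ms_sec (structure_module S) U)" if "rs_open S U" for U
  proof -
    have "cring (rs_sec S U)" using that assms[unfolded ringed_space_def, THEN conjunct1] by simp
    then show ?thesis unfolding structure_module_def by (simp add: module_self)
  qed
  show "sheaf_on (rs_top S) (\<lambda>U. carrier (ms_sec (structure_module S) U)) (ms_res (structure_module S))"
    using assms unfolding ringed_space_def structure_module_def by (simp add: ring.defs)
qed (use assms in \<open>auto simp: structure_module_def ring.defs ringed_space_def ring_hom_def\<close>)

lemma structure_module_simps [simp]:
  "carrier (ms_sec (structure_module S) V) = carrier (rs_sec S V)"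
  "\<zero>\<^bsub>ms_sec (structure_module S) V\<^esub> = \<zero>\<^bsub>rs_sec S V\<^esub>"
  "x \<oplus>\<^bsub>ms_sec (structure_module S) V\<^esub> y = x \<oplus>\<^bsub>rs_sec S V\<^esub> y"
  "a \<odot>\<^bsub>ms_sec (structure_module S) V\<^esub> x = a \<otimes>\<^bsub>rs_sec S V\<^esub> x"
  "ms_res (structure_module S) = rs_res S"
  by (auto simp: structure_module_def ring.defs)

text \<open>The stalks of the subsheaf \<open>N\<close> at the points of \<open>D\<close> are spanned by the germs of \<open>G\<close>. Here \<open>N\<close> is
  just a family of sets of sections, so that ideals, submodules and the whole of \<open>M\<close> are treated
  alike.\<close>

definition generated_over ::
    "('x, 'a) ringed_space \<Rightarrow> ('x, 'a, 'b) module_sheaf \<Rightarrow> ('x set \<Rightarrow> 'b set) \<Rightarrow> 'x set \<Rightarrow> 'b set \<Rightarrow> bool" where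
  "generated_over S M N D G \<longleftrightarrow> (\<forall>V s y. rs_open S V \<and> V \<subseteq> D \<and> s \<in> N V \<and> y \<in> V \<longrightarrow>
     (\<exists>W. rs_open S W \<and> y \<in> W \<and> W \<subseteq> V \<and>
       ms_res M V W s \<in> lspan (carrier (rs_sec S W)) (ms_sec M W) (ms_res M D W ` G)))"

lemma generated_overI:
  assumes "\<And>V s y. rs_open S V \<Longrightarrow> V \<subseteq> D \<Longrightarrow> s \<in> N V \<Longrightarrow> y \<in> V \<Longrightarrow> \<exists>W. rs_open S W \<and> y \<in> W \<and> W \<subseteq> V \<and>
    ms_res M V W s \<in> lspan (carrier (rs_sec S W)) (ms_sec M W) (ms_res M D W ` G)"
  shows "generated_over S M N D G"
  using assms unfolding generated_over_def by simp

lemma generated_overE: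
  assumes "generated_over S M N D G" "rs_open S V" "V \<subseteq> D" "s \<in> N V" "y \<in> V"
  obtains W where "rs_open S W" "y \<in> W" "W \<subseteq> V"
    "ms_res M V W s \<in> lspan (carrier (rs_sec S W)) (ms_sec M W) (ms_res M D W ` G)"
proof -
  have "\<exists>W. rs_open S W \<and> y \<in> W \<and> W \<subseteq> V \<and>
      ms_res M V W s \<in> lspan (carrier (rs_sec S W)) (ms_sec M W) (ms_res M D W ` G)"
    using assms unfolding generated_over_def by simp
  then show thesis using that by (elim exE conjE)
qed

lemma lspan_structure_singleton:
  assumes S: "ringed_space S" and W: "rs_open S W" and f: "f \<in> carrier (rs_sec S W)"
    and x: "x \<in> lspan (carrier (rs_sec S W)) (ms_sec (structure_module S) W) {f}"
  shows "\<exists>c\<in>carrier (rs_sec S W). x = c \<otimes>\<^bsub>rs_sec S W\<^esub> f"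
proof -
  interpret Module.module "rs_sec S W" "ms_sec (structure_module S) W"
    using structure_module_sheaf[OF S, unfolded module_sheaf_def, THEN conjunct1] W by simp
  show ?thesis using lspan_singleton[OF _ x] f by simp
qed

context sheaf_of_modules
begin

text \<open>The finite sums in the definition of the product \<open>JN\<close> are linear combinations of sections of \<open>N\<close> with
  coefficients in \<open>J\<close>.\<close>

lemma ideal_mult_iff:
  assumes J: "\<forall>V. rs_open S V \<longrightarrow> J V \<subseteq> carrier (\<O> V)"
    and N: "\<forall>V. rs_open S V \<longrightarrow> N V \<subseteq> carrier (\<M> V)"
  shows "s \<in> ideal_mult S M J N V \<longleftrightarrow> s \<in> carrier (\<M> V) \<and>
    (\<forall>x\<in>V. \<exists>W. rs_open S W \<and> x \<in> W \<and> W \<subseteq> V \<and> ms_res M V W s \<in> lspan (J W) (\<M> W) (N W))"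
proof -
  define P where "P W t \<longleftrightarrow> (\<exists>(n::nat). \<exists>a\<in>{..<n} \<rightarrow> J W. \<exists>y\<in>{..<n} \<rightarrow> N W.
        t = (\<Oplus>\<^bsub>\<M> W\<^esub>i\<in>{..<n}. a i \<odot>\<^bsub>\<M> W\<^esub> y i))" for W t
  have "P W t \<longleftrightarrow> t \<in> lspan (J W) (\<M> W) (N W)" if W: "rs_open S W" for W t
  proof -
    interpret Module.module "\<O> W" "\<M> W" using module_sec[OF W] .
    have cl: "J W \<subseteq> carrier (\<O> W)" "N W \<subseteq> carrier (\<M> W)" using J N W by auto
    show ?thesis
      unfolding P_def using lspan_as_finsum[OF cl, of t] finsum_in_lspan[OF cl] by blast
  qed
  moreover have "s \<in> ideal_mult S M J N V \<longleftrightarrow> s \<in> carrier (\<M> V) \<and>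
      (\<forall>x\<in>V. \<exists>W. rs_open S W \<and> x \<in> W \<and> W \<subseteq> V \<and> P W (ms_res M V W s))"
    unfolding ideal_mult_def P_def by simp
  ultimately show ?thesis by blast
qed

lemma ideal_mult_closed: "ideal_mult S M J N V \<subseteq> carrier (\<M> V)"
  unfolding ideal_mult_def by auto

lemma ideal_multI:
  assumes J: "\<forall>V. rs_open S V \<longrightarrow> J V \<subseteq> carrier (\<O> V)"
    and N: "\<forall>V. rs_open S V \<longrightarrow> N V \<subseteq> carrier (\<M> V)"
    and V: "rs_open S V" and s: "s \<in> lspan (J V) (\<M> V) (N V)"
  shows "s \<in> ideal_mult S M J N V"
proof -
  interpret Module.module "\<O> V" "\<M> V" using module_sec[OF V] .
  have "J V \<subseteq> carrier (\<O> V)" "N V \<subseteq> carrier (\<M> V)" using J N V by auto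
  then have "s \<in> carrier (\<M> V)" using lspan_closed s by blast
  then show ?thesis using s V mres_id[OF V] by (auto simp: ideal_mult_iff[OF J N])
qed

lemma ideal_mult_restrict:
  assumes J: "\<forall>V. rs_open S V \<longrightarrow> J V \<subseteq> carrier (\<O> V)"
    and N: "\<forall>V. rs_open S V \<longrightarrow> N V \<subseteq> carrier (\<M> V)"
    and rJ: "\<And>V W. rs_open S V \<Longrightarrow> rs_open S W \<Longrightarrow> W \<subseteq> V \<Longrightarrow> rs_res S V W ` J V \<subseteq> J W"
    and rN: "\<And>V W. rs_open S V \<Longrightarrow> rs_open S W \<Longrightarrow> W \<subseteq> V \<Longrightarrow> ms_res M V W ` N V \<subseteq> N W"
    and VW: "rs_open S V" "rs_open S W" "W \<subseteq> V" and s: "s \<in> ideal_mult S M J N V"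
  shows "ms_res M V W s \<in> ideal_mult S M J N W"
  unfolding ideal_mult_iff[OF J N]
proof (intro conjI ballI)
  have sM: "s \<in> carrier (\<M> V)" using s ideal_mult_closed by blast
  then show "ms_res M V W s \<in> carrier (\<M> W)" using mres_closed VW by blast
  fix x assume x: "x \<in> W"
  then obtain V' where V': "rs_open S V'" "x \<in> V'" "V' \<subseteq> V" "ms_res M V V' s \<in> lspan (J V') (\<M> V') (N V')"
    using s VW unfolding ideal_mult_iff[OF J N] by blast
  let ?W = "V' \<inter> W"
  have o: "rs_open S ?W" using V' VW by auto
  have "ms_res M V' ?W (ms_res M V V' s) \<in> lspan (J ?W) (\<M> ?W) (N ?W)"
    using V' o J N rJ[OF V'(1) o] rN[OF V'(1) o]
    by (intro mres_lspan[where V = V' and A = "J V'" and G = "N V'"]) auto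
  then have "ms_res M W ?W (ms_res M V W s) \<in> lspan (J ?W) (\<M> ?W) (N ?W)"
    using V' VW o sM by (simp add: mres_res)
  then show "\<exists>W'. rs_open S W' \<and> x \<in> W' \<and> W' \<subseteq> W \<and> ms_res M W W' (ms_res M V W s) \<in> lspan (J W') (\<M> W') (N W')"
    using o x V' by blast
qed

lemma mres_image:
  assumes "rs_open S U" "rs_open S V" "rs_open S W" "W \<subseteq> V" "V \<subseteq> U" "G \<subseteq> carrier (\<M> U)"
  shows "ms_res M V W ` ms_res M U V ` G = ms_res M U W ` G"
  unfolding image_image using assms(6) by (intro image_cong[OF refl] mres_res[OF assms(1-5)]) auto

lemma mres_span:
  assumes D: "rs_open S D" and G: "G \<subseteq> carrier (\<M> D)"
    and V: "rs_open S V" "V \<subseteq> D" and W: "rs_open S W" "W \<subseteq> V"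
    and t: "t \<in> sec_span V (ms_res M D V ` G)"
  shows "ms_res M V W t \<in> sec_span W (ms_res M D W ` G)"
proof -
  have "ms_res M D V ` G \<subseteq> carrier (\<M> V)" using mres_closed[OF D V] G by blast
  then show ?thesis
    using mres_lspan_sec[OF V(1) W _ t] mres_image[OF D V(1) W V(2) G] by simp
qed

text \<open>Generators may be replaced by any sections whose span contains them.\<close>

lemma generated_over_change:
  assumes gen: "generated_over S M N D G" and D: "rs_open S D" "G \<subseteq> carrier (\<M> D)"
    and D': "rs_open S D'" "D' \<subseteq> D" "G' \<subseteq> carrier (\<M> D')"
    and GG': "ms_res M D D' ` G \<subseteq> sec_span D' G'"
  shows "generated_over S M N D' G'"
proof (rule generated_overI)
  fix V s y assume V: "rs_open S V" "V \<subseteq> D'" and s: "s \<in> N V" and y: "y \<in> V"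
  have VD: "V \<subseteq> D" using V D' by blast
  obtain W where W: "rs_open S W" "y \<in> W" "W \<subseteq> V"
    and sp: "ms_res M V W s \<in> sec_span W (ms_res M D W ` G)"
    using generated_overE[OF gen V(1) VD s y] .
  have W': "W \<subseteq> D'" using W V by blast
  interpret Module.module "\<O> W" "\<M> W" using module_sec[OF W(1)] .
  have "ms_res M D W ` G = ms_res M D' W ` ms_res M D D' ` G"
    using mres_image[OF D(1) D'(1) W(1) W' D'(2) D(2)] by simp
  also have "\<dots> \<subseteq> sec_span W (ms_res M D' W ` G')"
    using GG' mres_lspan_sec[OF D'(1) W(1) W' D'(3)] by blast
  finally have "sec_span W (ms_res M D W ` G) \<subseteq>
      sec_span W (ms_res M D' W ` G')"
  proof (rule lspan_subset_lspan[rotated])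
    show "ms_res M D' W ` G' \<subseteq> carrier (\<M> W)" using mres_closed[OF D'(1) W(1) W'] D'(3) by blast
  qed
  then have "ms_res M V W s \<in> sec_span W (ms_res M D' W ` G')"
    using sp by (rule subsetD)
  then show "\<exists>W. rs_open S W \<and> y \<in> W \<and> W \<subseteq> V \<and>
      ms_res M V W s \<in> sec_span W (ms_res M D' W ` G')"
    using W by blast
qed

lemma generated_over_restrict:
  assumes gen: "generated_over S M N D G" and D: "rs_open S D" "G \<subseteq> carrier (\<M> D)"
    and D': "rs_open S D'" "D' \<subseteq> D"
  shows "generated_over S M N D' (ms_res M D D' ` G)"
proof -
  interpret Module.module "\<O> D'" "\<M> D'" using module_sec[OF D'(1)] .
  have "ms_res M D D' ` G \<subseteq> carrier (\<M> D')" using mres_closed[OF D(1) D'] D(2) by blast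
  then show ?thesis using lspan_R_incl by (intro generated_over_change[OF gen D D']) auto
qed

text \<open>Near a point a section of \<open>JN\<close> is a sum of products \<open>ax\<close>, where near the point \<open>a\<close> is a multiple of \<open>f\<close> and
  \<open>x\<close> is a combination of \<open>H\<close>. Each summand may need a smaller neighbourhood, so the property that some
  neighbourhood exists is shown to be closed under sums.\<close>

lemma ideal_mult_generated:
  assumes J: "\<forall>V. rs_open S V \<longrightarrow> J V \<subseteq> carrier (\<O> V)"
    and N: "\<forall>V. rs_open S V \<longrightarrow> N V \<subseteq> carrier (\<M> V)"
    and rN: "\<And>V W. rs_open S V \<Longrightarrow> rs_open S W \<Longrightarrow> W \<subseteq> V \<Longrightarrow> ms_res M V W ` N V \<subseteq> N W"
    and D: "rs_open S D" and f: "f \<in> carrier (\<O> D)" and H: "H \<subseteq> carrier (\<M> D)"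
    and J_gen: "generated_over S (structure_module S) J D {f}" and N_gen: "generated_over S M N D H"
  shows "generated_over S M (ideal_mult S M J N) D ((\<lambda>h. f \<odot>\<^bsub>\<M> D\<^esub> h) ` H)"
proof (rule generated_overI)
  fix V s y assume V: "rs_open S V" "V \<subseteq> D" and s: "s \<in> ideal_mult S M J N V" and y: "y \<in> V"
  let ?fH = "(\<lambda>h. f \<odot>\<^bsub>\<M> D\<^esub> h) ` H"
  let ?span = "\<lambda>W. sec_span W (ms_res M D W ` ?fH)"
  interpret D: Module.module "\<O> D" "\<M> D" using module_sec[OF D] .
  have fH: "?fH \<subseteq> carrier (\<M> D)" using f H by auto
  have sM: "s \<in> carrier (\<M> V)" using s ideal_mult_closed by blast
  obtain V1 where V1: "rs_open S V1" "y \<in> V1" "V1 \<subseteq> V"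
    and s1: "ms_res M V V1 s \<in> lspan (J V1) (\<M> V1) (N V1)"
    using s y ideal_mult_iff[OF J N, of s V] by auto
  have V1D: "V1 \<subseteq> D" using V1 V by blast
  let ?Z = "{t \<in> carrier (\<M> V1). \<exists>W. rs_open S W \<and> y \<in> W \<and> W \<subseteq> V1 \<and> ms_res M V1 W t \<in> ?span W}"
  interpret V1: Module.module "\<O> V1" "\<M> V1" using module_sec[OF V1(1)] .
  have "ms_res M V V1 s \<in> ?Z"
    using s1
  proof (rule V1.lspan_least)
    show "\<zero>\<^bsub>\<M> V1\<^esub> \<in> ?Z"
      using V1 mres_zero[OF V1(1,1)] by (auto intro!: exI[of _ V1] lspan_zero)
  next
    fix t t' assume "t \<in> ?Z" "t' \<in> ?Z"
    then obtain W W' where t: "t \<in> carrier (\<M> V1)" "t' \<in> carrier (\<M> V1)"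
      and W: "rs_open S W" "y \<in> W" "W \<subseteq> V1" "rs_open S W'" "y \<in> W'" "W' \<subseteq> V1"
      and ts: "ms_res M V1 W t \<in> ?span W" "ms_res M V1 W' t' \<in> ?span W'"
      by blast
    let ?W = "W \<inter> W'"
    have o: "rs_open S ?W" "?W \<subseteq> W" "?W \<subseteq> W'" "?W \<subseteq> V1" "?W \<subseteq> D" "W \<subseteq> D" "W' \<subseteq> D" using W V1D by auto
    interpret W: Module.module "\<O> ?W" "\<M> ?W" using module_sec[OF o(1)] .
    have "ms_res M V1 ?W t \<in> ?span ?W" "ms_res M V1 ?W t' \<in> ?span ?W"
      using mres_span[OF D fH W(1) o(6) o(1,2) ts(1)] mres_span[OF D fH W(4) o(7) o(1,3) ts(2)]
        mres_res[OF V1(1) W(1) o(1,2) W(3) t(1)] mres_res[OF V1(1) W(4) o(1,3) W(6) t(2)] by auto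
    moreover have "ms_res M D ?W ` ?fH \<subseteq> carrier (\<M> ?W)" using mres_closed[OF D o(1,5)] fH by blast
    ultimately have "ms_res M V1 ?W (t \<oplus>\<^bsub>\<M> V1\<^esub> t') \<in> ?span ?W"
      unfolding mres_add[OF V1(1) o(1,4) t] by (intro W.lspan_add) auto
    then show "t \<oplus>\<^bsub>\<M> V1\<^esub> t' \<in> ?Z" using o W t by blast
  next
    fix a x assume a: "a \<in> J V1" and x: "x \<in> N V1"
    have ax: "a \<in> carrier (\<O> V1)" "x \<in> carrier (\<M> V1)" using a x J N V1(1) by auto
    obtain W where W: "rs_open S W" "y \<in> W" "W \<subseteq> V1"
      and asp: "rs_res S V1 W a \<in> lspan (carrier (\<O> W)) (ms_sec (structure_module S) W) {rs_res S D W f}"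
      using generated_overE[OF J_gen V1(1) V1D a V1(2)] by auto
    have WD: "W \<subseteq> D" using W V1D by blast
    have "ms_res M V1 W x \<in> N W" using rN[OF V1(1) W(1,3)] x by blast
    then obtain W' where W': "rs_open S W'" "y \<in> W'" "W' \<subseteq> W"
      and xs: "ms_res M W W' (ms_res M V1 W x) \<in> sec_span W' (ms_res M D W' ` H)"
      using generated_overE[OF N_gen W(1) WD _ W(2)] by blast
    have W'D: "W' \<subseteq> D" "W' \<subseteq> V1" using W' WD W by auto
    interpret W': Module.module "\<O> W'" "\<M> W'" using module_sec[OF W'(1)] .
    let ?f = "rs_res S D W' f"
    have fW: "rs_res S D W f \<in> carrier (\<O> W)" using res_closed[OF D W(1) WD f] .
    have fW': "?f \<in> carrier (\<O> W')" using res_closed[OF D W'(1) W'D(1) f] .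
    obtain c where c: "c \<in> carrier (\<O> W)" and eq: "rs_res S V1 W a = c \<otimes>\<^bsub>\<O> W\<^esub> rs_res S D W f"
      using lspan_structure_singleton[OF ringed W(1) fW asp] by blast
    have cW': "rs_res S W W' c \<in> carrier (\<O> W')" using res_closed[OF W(1) W'(1,3) c] .
    have HW': "ms_res M D W' ` H \<subseteq> carrier (\<M> W')" using mres_closed[OF D W'(1) W'D(1)] H by blast
    have fHW': "ms_res M D W' ` ?fH \<subseteq> carrier (\<M> W')" using mres_closed[OF D W'(1) W'D(1)] fH by blast
    have xs': "ms_res M V1 W' x \<in> sec_span W' (ms_res M D W' ` H)"
      using xs mres_res[OF V1(1) W(1) W'(1,3) W(3) ax(2)] by simp
    have xM: "ms_res M V1 W' x \<in> carrier (\<M> W')" using mres_closed[OF V1(1) W'(1) W'D(2) ax(2)] .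
    have fx: "?f \<odot>\<^bsub>\<M> W'\<^esub> ms_res M V1 W' x \<in> ?span W'"
      using W'.module_axioms subset_refl HW' xs'
    proof (rule lspan_hom)
      fix b g assume b: "b \<in> carrier (\<O> W')" and "g \<in> ms_res M D W' ` H"
      then obtain h where h: "h \<in> H" "g = ms_res M D W' h" by blast
      have "?f \<odot>\<^bsub>\<M> W'\<^esub> (b \<odot>\<^bsub>\<M> W'\<^esub> g) = b \<odot>\<^bsub>\<M> W'\<^esub> (?f \<odot>\<^bsub>\<M> W'\<^esub> g)"
        using b fW' HW' h by (subst (1 2) W'.smult_assoc1[symmetric]) (auto simp: W'.m_comm)
      also have "?f \<odot>\<^bsub>\<M> W'\<^esub> g = ms_res M D W' (f \<odot>\<^bsub>\<M> D\<^esub> h)"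
        using mres_smult[OF D W'(1) W'D(1) f] h H by auto
      finally show "\<exists>a'\<in>carrier (\<O> W'). \<exists>g'\<in>ms_res M D W' ` ?fH.
          ?f \<odot>\<^bsub>\<M> W'\<^esub> (b \<odot>\<^bsub>\<M> W'\<^esub> g) = a' \<odot>\<^bsub>\<M> W'\<^esub> g'" using b h(1) by blast
    qed (use fW' in \<open>auto simp: W'.smult_r_distr\<close>)
    have "rs_res S V1 W' a = rs_res S W W' c \<otimes>\<^bsub>\<O> W'\<^esub> ?f"
      using res_res[OF V1(1) W(1) W'(1,3) W(3) ax(1)] eq ring_hom_memE(2)[OF res_hom[OF W(1) W'(1,3)] c fW]
        res_res[OF D W(1) W'(1,3) WD f] by simp
    then have "ms_res M V1 W' (a \<odot>\<^bsub>\<M> V1\<^esub> x) = rs_res S W W' c \<odot>\<^bsub>\<M> W'\<^esub> (?f \<odot>\<^bsub>\<M> W'\<^esub> ms_res M V1 W' x)"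
      using mres_smult[OF V1(1) W'(1) W'D(2) ax] cW' fW' xM by (simp add: W'.smult_assoc1)
    also have "\<dots> \<in> ?span W'" by (rule W'.lspan_R_smult[OF fHW' cW' fx])
    finally show "a \<odot>\<^bsub>\<M> V1\<^esub> x \<in> ?Z" using W' W'D ax by auto
  qed
  then obtain W where W: "rs_open S W" "y \<in> W" "W \<subseteq> V1" "ms_res M V1 W (ms_res M V V1 s) \<in> ?span W"
    by blast
  then show "\<exists>W. rs_open S W \<and> y \<in> W \<and> W \<subseteq> V \<and> ms_res M V W s \<in> ?span W"
    using mres_res[OF V(1) V1(1) W(1,3) V1(3) sM] V1(3) by auto
qed

end

locale ideal_and_submodule = sheaf_of_modules S M
  for S :: "('x, 'a) ringed_space" and M :: "('x, 'a, 'b) module_sheaf" +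
  fixes I :: "'x set \<Rightarrow> 'a set" and N :: "'x set \<Rightarrow> 'b set"
  assumes I: "ideal_sheaf S I" and N: "sub_sheaf S M N"
begin

sublocale struct_sheaf: sheaf_of_modules S "structure_module S"
  using ringed structure_module_sheaf[OF ringed] by unfold_locales

lemma I_submodule: "rs_open S V \<Longrightarrow> submodule (I V) (\<O> V) (ms_sec (structure_module S) V)"
  using I unfolding ideal_sheaf_def sub_sheaf_def by blast

lemma I_closed: "rs_open S V \<Longrightarrow> I V \<subseteq> carrier (\<O> V)"
  using Module.module.submoduleE(1)[OF struct_sheaf.module_sec I_submodule] by simp

lemma I_mult: "rs_open S V \<Longrightarrow> c \<in> carrier (\<O> V) \<Longrightarrow> a \<in> I V \<Longrightarrow> c \<otimes>\<^bsub>\<O> V\<^esub> a \<in> I V"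
  using Module.module.submoduleE(4)[OF struct_sheaf.module_sec I_submodule] by simp

lemma I_restrict: "rs_open S V \<Longrightarrow> rs_open S W \<Longrightarrow> W \<subseteq> V \<Longrightarrow> rs_res S V W ` I V \<subseteq> I W"
  using I sheaf_on_closed[of "rs_top S" I "rs_res S" V W] unfolding ideal_sheaf_def sub_sheaf_def by auto

lemma N_closed: "rs_open S V \<Longrightarrow> N V \<subseteq> carrier (\<M> V)"
  using N Module.module.submoduleE(1)[OF module_sec] unfolding sub_sheaf_def by blast

lemma N_restrict: "rs_open S V \<Longrightarrow> rs_open S W \<Longrightarrow> W \<subseteq> V \<Longrightarrow> ms_res M V W ` N V \<subseteq> N W"
  using N sheaf_on_closed[of "rs_top S" N "ms_res M" V W] unfolding sub_sheaf_def by auto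

lemma power_closed: "rs_open S V \<Longrightarrow> ideal_power S I n V \<subseteq> carrier (\<O> V)"
  using struct_sheaf.ideal_mult_closed by (cases n) auto

lemma power_restrict:
  "rs_open S V \<Longrightarrow> rs_open S W \<Longrightarrow> W \<subseteq> V \<Longrightarrow> rs_res S V W ` ideal_power S I n V \<subseteq> ideal_power S I n W"
proof (induction n arbitrary: V W)
  case 0
  then show ?case using res_closed by auto
next
  case (Suc n)
  then show ?case
    using struct_sheaf.ideal_mult_restrict[of I "ideal_power S I n" V W] I_closed I_restrict power_closed
    by (auto simp: image_subset_iff)
qed

abbreviation INn :: "nat \<Rightarrow> 'x set \<Rightarrow> 'b set" where
  "INn n \<equiv> ideal_mult S M (ideal_power S I n) N"

lemma INn_restrict:
  "rs_open S V \<Longrightarrow> rs_open S W \<Longrightarrow> W \<subseteq> V \<Longrightarrow> s \<in> INn n V \<Longrightarrow> ms_res M V W s \<in> INn n W"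
  using power_closed N_closed power_restrict N_restrict by (intro ideal_mult_restrict[of _ _ V W s]) auto

end

text \<open>An open set \<open>D\<close> over which the ideal sheaf is generated by one section \<open>f\<close> and the submodule by a set
  \<open>H\<close> of sections. There \<open>I\<^sup>nN\<close> is generated by the sections \<open>f\<^sup>nh\<close>.\<close>

locale generators_over = ideal_and_submodule S M I N
  for S :: "('x, 'a) ringed_space" and M :: "('x, 'a, 'b) module_sheaf" and I N +
  fixes D :: "'x set" and f :: 'a and H :: "'b set"
  assumes D: "rs_open S D" and f: "f \<in> I D" and H: "H \<subseteq> N D"
    and I_generated: "generated_over S (structure_module S) I D {f}"
    and N_generated: "generated_over S M N D H"
begin

lemma f_closed: "f \<in> carrier (\<O> D)" using f I_closed[OF D] by blast
lemma H_closed: "H \<subseteq> carrier (\<M> D)" using H N_closed[OF D] by blast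

definition f_pow_H :: "nat \<Rightarrow> 'b set" where
  "f_pow_H n = (\<lambda>h. (f [^]\<^bsub>\<O> D\<^esub> n) \<odot>\<^bsub>\<M> D\<^esub> h) ` H"

lemma f_pow_H_closed: "f_pow_H n \<subseteq> carrier (\<M> D)"
proof -
  interpret Module.module "\<O> D" "\<M> D" using module_sec[OF D] .
  show ?thesis unfolding f_pow_H_def using f_closed H_closed by auto
qed

lemma f_pow_H_res:
  assumes "rs_open S V" "V \<subseteq> D"
  shows "ms_res M D V ` f_pow_H n =
    (\<lambda>h. (rs_res S D V f [^]\<^bsub>\<O> V\<^esub> n) \<odot>\<^bsub>\<M> V\<^esub> ms_res M D V h) ` H"
proof -
  interpret D: cring "\<O> D" using cring_sec[OF D] .
  have "ms_res M D V ((f [^]\<^bsub>\<O> D\<^esub> n) \<odot>\<^bsub>\<M> D\<^esub> h) =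
      (rs_res S D V f [^]\<^bsub>\<O> V\<^esub> n) \<odot>\<^bsub>\<M> V\<^esub> ms_res M D V h" if "h \<in> H" for h
    using that assms D f_closed H_closed by (subst mres_smult) (auto simp: res_pow)
  then show ?thesis unfolding f_pow_H_def image_image by (rule image_cong[OF refl])
qed

definition span_over :: "nat \<Rightarrow> 'x set \<Rightarrow> 'b set" where
  "span_over n V = sec_span V (ms_res M D V ` f_pow_H n)"

lemma mres_f_pow_H_closed: "rs_open S V \<Longrightarrow> V \<subseteq> D \<Longrightarrow> ms_res M D V ` f_pow_H n \<subseteq> carrier (\<M> V)"
  using mres_closed[OF D] f_pow_H_closed by blast

lemma span_over_Suc:
  assumes V: "rs_open S V" "V \<subseteq> D"
  shows "span_over (Suc n) V \<subseteq> span_over n V"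
proof -
  interpret Module.module "\<O> V" "\<M> V" using module_sec[OF V(1)] .
  have fV: "rs_res S D V f \<in> carrier (\<O> V)" using res_closed[OF D V f_closed] .
  show ?thesis unfolding span_over_def
  proof (rule lspan_subset_lspan[OF mres_f_pow_H_closed[OF V]])
    show "ms_res M D V ` f_pow_H (Suc n) \<subseteq> sec_span V (ms_res M D V ` f_pow_H n)"
    proof
      fix x assume "x \<in> ms_res M D V ` f_pow_H (Suc n)"
      then obtain h where h: "h \<in> H"
        and x: "x = (rs_res S D V f [^]\<^bsub>\<O> V\<^esub> Suc n) \<odot>\<^bsub>\<M> V\<^esub> ms_res M D V h"
        unfolding f_pow_H_res[OF V] by blast
      let ?g = "(rs_res S D V f [^]\<^bsub>\<O> V\<^esub> n) \<odot>\<^bsub>\<M> V\<^esub> ms_res M D V h"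
      have hV: "ms_res M D V h \<in> carrier (\<M> V)" using mres_closed[OF D V] H_closed h by blast
      have "x = rs_res S D V f \<odot>\<^bsub>\<M> V\<^esub> ?g"
        unfolding x using fV hV by (simp add: smult_assoc1[symmetric] m_comm)
      moreover have "?g \<in> ms_res M D V ` f_pow_H n" unfolding f_pow_H_res[OF V] using h by blast
      ultimately show "x \<in> sec_span V (ms_res M D V ` f_pow_H n)"
        using lspan_R_smult[OF mres_f_pow_H_closed[OF V] fV lspan_R_incl[OF mres_f_pow_H_closed[OF V]]]
        by simp
    qed
  qed
qed

lemma pow_in_ideal_power:
  assumes V: "rs_open S V" "V \<subseteq> D"
  shows "c \<in> carrier (\<O> V) \<Longrightarrow> c \<otimes>\<^bsub>\<O> V\<^esub> (rs_res S D V f [^]\<^bsub>\<O> V\<^esub> n) \<in> ideal_power S I n V"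
proof (induction n)
  case 0
  interpret cring "\<O> V" using cring_sec[OF V(1)] .
  show ?case using 0 by simp
next
  case (Suc n)
  interpret cring "\<O> V" using cring_sec[OF V(1)] .
  interpret struct: Module.module "\<O> V" "ms_sec (structure_module S) V"
    using struct_sheaf.module_sec[OF V(1)] .
  let ?fV = "rs_res S D V f"
  have fV: "?fV \<in> carrier (\<O> V)" using res_closed[OF D V f_closed] .
  have fI: "?fV \<in> I V" using I_restrict[OF D V] f by blast
  have "c \<otimes>\<^bsub>\<O> V\<^esub> (?fV [^]\<^bsub>\<O> V\<^esub> Suc n) = ?fV \<odot>\<^bsub>ms_sec (structure_module S) V\<^esub> (c \<otimes>\<^bsub>\<O> V\<^esub> (?fV [^]\<^bsub>\<O> V\<^esub> n))"
    using fV Suc by (simp add: m_ac)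
  also have "\<dots> \<in> lspan (I V) (ms_sec (structure_module S) V) (ideal_power S I n V)"
    using struct.lspan_smult_incl[OF I_closed[OF V(1)]] power_closed[OF V(1)] fI Suc by auto
  finally have "c \<otimes>\<^bsub>\<O> V\<^esub> (?fV [^]\<^bsub>\<O> V\<^esub> Suc n) \<in> ideal_mult S (structure_module S) I (ideal_power S I n) V"
    using I_closed power_closed V(1) by (intro struct_sheaf.ideal_multI) auto
  then show ?case by simp
qed

lemma span_over_subset_INn:
  assumes V: "rs_open S V" "V \<subseteq> D"
  shows "span_over n V \<subseteq> INn n V"
proof
  interpret Module.module "\<O> V" "\<M> V" using module_sec[OF V(1)] .
  let ?L = "lspan (ideal_power S I n V) (\<M> V) (N V)"
  have fV: "rs_res S D V f \<in> carrier (\<O> V)" using res_closed[OF D V f_closed] .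
  fix s assume "s \<in> span_over n V"
  then have "s \<in> ?L" unfolding span_over_def
  proof (rule lspan_least)
    fix c x assume c: "c \<in> carrier (\<O> V)" and "x \<in> ms_res M D V ` f_pow_H n"
    then obtain h where h: "h \<in> H"
      and x: "x = (rs_res S D V f [^]\<^bsub>\<O> V\<^esub> n) \<odot>\<^bsub>\<M> V\<^esub> ms_res M D V h"
      unfolding f_pow_H_res[OF V] by blast
    have hN: "ms_res M D V h \<in> N V" using N_restrict[OF D V] H h by blast
    have hV: "ms_res M D V h \<in> carrier (\<M> V)" using hN N_closed[OF V(1)] by blast
    have "c \<odot>\<^bsub>\<M> V\<^esub> x = (c \<otimes>\<^bsub>\<O> V\<^esub> (rs_res S D V f [^]\<^bsub>\<O> V\<^esub> n)) \<odot>\<^bsub>\<M> V\<^esub> ms_res M D V h"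
      unfolding x using c fV hV by (simp add: smult_assoc1)
    then show "c \<odot>\<^bsub>\<M> V\<^esub> x \<in> ?L"
      using pow_in_ideal_power[OF V c] hN lspan_smult_incl[OF power_closed[OF V(1)] N_closed[OF V(1)]] by simp
  qed (auto intro: lspan_zero lspan_add[OF power_closed[OF V(1)] N_closed[OF V(1)]])
  then show "s \<in> INn n V" using power_closed N_closed V by (intro ideal_multI) auto
qed

lemma ideal_power_generated:
  "generated_over S (structure_module S) (ideal_power S I n) D {f [^]\<^bsub>\<O> D\<^esub> n}"
proof (induction n)
  case 0
  interpret D: cring "\<O> D" using cring_sec[OF D] .
  show ?case
  proof (rule generated_overI)
    fix V s y assume V: "rs_open S V" "V \<subseteq> D" and s: "s \<in> ideal_power S I 0 V" and y: "y \<in> V"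
    interpret Module.module "\<O> V" "ms_sec (structure_module S) V" using struct_sheaf.module_sec[OF V(1)] .
    have "s \<odot>\<^bsub>ms_sec (structure_module S) V\<^esub> \<one>\<^bsub>\<O> V\<^esub> \<in>
        lspan (carrier (\<O> V)) (ms_sec (structure_module S) V) {\<one>\<^bsub>\<O> V\<^esub>}"
      using s by (intro lspan_smult_incl) auto
    then show "\<exists>W. rs_open S W \<and> y \<in> W \<and> W \<subseteq> V \<and> ms_res (structure_module S) V W s \<in>
        lspan (carrier (\<O> W)) (ms_sec (structure_module S) W)
          (ms_res (structure_module S) D W ` {f [^]\<^bsub>\<O> D\<^esub> (0::nat)})"
      using V s y res_id[OF V(1)] ring_hom_memE(4)[OF res_hom[OF D V]] by (intro exI[of _ V]) simp
  qed
next
  case (Suc n)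
  interpret D: cring "\<O> D" using cring_sec[OF D] .
  have "generated_over S (structure_module S) (ideal_mult S (structure_module S) I (ideal_power S I n)) D
      ((\<lambda>h. f \<odot>\<^bsub>ms_sec (structure_module S) D\<^esub> h) ` {f [^]\<^bsub>\<O> D\<^esub> n})"
    using I_closed power_closed power_restrict f_closed
    by (intro struct_sheaf.ideal_mult_generated[OF _ _ _ D _ _ I_generated Suc]) auto
  then show ?case using f_closed by (simp add: D.m_comm)
qed

lemma INn_generated: "generated_over S M (INn n) D (f_pow_H n)"
  unfolding f_pow_H_def
proof (rule ideal_mult_generated[OF _ _ _ D _ H_closed ideal_power_generated N_generated])
  interpret D: cring "\<O> D" using cring_sec[OF D] .
  show "f [^]\<^bsub>\<O> D\<^esub> n \<in> carrier (\<O> D)" using f_closed by simp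
qed (use power_closed N_closed N_restrict in auto)

end

section \<open>Cartier modules near a point\<close>

locale cartier_sheaf = sheaf_of_modules S M
  for S :: "('x, 'a) ringed_space" and M :: "('x, 'a, 'b) module_sheaf" +
  fixes q :: nat and C :: "'x set \<Rightarrow> 'b \<Rightarrow> 'b"
  assumes q: "q \<ge> 2" and cartier: "cartier_module q S M C"
begin

lemma C_sec:
  assumes "rs_open S V"
  shows "x \<in> carrier (\<M> V) \<Longrightarrow> C V x \<in> carrier (\<M> V)"
    and "x \<in> carrier (\<M> V) \<Longrightarrow> y \<in> carrier (\<M> V) \<Longrightarrow>
      C V (x \<oplus>\<^bsub>\<M> V\<^esub> y) = C V x \<oplus>\<^bsub>\<M> V\<^esub> C V y"
    and "a \<in> carrier (\<O> V) \<Longrightarrow> x \<in> carrier (\<M> V) \<Longrightarrow>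
      C V ((a [^]\<^bsub>\<O> V\<^esub> q) \<odot>\<^bsub>\<M> V\<^esub> x) = a \<odot>\<^bsub>\<M> V\<^esub> C V x"
  using cartier[unfolded cartier_module_def, THEN conjunct2, THEN conjunct1] assms by auto

lemma C_res: "rs_open S V \<Longrightarrow> rs_open S W \<Longrightarrow> W \<subseteq> V \<Longrightarrow> x \<in> carrier (\<M> V) \<Longrightarrow>
    ms_res M V W (C V x) = C W (ms_res M V W x)"
  using cartier[unfolded cartier_module_def, THEN conjunct2, THEN conjunct2] by simp

lemma cartier_map_sec: "rs_open S V \<Longrightarrow> cartier_map (\<O> V) (\<M> V) q (C V)"
  using module_sec q C_sec by (intro cartier_map.intro cartier_map_axioms.intro) auto

lemma C_pow_res:
  assumes VW: "rs_open S V" "rs_open S W" "W \<subseteq> V" and x: "x \<in> carrier (\<M> V)"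
  shows "ms_res M V W ((C V ^^ m) x) = (C W ^^ m) (ms_res M V W x)"
proof -
  interpret V: cartier_map "\<O> V" "\<M> V" q "C V" using cartier_map_sec[OF VW(1)] .
  show ?thesis by (induction m) (simp_all add: C_res[OF VW] V.C_pow_closed[OF x])
qed

text \<open>The sections over \<open>W\<close> as a module over the functions on a larger open set \<open>U\<close>. The open set \<open>W\<close> is
  shrunk several times; the ring stays the same, and with it its generators over the field of
  scalars.\<close>

definition mod_on :: "'x set \<Rightarrow> 'x set \<Rightarrow> ('a, 'b) module" where
  "mod_on U W = (\<M> W)\<lparr>smult := \<lambda>a x. rs_res S U W a \<odot>\<^bsub>\<M> W\<^esub> x\<rparr>"

lemma mod_on_simps [simp]:
  "carrier (mod_on U W) = carrier (\<M> W)"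
  "\<zero>\<^bsub>mod_on U W\<^esub> = \<zero>\<^bsub>\<M> W\<^esub>"
  "x \<oplus>\<^bsub>mod_on U W\<^esub> y = x \<oplus>\<^bsub>\<M> W\<^esub> y"
  "a \<odot>\<^bsub>mod_on U W\<^esub> x = rs_res S U W a \<odot>\<^bsub>\<M> W\<^esub> x"
  by (auto simp: mod_on_def)

lemma module_on:
  assumes UW: "rs_open S U" "rs_open S W" "W \<subseteq> U"
  shows "Module.module (\<O> U) (mod_on U W)"
proof -
  interpret W: Module.module "\<O> W" "\<M> W" using module_sec[OF UW(2)] .
  note hom = ring_hom_memE[OF res_hom[OF UW]]
  show ?thesis
  proof (rule moduleI)
    show "cring (\<O> U)" using cring_sec[OF UW(1)] .
    show "abelian_group (mod_on U W)"
      using W.M.abelian_group_axioms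
      unfolding abelian_group_def abelian_monoid_def abelian_group_axioms_def mod_on_def by simp
  qed (auto simp: hom W.smult_l_distr W.smult_r_distr W.smult_assoc1)
qed

lemma cartier_map_on:
  assumes UW: "rs_open S U" "rs_open S W" "W \<subseteq> U"
  shows "cartier_map (\<O> U) (mod_on U W) q (C W)"
proof (intro cartier_map.intro cartier_map_axioms.intro)
  show "Module.module (\<O> U) (mod_on U W)" using module_on[OF UW] .
  fix a x assume "a \<in> carrier (\<O> U)" "x \<in> carrier (mod_on U W)"
  then show "C W ((a [^]\<^bsub>\<O> U\<^esub> q) \<odot>\<^bsub>mod_on U W\<^esub> x) = a \<odot>\<^bsub>mod_on U W\<^esub> C W x"
    using C_sec(3)[OF UW(2)] res_closed[OF UW] res_pow[OF UW] by simp
qed (use q C_sec[OF UW(2)] in auto)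

abbreviation span_on :: "'x set \<Rightarrow> 'x set \<Rightarrow> 'b set \<Rightarrow> 'b set" where
  "span_on U W \<equiv> lspan (carrier (\<O> U)) (mod_on U W)"

lemma span_on_restrict:
  assumes U: "rs_open S U" and W: "rs_open S W" "W \<subseteq> U" and W': "rs_open S W'" "W' \<subseteq> W"
    and G: "G \<subseteq> carrier (\<M> W)" and x: "x \<in> span_on U W G"
  shows "ms_res M W W' x \<in> span_on U W' (ms_res M W W' ` G)"
  using module_on[OF U W] subset_refl _ x
proof (rule lspan_hom)
  fix a g assume a: "a \<in> carrier (\<O> U)" and g: "g \<in> G"
  have "ms_res M W W' (a \<odot>\<^bsub>mod_on U W\<^esub> g) = a \<odot>\<^bsub>mod_on U W'\<^esub> ms_res M W W' g"
    using mres_smult[OF W(1) W', of "rs_res S U W a" g] res_closed[OF U W a] res_res[OF U W(1) W' W(2) a] G g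
    by auto
  then show "\<exists>a'\<in>carrier (\<O> U). \<exists>g'\<in>ms_res M W W' ` G.
      ms_res M W W' (a \<odot>\<^bsub>mod_on U W\<^esub> g) = a' \<odot>\<^bsub>mod_on U W'\<^esub> g'" using a g by blast
qed (use W W' G mres_zero mres_add in auto)

text \<open>The coefficients are functions on \<open>U\<close> and thus make sense over every \<open>W\<close> in between.\<close>

lemma span_on_lift:
  assumes U: "rs_open S U" and W: "rs_open S W" "W \<subseteq> U" and W': "rs_open S W'" "W' \<subseteq> W"
    and G: "G \<subseteq> carrier (\<M> W)" and x: "x \<in> span_on U W' (ms_res M W W' ` G)"
  shows "\<exists>x0\<in>span_on U W G. ms_res M W W' x0 = x"
  using x
proof induction
  case lspan_zero
  show ?case using mres_zero[OF W(1) W'] lspan.lspan_zero[of "mod_on U W"] by auto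
next
  case (lspan_step a g x)
  then obtain x0 g0 where x0: "x0 \<in> span_on U W G" "ms_res M W W' x0 = x"
    and g0: "g0 \<in> G" "g = ms_res M W W' g0" by blast
  interpret UW: Module.module "\<O> U" "mod_on U W" using module_on[OF U W] .
  have gM: "g0 \<in> carrier (\<M> W)" using g0 G by blast
  have x0M: "x0 \<in> carrier (\<M> W)" using x0 UW.lspan_closed[OF subset_refl, of G] G by auto
  have aM: "rs_res S U W a \<odot>\<^bsub>\<M> W\<^esub> g0 \<in> carrier (\<M> W)"
    using UW.smult_closed[OF lspan_step(1), of g0] gM by simp
  have "ms_res M W W' (a \<odot>\<^bsub>mod_on U W\<^esub> g0 \<oplus>\<^bsub>mod_on U W\<^esub> x0) = a \<odot>\<^bsub>mod_on U W'\<^esub> g \<oplus>\<^bsub>mod_on U W'\<^esub> x"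
    using mres_add[OF W(1) W' aM x0M] mres_smult[OF W(1) W' res_closed[OF U W lspan_step(1)] gM]
      res_res[OF U W(1) W' W(2) lspan_step(1)] g0 x0 by simp
  moreover have "a \<odot>\<^bsub>mod_on U W\<^esub> g0 \<oplus>\<^bsub>mod_on U W\<^esub> x0 \<in> span_on U W G"
    using lspan_step(1) g0(1) x0(1) by (rule lspan.lspan_step)
  ultimately show ?case by blast
qed

lemma span_on_subset:
  assumes U: "rs_open S U" and W: "rs_open S W" "W \<subseteq> U" and G: "G \<subseteq> carrier (\<M> W)"
  shows "span_on U W G \<subseteq> sec_span W G"
proof
  fix x assume "x \<in> span_on U W G"
  with module_on[OF U W] subset_refl _ have "(\<lambda>x. x) x \<in> sec_span W G"
  proof (rule lspan_hom)
    fix a g assume "a \<in> carrier (\<O> U)" "g \<in> G"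
    then show "\<exists>a'\<in>carrier (\<O> W). \<exists>g'\<in>G. a \<odot>\<^bsub>mod_on U W\<^esub> g = a' \<odot>\<^bsub>\<M> W\<^esub> g'"
      using res_closed[OF U W] by auto
  qed (use G in auto)
  then show "x \<in> sec_span W G" .
qed

text \<open>The inclusion of image sheaves \<open>C\<^sup>m(E) \<subseteq> C\<^sup>m(F)\<close> over \<open>W\<close>, in a form that speaks of sections of \<open>E\<close>
  only, since a section of the image sheaf comes from sections of \<open>E\<close> only locally.\<close>

definition image_le :: "nat \<Rightarrow> ('x set \<Rightarrow> 'b set) \<Rightarrow> ('x set \<Rightarrow> 'b set) \<Rightarrow> 'x set \<Rightarrow> bool" where
  "image_le m E F W \<longleftrightarrow> (\<forall>V y t. rs_open S V \<and> V \<subseteq> W \<and> y \<in> V \<and> t \<in> E V \<longrightarrow>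
     (\<exists>V'. rs_open S V' \<and> y \<in> V' \<and> V' \<subseteq> V \<and> ms_res M V V' ((C V ^^ m) t) \<in> (C V' ^^ m) ` F V'))"

lemma cartier_image_subset:
  assumes cover: "rs_points S \<subseteq> \<Union>\<W>" and le: "\<And>W. W \<in> \<W> \<Longrightarrow> rs_open S W \<and> image_le m E F W"
    and E: "\<And>V. rs_open S V \<Longrightarrow> E V \<subseteq> carrier (\<M> V)"
    and E_restrict: "\<And>V W t. rs_open S V \<Longrightarrow> rs_open S W \<Longrightarrow> W \<subseteq> V \<Longrightarrow> t \<in> E V \<Longrightarrow> ms_res M V W t \<in> E W"
    and V: "rs_open S V"
  shows "cartier_image S M C m E V \<subseteq> cartier_image S M C m F V"
proof
  fix s assume s: "s \<in> cartier_image S M C m E V"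
  then have sM: "s \<in> carrier (\<M> V)" unfolding cartier_image_def by blast
  have "\<exists>V'. rs_open S V' \<and> y \<in> V' \<and> V' \<subseteq> V \<and> ms_res M V V' s \<in> (C V' ^^ m) ` F V'" if y: "y \<in> V" for y
  proof -
    have "\<exists>V1. rs_open S V1 \<and> y \<in> V1 \<and> V1 \<subseteq> V \<and> ms_res M V V1 s \<in> (C V1 ^^ m) ` E V1"
      using s y unfolding cartier_image_def by simp
    then obtain V1 t where V1: "rs_open S V1" "y \<in> V1" "V1 \<subseteq> V" and t: "t \<in> E V1"
      and st: "ms_res M V V1 s = (C V1 ^^ m) t" by blast
    obtain W where W: "W \<in> \<W>" "y \<in> W" using cover y openin_subset[OF V] by blast
    let ?V2 = "V1 \<inter> W"
    have V2: "rs_open S ?V2" "?V2 \<subseteq> V1" "?V2 \<subseteq> W" "y \<in> ?V2" using V1 W le by auto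
    have tM: "t \<in> carrier (\<M> V1)" using t E V1 by blast
    have "ms_res M V1 ?V2 t \<in> E ?V2" using E_restrict[OF V1(1) V2(1,2) t] .
    then obtain V3 where V3: "rs_open S V3" "y \<in> V3" "V3 \<subseteq> ?V2"
      and img: "ms_res M ?V2 V3 ((C ?V2 ^^ m) (ms_res M V1 ?V2 t)) \<in> (C V3 ^^ m) ` F V3"
      using le[OF W(1)] V2 unfolding image_le_def by blast
    have V3': "V3 \<subseteq> V1" "V3 \<subseteq> V" using V3 V2 V1 by auto
    have tV3: "ms_res M ?V2 V3 (ms_res M V1 ?V2 t) = ms_res M V1 V3 t"
      using mres_res[OF V1(1) V2(1) V3(1,3) V2(2) tM] .
    have "ms_res M V V3 s = ms_res M V1 V3 (ms_res M V V1 s)"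
      using mres_res[OF V V1(1) V3(1) V3'(1) V1(3) sM] by simp
    also have "\<dots> = (C V3 ^^ m) (ms_res M V1 V3 t)"
      unfolding st using C_pow_res[OF V1(1) V3(1) V3'(1) tM] .
    also have "\<dots> \<in> (C V3 ^^ m) ` F V3"
      using img C_pow_res[OF V2(1) V3(1,3) mres_closed[OF V1(1) V2(1,2) tM]] unfolding tV3 by simp
    finally show ?thesis using V3 V3' by blast
  qed
  then show "s \<in> cartier_image S M C m F V" using sM unfolding cartier_image_def by simp
qed

end

text \<open>An affine open set whose ring of functions is generated by the finite set \<open>T\<close> over a field \<open>K\<close> that is
  finite over its \<open>q\<close>-th powers. The last assumption is quantified over modules because it is applied to
  the sections over different open subsets.\<close>

locale affine_chart = cartier_sheaf S M q C
  for S :: "('x, 'a) ringed_space" and M :: "('x, 'a, 'b) module_sheaf" and q C +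
  fixes U :: "'x set" and K T B :: "'a set"
  assumes U_affine: "affine_open S U"
    and K_subring: "subring K (rs_sec S U)"
    and K_inverse: "\<And>c. c \<in> K \<Longrightarrow> c \<noteq> \<zero>\<^bsub>rs_sec S U\<^esub> \<Longrightarrow> \<exists>d\<in>K. d \<otimes>\<^bsub>rs_sec S U\<^esub> c = \<one>\<^bsub>rs_sec S U\<^esub>"
    and T: "finite T" "T \<subseteq> carrier (rs_sec S U)"
    and generated: "carrier (rs_sec S U) = generate_ring (rs_sec S U) (K \<union> T)"
    and B: "finite B" "B \<subseteq> carrier (rs_sec S U)"
    and F_finite: "\<And>(M' :: ('a, 'b) module) c y. Module.module (rs_sec S U) M' \<Longrightarrow> c \<in> K \<Longrightarrow> y \<in> carrier M' \<Longrightarrow>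
      c \<odot>\<^bsub>M'\<^esub> y \<in> lspan ((\<lambda>a. a [^]\<^bsub>rs_sec S U\<^esub> q) ` K) M' ((\<lambda>b. b \<odot>\<^bsub>M'\<^esub> y) ` B)"
begin

lemma U_open: "rs_open S U"
  using U_affine unfolding affine_open_def by blast

lemma cartier_algebra_on:
  assumes W: "rs_open S W" "W \<subseteq> U"
  shows "cartier_algebra (\<O> U) (mod_on U W) K q (C W) T B"
  using module_on[OF U_open W] cartier_map_on[OF U_open W] K_subring K_inverse T generated B F_finite
  by (intro cartier_algebra.intro cartier_algebra_axioms.intro scalar_field.intro scalar_field_axioms.intro)

definition unit_on :: "'x set \<Rightarrow> 'a \<Rightarrow> bool" where
  "unit_on D u \<longleftrightarrow> rs_open S D \<and> D \<subseteq> U \<and> u \<in> carrier (\<O> U) \<and> rs_res S U D u \<in> Units (\<O> D)"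

lemma unit_on_restrict:
  assumes u: "unit_on D u" and D': "rs_open S D'" "D' \<subseteq> D"
  shows "unit_on D' u"
proof -
  have D: "rs_open S D" "D \<subseteq> U" "u \<in> carrier (\<O> U)" using u unfolding unit_on_def by auto
  have "rs_res S D D' (rs_res S U D u) \<in> Units (\<O> D')"
    using u unfolding unit_on_def by (intro ring_hom_Units[OF res_hom[OF D(1) D']]) auto
  then show ?thesis using D D' res_res[OF U_open D(1) D' D(2,3)] unfolding unit_on_def by auto
qed

lemma unit_on_mult:
  assumes "unit_on D u" "unit_on D v"
  shows "unit_on D (u \<otimes>\<^bsub>\<O> U\<^esub> v)"
proof -
  have D: "rs_open S D" "D \<subseteq> U" "u \<in> carrier (\<O> U)" "v \<in> carrier (\<O> U)"
    using assms unfolding unit_on_def by auto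
  interpret U: cring "\<O> U" using cring_sec[OF U_open] .
  interpret D: cring "\<O> D" using cring_sec[OF D(1)] .
  show ?thesis
    using assms D ring_hom_memE(2)[OF res_hom[OF U_open D(1,2)] D(3,4)] unfolding unit_on_def by auto
qed

lemma unit_on_one:
  assumes "rs_open S D" "D \<subseteq> U"
  shows "unit_on D \<one>\<^bsub>\<O> U\<^esub>"
proof -
  interpret U: cring "\<O> U" using cring_sec[OF U_open] .
  interpret D: cring "\<O> D" using cring_sec[OF assms(1)] .
  show ?thesis using assms ring_hom_memE(4)[OF res_hom[OF U_open assms]] unfolding unit_on_def by auto
qed

lemma unit_on_inverse:
  assumes "unit_on D u"
  obtains v where "v \<in> carrier (\<O> D)" "v \<otimes>\<^bsub>\<O> D\<^esub> rs_res S U D u = \<one>\<^bsub>\<O> D\<^esub>"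
  using assms unfolding unit_on_def Units_def by blast

text \<open>A denominator that clears \<open>z\<close> on \<open>D1\<close> still does so on a smaller set, and so does every multiple of
  it. This makes products of denominators common denominators.\<close>

lemma denominator_restrict:
  assumes W: "rs_open S W" "W \<subseteq> U" and G: "G \<subseteq> carrier (\<M> W)"
    and V: "rs_open S V" "V \<subseteq> W" and z: "z \<in> carrier (\<M> V)"
    and D1: "rs_open S D1" "D1 \<subseteq> V" and u: "u \<in> carrier (\<O> U)"
    and uz: "u \<odot>\<^bsub>mod_on U D1\<^esub> ms_res M V D1 z \<in> span_on U D1 (ms_res M W D1 ` G)"
    and D: "rs_open S D" "D \<subseteq> D1" and w: "w \<in> carrier (\<O> U)"
  shows "(w \<otimes>\<^bsub>\<O> U\<^esub> u) \<odot>\<^bsub>mod_on U D\<^esub> ms_res M V D z \<in> span_on U D (ms_res M W D ` G)"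
proof -
  have sub: "D1 \<subseteq> W" "D1 \<subseteq> U" "D \<subseteq> U" "D \<subseteq> V" "D \<subseteq> W" using D D1 V W by auto
  interpret D: Module.module "\<O> U" "mod_on U D" using module_on[OF U_open D(1) sub(3)] .
  have GD: "ms_res M W D ` G \<subseteq> carrier (mod_on U D)" using mres_closed[OF W(1) D(1) sub(5)] G by auto
  have GD1: "ms_res M W D1 ` G \<subseteq> carrier (\<M> D1)" using mres_closed[OF W(1) D1(1) sub(1)] G by auto
  have zD: "ms_res M V D z \<in> carrier (mod_on U D)" using mres_closed[OF V(1) D(1) sub(4) z] by simp
  have zD1: "ms_res M V D1 z \<in> carrier (\<M> D1)" using mres_closed[OF V(1) D1 z] .
  have "ms_res M D1 D (u \<odot>\<^bsub>mod_on U D1\<^esub> ms_res M V D1 z) \<in> span_on U D (ms_res M D1 D ` ms_res M W D1 ` G)"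
    using span_on_restrict[OF U_open D1(1) sub(2) D GD1 uz] .
  also have "ms_res M D1 D ` ms_res M W D1 ` G = ms_res M W D ` G"
    using mres_image[OF W(1) D1(1) D sub(1) G] .
  also have "ms_res M D1 D (u \<odot>\<^bsub>mod_on U D1\<^esub> ms_res M V D1 z) = u \<odot>\<^bsub>mod_on U D\<^esub> ms_res M V D z"
    using mres_smult[OF D1(1) D res_closed[OF U_open D1(1) sub(2) u] zD1]
      res_res[OF U_open D1(1) D sub(2) u] mres_res[OF V(1) D1(1) D D1(2) z] by simp
  finally have "w \<odot>\<^bsub>mod_on U D\<^esub> (u \<odot>\<^bsub>mod_on U D\<^esub> ms_res M V D z) \<in> span_on U D (ms_res M W D ` G)"
    by (rule D.lspan_R_smult[OF GD w])
  then show ?thesis using D.smult_assoc1[OF w u zD] by simp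
qed

text \<open>Local coefficients are fractions of functions on \<open>U\<close>, and finitely many of them have a common
  denominator.\<close>

lemma clear_denominators:
  assumes W: "rs_open S W" "W \<subseteq> U" and G: "G \<subseteq> carrier (\<M> W)"
    and V: "rs_open S V" "V \<subseteq> W" and y: "y \<in> V"
    and t: "t \<in> sec_span V (ms_res M W V ` G)"
  shows "\<exists>D u. unit_on D u \<and> y \<in> D \<and> D \<subseteq> V \<and>
    u \<odot>\<^bsub>mod_on U D\<^esub> ms_res M V D t \<in> span_on U D (ms_res M W D ` G)"
proof -
  have VU: "V \<subseteq> U" using V W by blast
  have GV: "ms_res M W V ` G \<subseteq> carrier (\<M> V)" using mres_closed[OF W(1) V] G by auto
  interpret V: Module.module "\<O> V" "\<M> V" using module_sec[OF V(1)] .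
  show ?thesis using t
  proof induction
    case lspan_zero
    interpret VU: Module.module "\<O> U" "mod_on U V" using module_on[OF U_open V(1) VU] .
    show ?case
      using unit_on_one[OF V(1) VU] y mres_id[OF V(1)] VU.smult_r_null[OF VU.R.one_closed]
        lspan.lspan_zero[of "mod_on U V"]
      by (intro exI[of _ V] exI[of _ "\<one>\<^bsub>\<O> U\<^esub>"]) simp
  next
    case (lspan_step a g t)
    then obtain g0 D2 u2 where g0: "g0 \<in> G" "g = ms_res M W V g0"
      and D2: "unit_on D2 u2" "y \<in> D2" "D2 \<subseteq> V"
      and u2t: "u2 \<odot>\<^bsub>mod_on U D2\<^esub> ms_res M V D2 t \<in> span_on U D2 (ms_res M W D2 ` G)" by blast
    obtain D1 u1 \<alpha> where D1: "rs_open S D1" "y \<in> D1" "D1 \<subseteq> V" and u1: "u1 \<in> carrier (\<O> U)"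
      and \<alpha>: "\<alpha> \<in> carrier (\<O> U)" and unit1: "rs_res S U D1 u1 \<in> Units (\<O> D1)"
      and frac: "rs_res S U D1 u1 \<otimes>\<^bsub>\<O> D1\<^esub> rs_res S V D1 a = rs_res S U D1 \<alpha>"
      using affine_open_fractions[OF ringed U_affine V(1) VU y lspan_step(1)] by blast
    have D1U: "D1 \<subseteq> U" using D1 VU by blast
    have D2o: "rs_open S D2" and u2: "u2 \<in> carrier (\<O> U)" using D2 unfolding unit_on_def by auto
    let ?D = "D1 \<inter> D2"
    have o: "rs_open S ?D" "?D \<subseteq> D1" "?D \<subseteq> D2" "?D \<subseteq> V" "?D \<subseteq> W" "?D \<subseteq> U" using D1 D2o V W by auto
    interpret D: Module.module "\<O> ?D" "\<M> ?D" using module_sec[OF o(1)] .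
    interpret DU: Module.module "\<O> U" "mod_on U ?D" using module_on[OF U_open o(1,6)] .
    let ?u = "u1 \<otimes>\<^bsub>\<O> U\<^esub> u2"
    have unit: "unit_on ?D ?u"
    proof -
      have "unit_on D1 u1" using D1 D1U u1 unit1 unfolding unit_on_def by blast
      then show ?thesis using unit_on_restrict[OF _ o(1)] o D2 by (intro unit_on_mult) auto
    qed
    have tM: "t \<in> carrier (\<M> V)" using lspan_step(3) V.lspan_closed[OF subset_refl GV] by blast
    have gM: "g0 \<in> carrier (\<M> W)" "g \<in> carrier (\<M> V)" using g0 G GV by auto
    have GD: "ms_res M W ?D ` G \<subseteq> carrier (mod_on U ?D)" using mres_closed[OF W(1) o(1,5)] G by auto
    have res: "rs_res S U ?D u1 \<in> carrier (\<O> ?D)" "rs_res S U ?D u2 \<in> carrier (\<O> ?D)"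
      "rs_res S U ?D \<alpha> \<in> carrier (\<O> ?D)" "rs_res S V ?D a \<in> carrier (\<O> ?D)"
      using res_closed[OF U_open o(1,6)] res_closed[OF V(1) o(1,4)] u1 u2 \<alpha> lspan_step(1) by auto
    have gD: "ms_res M W ?D g0 \<in> carrier (\<M> ?D)" "ms_res M V ?D g = ms_res M W ?D g0"
      using GD g0 mres_res[OF W(1) V(1) o(1,4) V(2) gM(1)] by auto
    have tD: "ms_res M V ?D t \<in> carrier (\<M> ?D)" using mres_closed[OF V(1) o(1,4) tM] .
    have frac': "rs_res S U ?D u1 \<otimes>\<^bsub>\<O> ?D\<^esub> rs_res S V ?D a = rs_res S U ?D \<alpha>"
      using ring_hom_memE(2)[OF res_hom[OF D1(1) o(1,2)], of "rs_res S U D1 u1" "rs_res S V D1 a"]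
        frac res_closed[OF U_open D1(1) D1U u1] res_closed[OF V(1) D1(1,3) lspan_step(1)]
        res_res[OF U_open D1(1) o(1,2) D1U] res_res[OF V(1) D1(1) o(1,2) D1(3)] u1 \<alpha> lspan_step(1)
      by simp
    have "ms_res M V ?D (a \<odot>\<^bsub>\<M> V\<^esub> g \<oplus>\<^bsub>\<M> V\<^esub> t) =
        rs_res S V ?D a \<odot>\<^bsub>\<M> ?D\<^esub> ms_res M W ?D g0 \<oplus>\<^bsub>\<M> ?D\<^esub> ms_res M V ?D t"
      using mres_add[OF V(1) o(1,4) _ tM] mres_smult[OF V(1) o(1,4) lspan_step(1) gM(2)] gD(2)
        V.smult_closed[OF lspan_step(1) gM(2)] by simp
    then have "?u \<odot>\<^bsub>mod_on U ?D\<^esub> ms_res M V ?D (a \<odot>\<^bsub>\<M> V\<^esub> g \<oplus>\<^bsub>\<M> V\<^esub> t) =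
        ?u \<odot>\<^bsub>mod_on U ?D\<^esub> (rs_res S V ?D a \<odot>\<^bsub>\<M> ?D\<^esub> ms_res M W ?D g0)
        \<oplus>\<^bsub>mod_on U ?D\<^esub> ?u \<odot>\<^bsub>mod_on U ?D\<^esub> ms_res M V ?D t"
      using DU.smult_r_distr[of ?u] u1 u2 D.smult_closed[OF res(4) gD(1)] tD by simp
    also have "?u \<odot>\<^bsub>mod_on U ?D\<^esub> (rs_res S V ?D a \<odot>\<^bsub>\<M> ?D\<^esub> ms_res M W ?D g0) =
        (u2 \<otimes>\<^bsub>\<O> U\<^esub> \<alpha>) \<odot>\<^bsub>mod_on U ?D\<^esub> ms_res M W ?D g0"
    proof -
      have "(rs_res S U ?D u1 \<otimes>\<^bsub>\<O> ?D\<^esub> rs_res S U ?D u2) \<otimes>\<^bsub>\<O> ?D\<^esub> rs_res S V ?D a =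
          rs_res S U ?D u2 \<otimes>\<^bsub>\<O> ?D\<^esub> rs_res S U ?D \<alpha>"
        unfolding frac'[symmetric] using res by (simp add: D.m_ac)
      then show ?thesis
        using ring_hom_memE(2)[OF res_hom[OF U_open o(1,6)]] u1 u2 \<alpha> res gD
        by (simp add: D.smult_assoc1[symmetric])
    qed
    also have "\<dots> \<oplus>\<^bsub>mod_on U ?D\<^esub> ?u \<odot>\<^bsub>mod_on U ?D\<^esub> ms_res M V ?D t \<in> span_on U ?D (ms_res M W ?D ` G)"
    proof (rule lspan.lspan_step)
      show "?u \<odot>\<^bsub>mod_on U ?D\<^esub> ms_res M V ?D t \<in> span_on U ?D (ms_res M W ?D ` G)"
        using denominator_restrict[OF W G V tM D2o D2(3) u2 u2t o(1,3) u1] .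
    qed (use u2 \<alpha> g0 in auto)
    finally show ?case using unit o D1 D2 by blast
  qed
qed

lemma common_denominator:
  assumes W: "rs_open S W" "W \<subseteq> U" and G: "G \<subseteq> carrier (\<M> W)" and x: "x \<in> W"
    and gen: "generated_over S M (\<lambda>V. carrier (\<M> V)) W G"
    and Y: "finite Y" "Y \<subseteq> carrier (\<M> W)"
  shows "\<exists>D u. unit_on D u \<and> x \<in> D \<and> D \<subseteq> W \<and>
    (\<forall>y\<in>Y. u \<odot>\<^bsub>mod_on U D\<^esub> ms_res M W D y \<in> span_on U D (ms_res M W D ` G))"
  using Y
proof (induction Y)
  case empty
  show ?case using unit_on_one[OF W] x by blast
next
  case (insert y Y)
  then obtain D1 u1 where D1: "unit_on D1 u1" "x \<in> D1" "D1 \<subseteq> W"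
    and IH: "\<forall>y\<in>Y. u1 \<odot>\<^bsub>mod_on U D1\<^esub> ms_res M W D1 y \<in> span_on U D1 (ms_res M W D1 ` G)" by auto
  have yM: "y \<in> carrier (\<M> W)" using insert by blast
  obtain V where V: "rs_open S V" "x \<in> V" "V \<subseteq> W"
    and yV: "ms_res M W V y \<in> sec_span V (ms_res M W V ` G)"
    using generated_overE[OF gen W(1) subset_refl yM x] .
  obtain D2 u2 where D2: "unit_on D2 u2" "x \<in> D2" "D2 \<subseteq> V"
    and y2: "u2 \<odot>\<^bsub>mod_on U D2\<^esub> ms_res M V D2 (ms_res M W V y) \<in> span_on U D2 (ms_res M W D2 ` G)"
    using clear_denominators[OF W G V(1,3,2) yV] by blast
  have D1': "rs_open S D1" "u1 \<in> carrier (\<O> U)" and D2': "rs_open S D2" "u2 \<in> carrier (\<O> U)"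
    using D1 D2 unfolding unit_on_def by auto
  have D2W: "D2 \<subseteq> W" using D2 V by blast
  have y2': "u2 \<odot>\<^bsub>mod_on U D2\<^esub> ms_res M W D2 y \<in> span_on U D2 (ms_res M W D2 ` G)"
    using y2 mres_res[OF W(1) V(1) D2'(1) D2(3) V(3) yM] by simp
  let ?D = "D1 \<inter> D2" and ?u = "u1 \<otimes>\<^bsub>\<O> U\<^esub> u2"
  have o: "rs_open S ?D" "?D \<subseteq> D1" "?D \<subseteq> D2" using D1' D2' by auto
  interpret U: cring "\<O> U" using cring_sec[OF U_open] .
  have comm: "?u = u2 \<otimes>\<^bsub>\<O> U\<^esub> u1" using D1' D2' by (intro U.m_comm)
  have "unit_on ?D ?u"
    using unit_on_mult[OF unit_on_restrict[OF D1(1) o(1,2)] unit_on_restrict[OF D2(1) o(1,3)]] .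
  moreover have "?u \<odot>\<^bsub>mod_on U ?D\<^esub> ms_res M W ?D y \<in> span_on U ?D (ms_res M W ?D ` G)"
    using denominator_restrict[OF W G W(1) subset_refl yM D2'(1) D2W D2'(2) y2' o(1,3) D1'(2)] .
  moreover have "?u \<odot>\<^bsub>mod_on U ?D\<^esub> ms_res M W ?D y' \<in> span_on U ?D (ms_res M W ?D ` G)" if "y' \<in> Y" for y'
    unfolding comm
    using denominator_restrict[OF W G W(1) subset_refl _ D1'(1) D1(3) D1'(2) _ o(1,2) D2'(2), of y'] IH that insert
    by blast
  ultimately show ?case using D1 D2 by blast
qed

end

locale cartier_chart = affine_chart S M q C U K T B + ideal_and_submodule S M I N
  for S :: "('x, 'a) ringed_space" and M :: "('x, 'a, 'b) module_sheaf" and q C U K T B I N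
begin

abbreviation trace_on :: "'x set \<Rightarrow> 'a \<Rightarrow> 'b set \<Rightarrow> nat \<Rightarrow> nat \<Rightarrow> 'b set" where
  "trace_on D \<equiv> cartier_map.trace (\<O> U) (mod_on U D) (C D)"

text \<open>Here \<open>u\<close> is a common denominator for \<open>H\<close> and for the finitely many sections whose span contains the
  image under \<open>C\<close> of the span of \<open>G\<close>, and \<open>G'\<close> is \<open>u\<^bsup>-2\<^esup>G\<close>. One factor \<open>u\<close> clears the
  denominators and the other one comes from \<open>uC(y) = C(u\<^sup>qy)\<close>, where \<open>u\<^sup>qy\<close> lies in the span of \<open>G\<close>
  because \<open>q\<close> is at least \<open>2\<close>. The generator \<open>f\<close> is multiplied by a denominator, too: this turns it
  into a function \<open>\<alpha>\<close> on \<open>U\<close> that generates the same ideal.\<close>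

lemma exists_stable_chart:
  assumes gens: "generators_over S M I N W f H" and W: "W \<subseteq> U" and x: "x \<in> W" and H_finite: "finite H"
    and G: "finite G" "G \<subseteq> carrier (\<M> W)"
    and M_generated: "generated_over S M (\<lambda>V. carrier (\<M> V)) W G"
  shows "\<exists>D \<alpha> G' H'. x \<in> D \<and> D \<subseteq> U \<and> \<alpha> \<in> carrier (\<O> U) \<and>
    generators_over S M I N D (rs_res S U D \<alpha>) H' \<and> finite H' \<and>
    finite G' \<and> G' \<subseteq> carrier (\<M> D) \<and> (\<forall>y\<in>span_on U D G'. C D y \<in> span_on U D G') \<and>
    H' \<subseteq> span_on U D G'"
proof -
  interpret gen: generators_over S M I N W f H by fact
  have Wo: "rs_open S W" by (rule gen.D)
  interpret U: cring "\<O> U" using cring_sec[OF U_open] .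
  interpret CW: cartier_algebra "\<O> U" "mod_on U W" K q "C W" T B using cartier_algebra_on[OF Wo W] .
  have GW: "G \<subseteq> carrier (mod_on U W)" using G by simp
  \<comment> \<open>These finitely many sections become combinations of the generators after multiplication by one unit.\<close>
  let ?Y = "CW.gens G \<union> H"
  have Y: "finite ?Y" "?Y \<subseteq> carrier (\<M> W)"
    using CW.finite_gens[OF G(1)] H_finite CW.gens_closed[OF GW] gen.H_closed by auto
  obtain D1 u where D1: "unit_on D1 u" "x \<in> D1" "D1 \<subseteq> W"
    and uY1: "\<forall>y\<in>?Y. u \<odot>\<^bsub>mod_on U D1\<^esub> ms_res M W D1 y \<in> span_on U D1 (ms_res M W D1 ` G)"
    using common_denominator[OF Wo W G(2) x M_generated Y] by blast
  obtain D2 u2 \<alpha> where D2: "rs_open S D2" "x \<in> D2" "D2 \<subseteq> W" and u2: "u2 \<in> carrier (\<O> U)"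
    and \<alpha>: "\<alpha> \<in> carrier (\<O> U)" and unit2: "rs_res S U D2 u2 \<in> Units (\<O> D2)"
    and frac: "rs_res S U D2 u2 \<otimes>\<^bsub>\<O> D2\<^esub> rs_res S W D2 f = rs_res S U D2 \<alpha>"
    using affine_open_fractions[OF ringed U_affine Wo W x gen.f_closed] by blast
  let ?D = "D1 \<inter> D2"
  have D1o: "rs_open S D1" and u: "u \<in> carrier (\<O> U)" using D1 unfolding unit_on_def by auto
  have D: "rs_open S ?D" "?D \<subseteq> D1" "?D \<subseteq> D2" "?D \<subseteq> W" "?D \<subseteq> U" "x \<in> ?D"
    using D1 D1o D2 W by auto
  have D2U: "D2 \<subseteq> U" using D2 W by blast
  have unitD: "unit_on ?D u" using unit_on_restrict[OF D1(1) D(1,2)] .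
  have "unit_on D2 u2" using D2 D2U u2 unit2 unfolding unit_on_def by blast
  then have unitD2: "unit_on ?D u2" using D(1,3) by (rule unit_on_restrict)
  interpret D: Module.module "\<O> ?D" "\<M> ?D" using module_sec[OF D(1)] .
  interpret CD: cartier_map "\<O> U" "mod_on U ?D" q "C ?D" using cartier_map_on[OF U_open D(1,5)] .
  let ?G0 = "ms_res M W ?D ` G"
  have G0: "?G0 \<subseteq> carrier (mod_on U ?D)" using mres_closed[OF Wo D(1,4)] G(2) by auto
  have uY: "u \<odot>\<^bsub>mod_on U ?D\<^esub> ms_res M W ?D y \<in> span_on U ?D ?G0" if y: "y \<in> ?Y" for y
  proof -
    have yM: "y \<in> carrier (\<M> W)" using y Y by blast
    have "(\<one>\<^bsub>\<O> U\<^esub> \<otimes>\<^bsub>\<O> U\<^esub> u) \<odot>\<^bsub>mod_on U ?D\<^esub> ms_res M W ?D y \<in> span_on U ?D ?G0"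
      using denominator_restrict[OF Wo W G(2) Wo subset_refl yM D1o D1(3) u _ D(1,2) U.one_closed] uY1 y by blast
    then show ?thesis using u by simp
  qed
  obtain v where v: "v \<in> carrier (\<O> ?D)" "v \<otimes>\<^bsub>\<O> ?D\<^esub> rs_res S U ?D u = \<one>\<^bsub>\<O> ?D\<^esub>"
    using unit_on_inverse[OF unitD] .
  have uD: "rs_res S U ?D u \<in> carrier (\<O> ?D)" using res_closed[OF U_open D(1,5) u] .
  \<comment> \<open>The inverse of the unit acts on the sections over the smaller set, but need not come from a function on the whole chart.\<close>
  let ?G' = "(\<lambda>g. v \<odot>\<^bsub>\<M> ?D\<^esub> (v \<odot>\<^bsub>\<M> ?D\<^esub> g)) ` ?G0"
  let ?uu = "\<lambda>z. u \<odot>\<^bsub>mod_on U ?D\<^esub> (u \<odot>\<^bsub>mod_on U ?D\<^esub> z)"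
  have vu: "v \<odot>\<^bsub>\<M> ?D\<^esub> (rs_res S U ?D u \<odot>\<^bsub>\<M> ?D\<^esub> z) = z"
    and uv: "rs_res S U ?D u \<odot>\<^bsub>\<M> ?D\<^esub> (v \<odot>\<^bsub>\<M> ?D\<^esub> z) = z" if "z \<in> carrier (\<M> ?D)" for z
    using that v uD D.smult_assoc1[of v "rs_res S U ?D u" z, symmetric]
      D.smult_assoc1[of "rs_res S U ?D u" v z, symmetric] by (auto simp: D.m_comm)
  have G': "?G' \<subseteq> carrier (mod_on U ?D)" using G0 v by auto
  have to_G0: "?uu z \<in> span_on U ?D ?G0" if z: "z \<in> span_on U ?D ?G'" for z
    using CD.module_axioms subset_refl G' z
  proof (rule lspan_hom)
    fix a g assume a: "a \<in> carrier (\<O> U)" and "g \<in> ?G'"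
    then obtain g0 where g0: "g0 \<in> ?G0" and g: "g = v \<odot>\<^bsub>\<M> ?D\<^esub> (v \<odot>\<^bsub>\<M> ?D\<^esub> g0)" by blast
    have g0M: "g0 \<in> carrier (\<M> ?D)" using g0 G0 by auto
    have gM: "g \<in> carrier (mod_on U ?D)" using g g0M v by simp
    have "?uu g = g0" unfolding g using uv g0M v by simp
    moreover have "?uu (a \<odot>\<^bsub>mod_on U ?D\<^esub> g) = a \<odot>\<^bsub>mod_on U ?D\<^esub> ?uu g"
      using CD.smult_assoc1[OF u a gM, symmetric] CD.smult_assoc1[OF a u gM, symmetric]
        CD.smult_assoc1[OF u a CD.smult_closed[OF u gM], symmetric]
        CD.smult_assoc1[OF a u CD.smult_closed[OF u gM], symmetric]
        CD.smult_assoc1[OF a u gM] U.m_comm[OF u a] by metis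
    ultimately have "?uu (a \<odot>\<^bsub>mod_on U ?D\<^esub> g) = a \<odot>\<^bsub>mod_on U ?D\<^esub> g0" by simp
    then show "\<exists>a'\<in>carrier (\<O> U). \<exists>g'\<in>?G0. ?uu (a \<odot>\<^bsub>mod_on U ?D\<^esub> g) = a' \<odot>\<^bsub>mod_on U ?D\<^esub> g'"
      using a g0 by blast
  next
    show "?uu \<zero>\<^bsub>mod_on U ?D\<^esub> = \<zero>\<^bsub>mod_on U ?D\<^esub>" using uD by simp
    fix y z assume "y \<in> carrier (mod_on U ?D)" "z \<in> carrier (mod_on U ?D)"
    then show "?uu (y \<oplus>\<^bsub>mod_on U ?D\<^esub> z) = ?uu y \<oplus>\<^bsub>mod_on U ?D\<^esub> ?uu z"
      using uD by (simp add: D.smult_r_distr)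
  qed
  have from_G0: "z \<in> span_on U ?D ?G'" if z: "z \<in> carrier (\<M> ?D)" "?uu z \<in> span_on U ?D ?G0" for z
  proof -
    let ?vv = "\<lambda>z. v \<odot>\<^bsub>\<M> ?D\<^esub> (v \<odot>\<^bsub>\<M> ?D\<^esub> z)"
    from CD.module_axioms subset_refl G0 z(2) have "?vv (?uu z) \<in> span_on U ?D ?G'"
    proof (rule lspan_hom)
      fix a g assume a: "a \<in> carrier (\<O> U)" and g: "g \<in> ?G0"
      have gM: "g \<in> carrier (\<M> ?D)" using g G0 by auto
      have aD: "rs_res S U ?D a \<in> carrier (\<O> ?D)" using res_closed[OF U_open D(1,5) a] .
      have comm: "v \<odot>\<^bsub>\<M> ?D\<^esub> (rs_res S U ?D a \<odot>\<^bsub>\<M> ?D\<^esub> z) = rs_res S U ?D a \<odot>\<^bsub>\<M> ?D\<^esub> (v \<odot>\<^bsub>\<M> ?D\<^esub> z)"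
        if "z \<in> carrier (\<M> ?D)" for z
        using that aD v by (simp add: D.smult_assoc1[symmetric] D.m_comm)
      have "?vv (a \<odot>\<^bsub>mod_on U ?D\<^esub> g) = a \<odot>\<^bsub>mod_on U ?D\<^esub> ?vv g"
        using comm[OF gM] comm[OF D.smult_closed[OF v(1) gM]] by simp
      then show "\<exists>a'\<in>carrier (\<O> U). \<exists>g'\<in>?G'. ?vv (a \<odot>\<^bsub>mod_on U ?D\<^esub> g) = a' \<odot>\<^bsub>mod_on U ?D\<^esub> g'"
        using a g by blast
    qed (use v in \<open>auto simp: D.smult_r_distr\<close>)
    moreover have "?vv (?uu z) = z" using vu z uD by simp
    ultimately show ?thesis by simp
  qed
  have stable: "C ?D y \<in> span_on U ?D ?G'" if y: "y \<in> span_on U ?D ?G'" for y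
  proof (rule from_G0)
    have yM: "y \<in> carrier (mod_on U ?D)" using y CD.lspan_closed[OF subset_refl G'] by blast
    show "C ?D y \<in> carrier (\<M> ?D)" using CD.C_closed[OF yM] by simp
    \<comment> \<open>As \<open>q \<ge> 2\<close>, the element \<open>u\<^sup>qy\<close> lies in the span of the original generators and so extends to \<open>W\<close>.\<close>
    obtain j where j: "q = Suc (Suc j)" using q by (metis add_2_eq_Suc le_Suc_ex)
    have "u [^]\<^bsub>\<O> U\<^esub> q = (u [^]\<^bsub>\<O> U\<^esub> j) \<otimes>\<^bsub>\<O> U\<^esub> (u \<otimes>\<^bsub>\<O> U\<^esub> u)"
      unfolding j using u by (simp add: U.m_assoc)
    then have "(u [^]\<^bsub>\<O> U\<^esub> q) \<odot>\<^bsub>mod_on U ?D\<^esub> y = (u [^]\<^bsub>\<O> U\<^esub> j) \<odot>\<^bsub>mod_on U ?D\<^esub> ?uu y"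
      using CD.smult_assoc1[OF U.nat_pow_closed[OF u] U.m_closed[OF u u] yM] CD.smult_assoc1[OF u u yM] by metis
    then have "(u [^]\<^bsub>\<O> U\<^esub> q) \<odot>\<^bsub>mod_on U ?D\<^esub> y \<in> span_on U ?D ?G0"
      using CD.lspan_R_smult[OF G0 U.nat_pow_closed[OF u] to_G0[OF y]] by metis
    then obtain t where t: "t \<in> span_on U W G" "ms_res M W ?D t = (u [^]\<^bsub>\<O> U\<^esub> q) \<odot>\<^bsub>mod_on U ?D\<^esub> y"
      using span_on_lift[OF U_open Wo W D(1,4) G(2)] by blast
    have tM: "t \<in> carrier (\<M> W)" using t CW.lspan_closed[OF subset_refl GW] by auto
    have "u \<odot>\<^bsub>mod_on U ?D\<^esub> C ?D y = C ?D (ms_res M W ?D t)"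
      unfolding t(2) using CD.C_smult[OF u yM] by simp
    also have "\<dots> = ms_res M W ?D (C W t)" using C_res[OF Wo D(1,4) tM] by simp
    finally have Cy: "u \<odot>\<^bsub>mod_on U ?D\<^esub> C ?D y = ms_res M W ?D (C W t)" .
    have "C W t \<in> span_on U W (CW.gens G)" using CW.C_lspan_gens[OF GW t(1)] .
    then have "ms_res M W ?D (C W t) \<in> span_on U ?D (ms_res M W ?D ` CW.gens G)"
      using span_on_restrict[OF U_open Wo W D(1,4)] Y(2) by blast
    then have "ms_res M W ?D (C W t) \<in> {z \<in> carrier (mod_on U ?D). u \<odot>\<^bsub>mod_on U ?D\<^esub> z \<in> span_on U ?D ?G0}"
    proof (rule CD.lspan_least)
      show "\<zero>\<^bsub>mod_on U ?D\<^esub> \<in> {z \<in> carrier (mod_on U ?D). u \<odot>\<^bsub>mod_on U ?D\<^esub> z \<in> span_on U ?D ?G0}"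
        using CD.smult_r_null[OF u] lspan_zero[of "mod_on U ?D"] CD.M.zero_closed by simp
    next
      fix y z assume "y \<in> {z \<in> carrier (mod_on U ?D). u \<odot>\<^bsub>mod_on U ?D\<^esub> z \<in> span_on U ?D ?G0}"
        "z \<in> {z \<in> carrier (mod_on U ?D). u \<odot>\<^bsub>mod_on U ?D\<^esub> z \<in> span_on U ?D ?G0}"
      then show "y \<oplus>\<^bsub>mod_on U ?D\<^esub> z \<in> {z \<in> carrier (mod_on U ?D). u \<odot>\<^bsub>mod_on U ?D\<^esub> z \<in> span_on U ?D ?G0}"
        using CD.lspan_add[OF subset_refl G0] CD.smult_r_distr[OF u] CD.M.add.m_closed by simp
    next
      fix a g assume a: "a \<in> carrier (\<O> U)" and "g \<in> ms_res M W ?D ` CW.gens G"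
      then obtain g0 where g0: "g0 \<in> CW.gens G" "g = ms_res M W ?D g0" by blast
      have gM: "g \<in> carrier (mod_on U ?D)" using g0 Y(2) mres_closed[OF Wo D(1,4)] by auto
      have "a \<odot>\<^bsub>mod_on U ?D\<^esub> (u \<odot>\<^bsub>mod_on U ?D\<^esub> g) \<in> span_on U ?D ?G0"
        using CD.lspan_R_smult[OF G0 a uY[of g0]] g0 by simp
      then have "u \<odot>\<^bsub>mod_on U ?D\<^esub> (a \<odot>\<^bsub>mod_on U ?D\<^esub> g) \<in> span_on U ?D ?G0"
        using CD.smult_assoc1[OF u a gM] CD.smult_assoc1[OF a u gM] U.m_comm[OF u a] by metis
      then show "a \<odot>\<^bsub>mod_on U ?D\<^esub> g \<in> {z \<in> carrier (mod_on U ?D). u \<odot>\<^bsub>mod_on U ?D\<^esub> z \<in> span_on U ?D ?G0}"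
        using CD.smult_closed[OF a gM] by blast
    qed
    then show "?uu (C ?D y) \<in> span_on U ?D ?G0" unfolding Cy by simp
  qed
  let ?H = "ms_res M W ?D ` H"
  have H_span: "?H \<subseteq> span_on U ?D ?G'"
  proof
    fix h assume "h \<in> ?H"
    then obtain h0 where h0: "h0 \<in> H" "h = ms_res M W ?D h0" by blast
    have "u \<odot>\<^bsub>mod_on U ?D\<^esub> h \<in> span_on U ?D ?G0" using uY[of h0] h0 by simp
    then have "?uu h \<in> span_on U ?D ?G0" by (rule CD.lspan_R_smult[OF G0 u])
    moreover have "h \<in> carrier (\<M> ?D)" using h0 mres_closed[OF Wo D(1,4)] gen.H_closed by blast
    ultimately show "h \<in> span_on U ?D ?G'" by (intro from_G0)
  qed
  obtain v2 where v2: "v2 \<in> carrier (\<O> ?D)" "v2 \<otimes>\<^bsub>\<O> ?D\<^esub> rs_res S U ?D u2 = \<one>\<^bsub>\<O> ?D\<^esub>"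
    using unit_on_inverse[OF unitD2] .
  have u2D: "rs_res S U ?D u2 \<in> carrier (\<O> ?D)" using res_closed[OF U_open D(1,5) u2] .
  have fD: "rs_res S W ?D f \<in> carrier (\<O> ?D)" using res_closed[OF Wo D(1,4) gen.f_closed] .
  have \<alpha>D: "rs_res S U ?D \<alpha> \<in> carrier (\<O> ?D)" using res_closed[OF U_open D(1,5) \<alpha>] .
  have frac_D: "rs_res S U ?D u2 \<otimes>\<^bsub>\<O> ?D\<^esub> rs_res S W ?D f = rs_res S U ?D \<alpha>"
    using ring_hom_memE(2)[OF res_hom[OF D2(1) D(1,3)] res_closed[OF U_open D2(1) D2U u2] res_closed[OF Wo D2(1,3) gen.f_closed]]
      frac res_res[OF U_open D2(1) D(1,3) D2U u2] res_res[OF U_open D2(1) D(1,3) D2U \<alpha>]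
      res_res[OF Wo D2(1) D(1,3) D2(3) gen.f_closed] by simp
  have f_eq: "rs_res S W ?D f = v2 \<otimes>\<^bsub>\<O> ?D\<^esub> rs_res S U ?D \<alpha>"
    unfolding frac_D[symmetric] using v2 u2D fD by (simp add: D.m_assoc[symmetric])
  have "generators_over S M I N ?D (rs_res S U ?D \<alpha>) ?H"
  proof (intro generators_over.intro generators_over_axioms.intro)
    show "ideal_and_submodule S M I N" by (rule ideal_and_submodule_axioms)
    show "rs_open S ?D" by (rule D(1))
    have "rs_res S W ?D f \<in> I ?D" using I_restrict[OF Wo D(1,4)] gen.f by blast
    then show "rs_res S U ?D \<alpha> \<in> I ?D" unfolding frac_D[symmetric] by (rule I_mult[OF D(1) u2D])
    show "?H \<subseteq> N ?D" using N_restrict[OF Wo D(1,4)] gen.H by blast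
    have "generated_over S (structure_module S) I ?D {rs_res S U ?D \<alpha>}"
    proof (rule struct_sheaf.generated_over_change[OF gen.I_generated Wo _ D(1,4)])
      interpret struct: Module.module "\<O> ?D" "ms_sec (structure_module S) ?D"
        using struct_sheaf.module_sec[OF D(1)] .
      show "ms_res (structure_module S) W ?D ` {f} \<subseteq>
          lspan (carrier (\<O> ?D)) (ms_sec (structure_module S) ?D) {rs_res S U ?D \<alpha>}"
        using struct.lspan_smult_incl[OF subset_refl, of "{rs_res S U ?D \<alpha>}" v2] f_eq v2(1) \<alpha>D by simp
    qed (use gen.f_closed \<alpha>D in auto)
    then show "generated_over S (structure_module S) I ?D {rs_res S U ?D \<alpha>}" .
    show "generated_over S M N ?D ?H"
      using generated_over_restrict[OF gen.N_generated Wo gen.H_closed D(1,4)] .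
  qed
  then show ?thesis
    using D(5,6) \<alpha> H_span stable G' G(1) H_finite
    by (intro exI[of _ ?D] exI[of _ \<alpha>] exI[of _ ?G'] exI[of _ ?H]) auto
qed

lemma image_le_Suc:
  assumes gens: "generators_over S M I N D f H"
  shows "image_le m (INn (Suc n)) (INn n) D"
  unfolding image_le_def
proof (intro allI impI)
  interpret gen: generators_over S M I N D f H by fact
  fix V y t assume "rs_open S V \<and> V \<subseteq> D \<and> y \<in> V \<and> t \<in> INn (Suc n) V"
  then have V: "rs_open S V" "V \<subseteq> D" and y: "y \<in> V" and t: "t \<in> INn (Suc n) V" by auto
  have tM: "t \<in> carrier (\<M> V)" using t ideal_mult_closed by blast
  obtain W where W: "rs_open S W" "y \<in> W" "W \<subseteq> V" and sp: "ms_res M V W t \<in> gen.span_over (Suc n) W"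
    using generated_overE[OF gen.INn_generated V t y] unfolding gen.span_over_def by blast
  have WD: "W \<subseteq> D" using W V by blast
  have "ms_res M V W t \<in> INn n W"
    using sp gen.span_over_Suc[OF W(1) WD] gen.span_over_subset_INn[OF W(1) WD] by blast
  then show "\<exists>V'. rs_open S V' \<and> y \<in> V' \<and> V' \<subseteq> V \<and> ms_res M V V' ((C V ^^ m) t) \<in> (C V' ^^ m) ` INn n V'"
    using C_pow_res[OF V(1) W(1,3) tM] W by (intro exI[of _ W]) auto
qed

text \<open>A section of \<open>I\<^sup>nN\<close> near a point is a combination \<open>t\<close> of the sections \<open>f\<^sup>nh\<close>. If \<open>u\<close> is a common denominator
  of the coefficients, then \<open>uC\<^sup>m(t) = C\<^sup>m(u\<^sup>Qt)\<close> with \<open>Q = q\<^sup>m\<close>, and \<open>u\<^sup>Qt\<close> is a combination with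
  coefficients in \<open>\<O>(U)\<close>. So this element equals \<open>C\<^sup>m(t')\<close> for a combination \<open>t'\<close> of the sections
  \<open>f\<^bsup>n+1\<^esup>h\<close>, and \<open>C\<^sup>m(t) = C\<^sup>m(u\<^bsup>-Q\<^esup>t')\<close>.\<close>

lemma image_le_if_trace_eq:
  assumes gens: "generators_over S M I N D (rs_res S U D \<alpha>) H" and DU: "D \<subseteq> U" and \<alpha>: "\<alpha> \<in> carrier (\<O> U)"
    and eq: "trace_on D \<alpha> H m n = trace_on D \<alpha> H m (Suc n)"
  shows "image_le m (INn n) (INn (Suc n)) D"
  unfolding image_le_def
proof (intro allI impI)
  interpret gen: generators_over S M I N D "rs_res S U D \<alpha>" H by fact
  have D: "rs_open S D" by (rule gen.D)
  interpret U: cring "\<O> U" using cring_sec[OF U_open] .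
  interpret CD: cartier_map "\<O> U" "mod_on U D" q "C D" using cartier_map_on[OF U_open D DU] .
  have F_eq: "(\<lambda>h. (\<alpha> [^]\<^bsub>\<O> U\<^esub> j) \<odot>\<^bsub>mod_on U D\<^esub> h) ` H = gen.f_pow_H j" for j :: nat
    unfolding gen.f_pow_H_def using res_pow[OF U_open D DU \<alpha>] by simp
  fix V y t assume "rs_open S V \<and> V \<subseteq> D \<and> y \<in> V \<and> t \<in> INn n V"
  then have V: "rs_open S V" "V \<subseteq> D" and y: "y \<in> V" and t: "t \<in> INn n V" by auto
  have tM: "t \<in> carrier (\<M> V)" using t ideal_mult_closed by blast
  obtain V1 where V1: "rs_open S V1" "y \<in> V1" "V1 \<subseteq> V" and sp: "ms_res M V V1 t \<in> gen.span_over n V1"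
    using generated_overE[OF gen.INn_generated V t y] unfolding gen.span_over_def by blast
  have V1D: "V1 \<subseteq> D" using V1 V by blast
  obtain D' u where D': "unit_on D' u" "y \<in> D'" "D' \<subseteq> V1"
    and usp: "u \<odot>\<^bsub>mod_on U D'\<^esub> ms_res M V1 D' (ms_res M V V1 t) \<in> span_on U D' (ms_res M D D' ` gen.f_pow_H n)"
    using clear_denominators[OF D DU gen.f_pow_H_closed V1(1) V1D V1(2) sp[unfolded gen.span_over_def]] by blast
  have o: "rs_open S D'" "D' \<subseteq> D" "D' \<subseteq> U" "D' \<subseteq> V" and u: "u \<in> carrier (\<O> U)"
    using D' V1 V1D DU unfolding unit_on_def by auto
  interpret CD': cartier_map "\<O> U" "mod_on U D'" q "C D'" using cartier_map_on[OF U_open o(1,3)] .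
  interpret sec: cartier_map "\<O> D'" "\<M> D'" q "C D'" using cartier_map_sec[OF o(1)] .
  let ?z = "ms_res M V D' t" and ?Q = "q ^ m"
  have zM: "?z \<in> carrier (\<M> D')" using mres_closed[OF V(1) o(1,4) tM] .
  have uz: "u \<odot>\<^bsub>mod_on U D'\<^esub> ?z \<in> span_on U D' (ms_res M D D' ` gen.f_pow_H n)"
    using usp mres_res[OF V(1) V1(1) o(1) D'(3) V1(3) tM] by simp
  have FD': "ms_res M D D' ` gen.f_pow_H n \<subseteq> carrier (mod_on U D')"
    using gen.mres_f_pow_H_closed[OF o(1,2)] by simp
  obtain k where k: "?Q = Suc k" using q by (cases ?Q) auto
  have "(u [^]\<^bsub>\<O> U\<^esub> ?Q) \<odot>\<^bsub>mod_on U D'\<^esub> ?z = (u [^]\<^bsub>\<O> U\<^esub> k) \<odot>\<^bsub>mod_on U D'\<^esub> (u \<odot>\<^bsub>mod_on U D'\<^esub> ?z)"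
    unfolding k using CD'.smult_assoc1[OF U.nat_pow_closed[OF u] u] zM by simp
  then have "(u [^]\<^bsub>\<O> U\<^esub> ?Q) \<odot>\<^bsub>mod_on U D'\<^esub> ?z \<in> span_on U D' (ms_res M D D' ` gen.f_pow_H n)"
    using CD'.lspan_R_smult[OF FD' U.nat_pow_closed[OF u] uz] by simp
  then obtain t0 where t0: "t0 \<in> span_on U D (gen.f_pow_H n)"
    and t0z: "ms_res M D D' t0 = (u [^]\<^bsub>\<O> U\<^esub> ?Q) \<odot>\<^bsub>mod_on U D'\<^esub> ?z"
    using span_on_lift[OF U_open D DU o(1,2) gen.f_pow_H_closed] by blast
  have trace_F: "trace_on D \<alpha> H m j = (C D ^^ m) ` span_on U D (gen.f_pow_H j)" for j
    unfolding CD.trace_def F_eq ..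
  have "(C D ^^ m) t0 \<in> (C D ^^ m) ` span_on U D (gen.f_pow_H (Suc n))"
    using t0 eq unfolding trace_F by blast
  then obtain t1 where t1: "t1 \<in> span_on U D (gen.f_pow_H (Suc n))" and t01: "(C D ^^ m) t0 = (C D ^^ m) t1"
    by blast
  have tM': "t0 \<in> carrier (\<M> D)" "t1 \<in> carrier (\<M> D)"
    using t0 t1 CD.lspan_closed[OF subset_refl, of "gen.f_pow_H _"] gen.f_pow_H_closed by auto
  let ?t1 = "ms_res M D D' t1"
  have t1D': "?t1 \<in> gen.span_over (Suc n) D'"
    unfolding gen.span_over_def
    using mres_lspan_sec[OF D o(1,2) gen.f_pow_H_closed] span_on_subset[OF U_open D DU gen.f_pow_H_closed] t1 by blast
  have t1M: "?t1 \<in> carrier (\<M> D')" using mres_closed[OF D o(1,2) tM'(2)] .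
  have "rs_res S U D' u \<odot>\<^bsub>\<M> D'\<^esub> (C D' ^^ m) ?z = (C D' ^^ m) (ms_res M D D' t0)"
    unfolding t0z using CD'.C_pow_smult[of ?z u m] u zM by simp
  also have "\<dots> = (C D' ^^ m) ?t1"
    using C_pow_res[OF D o(1,2) tM'(1), of m] C_pow_res[OF D o(1,2) tM'(2), of m] t01 by simp
  finally have uC: "rs_res S U D' u \<odot>\<^bsub>\<M> D'\<^esub> (C D' ^^ m) ?z = (C D' ^^ m) ?t1" .
  obtain v where v: "v \<in> carrier (\<O> D')" "v \<otimes>\<^bsub>\<O> D'\<^esub> rs_res S U D' u = \<one>\<^bsub>\<O> D'\<^esub>"
    using unit_on_inverse[OF D'(1)] .
  have "(C D' ^^ m) ?z = v \<odot>\<^bsub>\<M> D'\<^esub> (C D' ^^ m) ?t1"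
    unfolding uC[symmetric] using v res_closed[OF U_open o(1,3) u] sec.C_pow_closed[OF zM]
    by (simp add: sec.smult_assoc1[symmetric])
  also have "\<dots> = (C D' ^^ m) ((v [^]\<^bsub>\<O> D'\<^esub> ?Q) \<odot>\<^bsub>\<M> D'\<^esub> ?t1)"
    using sec.C_pow_smult[OF t1M v(1)] by simp
  finally have Cz: "(C D' ^^ m) ?z = (C D' ^^ m) ((v [^]\<^bsub>\<O> D'\<^esub> ?Q) \<odot>\<^bsub>\<M> D'\<^esub> ?t1)" .
  have "(v [^]\<^bsub>\<O> D'\<^esub> ?Q) \<odot>\<^bsub>\<M> D'\<^esub> ?t1 \<in> gen.span_over (Suc n) D'"
    unfolding gen.span_over_def
    by (rule sec.lspan_R_smult[OF gen.mres_f_pow_H_closed[OF o(1,2)] sec.R.nat_pow_closed[OF v(1)] t1D'[unfolded gen.span_over_def]])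
  then have "(v [^]\<^bsub>\<O> D'\<^esub> ?Q) \<odot>\<^bsub>\<M> D'\<^esub> ?t1 \<in> INn (Suc n) D'"
    using gen.span_over_subset_INn[OF o(1,2)] by blast
  then have "ms_res M V D' ((C V ^^ m) t) \<in> (C D' ^^ m) ` INn (Suc n) D'"
    unfolding C_pow_res[OF V(1) o(1,4) tM] Cz by blast
  then show "\<exists>V'. rs_open S V' \<and> y \<in> V' \<and> V' \<subseteq> V \<and> ms_res M V V' ((C V ^^ m) t) \<in> (C V' ^^ m) ` INn (Suc n) V'"
    using o D'(2) by blast
qed

theorem jumps_bounded_near_point:
  assumes gens: "generators_over S M I N W f H" and W: "W \<subseteq> U" and x: "x \<in> W" and H_finite: "finite H"
    and G: "finite G" "G \<subseteq> carrier (\<M> W)"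
    and M_generated: "generated_over S M (\<lambda>V. carrier (\<M> V)) W G"
  shows "\<exists>D L. rs_open S D \<and> x \<in> D \<and> (\<forall>m. card {n \<in> {0..<q ^ m}.
    \<not> (image_le m (INn n) (INn (Suc n)) D \<and> image_le m (INn (Suc n)) (INn n) D)} \<le> L)"
proof -
  obtain D \<alpha> G' H' where D: "x \<in> D" "D \<subseteq> U" and \<alpha>: "\<alpha> \<in> carrier (\<O> U)"
    and gens': "generators_over S M I N D (rs_res S U D \<alpha>) H'" and H': "finite H'" "H' \<subseteq> span_on U D G'"
    and G': "finite G'" "G' \<subseteq> carrier (\<M> D)" and stable: "\<forall>y\<in>span_on U D G'. C D y \<in> span_on U D G'"
    using exists_stable_chart[OF assms] by blast
  have Do: "rs_open S D" using generators_over.D[OF gens'] .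
  interpret CD: cartier_algebra "\<O> U" "mod_on U D" K q "C D" T B using cartier_algebra_on[OF Do D(2)] .
  obtain L where L: "\<And>m. card {n \<in> {0..<q ^ m}. trace_on D \<alpha> H' m n \<noteq> trace_on D \<alpha> H' m (Suc n)} \<le> L"
    using CD.trace_jumps_bounded[of G' H' \<alpha>] G' stable H' \<alpha> by auto
  have "card {n \<in> {0..<q ^ m}. \<not> (image_le m (INn n) (INn (Suc n)) D \<and> image_le m (INn (Suc n)) (INn n) D)} \<le> L" for m
  proof -
    have "{n \<in> {0..<q ^ m}. \<not> (image_le m (INn n) (INn (Suc n)) D \<and> image_le m (INn (Suc n)) (INn n) D)}
        \<subseteq> {n \<in> {0..<q ^ m}. trace_on D \<alpha> H' m n \<noteq> trace_on D \<alpha> H' m (Suc n)}"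
      using image_le_if_trace_eq[OF gens' D(2) \<alpha>] image_le_Suc[OF gens'] by blast
    from card_mono[OF _ this] show ?thesis using L[of m] by simp
  qed
  then show ?thesis using Do D(1) by blast
qed

end

section \<open>F-finite fields\<close>

abbreviation self_module :: "'a ring \<Rightarrow> ('a, 'a) module" where
  "self_module R \<equiv> ring.extend R \<lparr>smult = monoid.mult R\<rparr>"

lemma self_module_simps:
  "carrier (self_module R) = carrier R" "\<zero>\<^bsub>self_module R\<^esub> = \<zero>\<^bsub>R\<^esub>"
  "x \<oplus>\<^bsub>self_module R\<^esub> y = x \<oplus>\<^bsub>R\<^esub> y" "a \<odot>\<^bsub>self_module R\<^esub> x = a \<otimes>\<^bsub>R\<^esub> x"
  by (auto simp: ring.defs)

lemma finsum_in_lspan_self: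
  assumes R: "cring R" and A: "A \<subseteq> carrier R" and G: "G \<subseteq> carrier R" and J: "finite J"
    and "c \<in> J \<rightarrow> A" "g \<in> J \<rightarrow> G"
  shows "(\<Oplus>\<^bsub>R\<^esub>j\<in>J. c j \<otimes>\<^bsub>R\<^esub> g j) \<in> lspan A (self_module R) G"
  using J assms(5,6)
proof (induction J)
  case empty
  interpret cring R by fact
  show ?case using lspan_zero[of "self_module R"] by (simp add: self_module_simps)
next
  case (insert j J)
  interpret cring R by fact
  have "(\<Oplus>\<^bsub>R\<^esub>j\<in>insert j J. c j \<otimes>\<^bsub>R\<^esub> g j) = c j \<otimes>\<^bsub>R\<^esub> g j \<oplus>\<^bsub>R\<^esub> (\<Oplus>\<^bsub>R\<^esub>j\<in>J. c j \<otimes>\<^bsub>R\<^esub> g j)"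
    using insert A G by (intro finsum_insert) (auto simp: Pi_def subset_iff)
  moreover have "c j \<odot>\<^bsub>self_module R\<^esub> g j \<oplus>\<^bsub>self_module R\<^esub> (\<Oplus>\<^bsub>R\<^esub>j\<in>J. c j \<otimes>\<^bsub>R\<^esub> g j) \<in> lspan A (self_module R) G"
    using insert by (intro lspan_step) auto
  ultimately show ?case by (simp add: self_module_simps)
qed

lemma F_finite_fieldD:
  assumes "F_finite_field p k"
  shows "field k" "(\<lambda>a. a [^]\<^bsub>k\<^esub> p) \<in> ring_hom k k"
    and "\<exists>B. finite B \<and> B \<subseteq> carrier k \<and> carrier k \<subseteq> lspan ((\<lambda>a. a [^]\<^bsub>k\<^esub> p) ` carrier k) (self_module k) B"
proof -
  show k: "field k" and hom: "(\<lambda>a. a [^]\<^bsub>k\<^esub> p) \<in> ring_hom k k"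
    using assms unfolding F_finite_field_def ring_hom_finite_def by auto
  interpret field k by fact
  obtain B where B: "finite B" "B \<subseteq> carrier k"
    and sum: "\<forall>s\<in>carrier k. \<exists>c\<in>B \<rightarrow> carrier k. s = (\<Oplus>\<^bsub>k\<^esub>b\<in>B. c b [^]\<^bsub>k\<^esub> p \<otimes>\<^bsub>k\<^esub> b)"
    using assms unfolding F_finite_field_def ring_hom_finite_def by blast
  have "s \<in> lspan ((\<lambda>a. a [^]\<^bsub>k\<^esub> p) ` carrier k) (self_module k) B" if s: "s \<in> carrier k" for s
  proof -
    obtain c where c: "c \<in> B \<rightarrow> carrier k" "s = (\<Oplus>\<^bsub>k\<^esub>b\<in>B. c b [^]\<^bsub>k\<^esub> p \<otimes>\<^bsub>k\<^esub> b)" using sum s by blast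
    show ?thesis unfolding c(2)
      using c(1) B by (intro finsum_in_lspan_self is_cring) (auto simp: Pi_def)
  qed
  then show "\<exists>B. finite B \<and> B \<subseteq> carrier k \<and> carrier k \<subseteq> lspan ((\<lambda>a. a [^]\<^bsub>k\<^esub> p) ` carrier k) (self_module k) B"
    using B by blast
qed

text \<open>By induction on \<open>e\<close>: if \<open>B\<close> generates \<open>k\<close> over its \<open>p\<^sup>e\<close>-th powers and \<open>B\<^sub>1\<close> generates it over its \<open>p\<close>-th
  powers, then the products \<open>b\<^sup>pb\<^sub>1\<close> generate it over its \<open>p\<^bsup>e+1\<^esup>\<close>-th powers. The definition of
  F-finite fields makes the Frobenius a ring homomorphism, which gives its additivity.\<close>

lemma F_finite_field_power:
  assumes k: "F_finite_field p k"
  shows "\<exists>B. finite B \<and> B \<subseteq> carrier k \<and>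
    carrier k \<subseteq> lspan ((\<lambda>a. a [^]\<^bsub>k\<^esub> (p ^ e)) ` carrier k) (self_module k) B"
proof (induction e)
  case 0
  interpret field k using F_finite_fieldD(1)[OF k] .
  interpret self: Module.module k "self_module k" using module_self[OF is_cring] .
  have "a \<in> lspan ((\<lambda>a. a [^]\<^bsub>k\<^esub> (p ^ 0)) ` carrier k) (self_module k) {\<one>\<^bsub>k\<^esub>}" if a: "a \<in> carrier k" for a
  proof -
    have "(a [^]\<^bsub>k\<^esub> (p ^ 0)) \<odot>\<^bsub>self_module k\<^esub> \<one>\<^bsub>k\<^esub> \<in> lspan ((\<lambda>a. a [^]\<^bsub>k\<^esub> (p ^ 0)) ` carrier k) (self_module k) {\<one>\<^bsub>k\<^esub>}"
      using a by (intro self.lspan_smult_incl) (auto simp: self_module_simps)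
    then show ?thesis using a by (simp add: self_module_simps)
  qed
  then show ?case by (intro exI[of _ "{\<one>\<^bsub>k\<^esub>}"]) auto
next
  case (Suc e)
  interpret field k using F_finite_fieldD(1)[OF k] .
  interpret self: Module.module k "self_module k" using module_self[OF is_cring] .
  let ?F = "\<lambda>a. a [^]\<^bsub>k\<^esub> p" and ?A = "\<lambda>e. (\<lambda>a. a [^]\<^bsub>k\<^esub> (p ^ e)) ` carrier k"
  note F = ring_hom_memE[OF F_finite_fieldD(2)[OF k]]
  obtain B where B: "finite B" "B \<subseteq> carrier k" "carrier k \<subseteq> lspan (?A e) (self_module k) B"
    using Suc by blast
  obtain B1 where B1: "finite B1" "B1 \<subseteq> carrier k" "carrier k \<subseteq> lspan (?F ` carrier k) (self_module k) B1"
    using F_finite_fieldD(3)[OF k] by blast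
  let ?B = "(\<lambda>(b, b1). ?F b \<otimes>\<^bsub>k\<^esub> b1) ` (B \<times> B1)"
  have clB: "?B \<subseteq> carrier k" using B B1 by auto
  have clA: "?A j \<subseteq> carrier k" for j by auto
  have "a \<in> lspan (?A (Suc e)) (self_module k) ?B" if a: "a \<in> carrier k" for a
  proof -
    have "a \<in> lspan (?F ` carrier k) (self_module k) B1" using a B1 by blast
    then show ?thesis
    proof (rule self.lspan_least)
      fix x b1 assume "x \<in> ?F ` carrier k" and b1: "b1 \<in> B1"
      then obtain c where c: "c \<in> carrier k" "x = ?F c" by blast
      have b1k: "b1 \<in> carrier k" using b1 B1 by blast
      have "?F c \<otimes>\<^bsub>k\<^esub> b1 \<in> lspan (?A (Suc e)) (self_module k) ?B"
        using self.module_axioms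
      proof (rule lspan_hom[where \<phi> = "\<lambda>x. ?F x \<otimes>\<^bsub>k\<^esub> b1"])
        show "c \<in> lspan (?A e) (self_module k) B" using c B by blast
        fix y b assume "y \<in> ?A e" and b: "b \<in> B"
        then obtain d where d: "d \<in> carrier k" "y = d [^]\<^bsub>k\<^esub> (p ^ e)" by blast
        have bk: "b \<in> carrier k" using b B by blast
        have "?F (y \<otimes>\<^bsub>k\<^esub> b) \<otimes>\<^bsub>k\<^esub> b1 = (d [^]\<^bsub>k\<^esub> (p ^ Suc e)) \<otimes>\<^bsub>k\<^esub> (?F b \<otimes>\<^bsub>k\<^esub> b1)"
          using d bk b1k F(2)[of y b] by (simp add: nat_pow_pow m_assoc mult.commute)
        then show "\<exists>a'\<in>?A (Suc e). \<exists>g'\<in>?B. ?F (y \<odot>\<^bsub>self_module k\<^esub> b) \<otimes>\<^bsub>k\<^esub> b1 = a' \<odot>\<^bsub>self_module k\<^esub> g'"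
          unfolding self_module_simps using d b b1
          by (intro bexI[of _ "d [^]\<^bsub>k\<^esub> (p ^ Suc e)"] bexI[of _ "?F b \<otimes>\<^bsub>k\<^esub> b1"]) auto
      next
        have "?F \<zero>\<^bsub>k\<^esub> = \<zero>\<^bsub>k\<^esub>" using ring_hom_zero[OF F_finite_fieldD(2)[OF k]] ring_axioms by blast
        then show "?F \<zero>\<^bsub>self_module k\<^esub> \<otimes>\<^bsub>k\<^esub> b1 = \<zero>\<^bsub>self_module k\<^esub>" using b1k by (simp add: self_module_simps)
      qed (use clA B b1k F(3) in \<open>auto simp: self_module_simps l_distr\<close>)
      then show "x \<odot>\<^bsub>self_module k\<^esub> b1 \<in> lspan (?A (Suc e)) (self_module k) ?B"
        unfolding c(2) self_module_simps .
    next
      show "\<zero>\<^bsub>self_module k\<^esub> \<in> lspan (?A (Suc e)) (self_module k) ?B" by (rule lspan_zero)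
      fix x y assume "x \<in> lspan (?A (Suc e)) (self_module k) ?B" "y \<in> lspan (?A (Suc e)) (self_module k) ?B"
      then show "x \<oplus>\<^bsub>self_module k\<^esub> y \<in> lspan (?A (Suc e)) (self_module k) ?B"
        using clA clB by (intro self.lspan_add) (auto simp: self_module_simps)
    qed
  qed
  then show ?case using clB B B1 by (intro exI[of _ ?B]) auto
qed

lemma field_image_scalars:
  assumes k: "field k" and R: "cring R" and h: "h \<in> ring_hom k R"
  shows "subring (h ` carrier k) R"
    and "c \<in> h ` carrier k \<Longrightarrow> c \<noteq> \<zero>\<^bsub>R\<^esub> \<Longrightarrow> \<exists>d\<in>h ` carrier k. d \<otimes>\<^bsub>R\<^esub> c = \<one>\<^bsub>R\<^esub>"
proof -
  interpret k: field k by fact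
  interpret R: cring R by fact
  note H = ring_hom_memE[OF h]
  have h0: "h \<zero>\<^bsub>k\<^esub> = \<zero>\<^bsub>R\<^esub>" using ring_hom_zero[OF h k.ring_axioms R.ring_axioms] .
  show "subring (h ` carrier k) R"
  proof (rule R.subringI)
    show "h ` carrier k \<subseteq> carrier R" using H(1) by blast
    show "\<one>\<^bsub>R\<^esub> \<in> h ` carrier k" using H(4) k.one_closed by (metis imageI)
  next
    fix x assume "x \<in> h ` carrier k"
    then obtain a where a: "a \<in> carrier k" "x = h a" by blast
    have "h (\<ominus>\<^bsub>k\<^esub> a) \<oplus>\<^bsub>R\<^esub> h a = \<zero>\<^bsub>R\<^esub>" using H(3)[of "\<ominus>\<^bsub>k\<^esub> a" a] a h0 by (simp add: k.l_neg)
    then have "\<ominus>\<^bsub>R\<^esub> x = h (\<ominus>\<^bsub>k\<^esub> a)" using a H(1) by (intro R.minus_equality) auto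
    then show "\<ominus>\<^bsub>R\<^esub> x \<in> h ` carrier k" using a by simp
  next
    fix x y assume "x \<in> h ` carrier k" "y \<in> h ` carrier k"
    then obtain a b where ab: "a \<in> carrier k" "x = h a" "b \<in> carrier k" "y = h b" by blast
    show "x \<otimes>\<^bsub>R\<^esub> y \<in> h ` carrier k"
      using H(2)[of a b] ab by (intro image_eqI[of _ _ "a \<otimes>\<^bsub>k\<^esub> b"]) auto
    show "x \<oplus>\<^bsub>R\<^esub> y \<in> h ` carrier k"
      using H(3)[of a b] ab by (intro image_eqI[of _ _ "a \<oplus>\<^bsub>k\<^esub> b"]) auto
  qed
  show "\<exists>d\<in>h ` carrier k. d \<otimes>\<^bsub>R\<^esub> c = \<one>\<^bsub>R\<^esub>" if c: "c \<in> h ` carrier k" "c \<noteq> \<zero>\<^bsub>R\<^esub>"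
  proof -
    obtain a where a: "a \<in> carrier k" "c = h a" using c by blast
    then have "a \<noteq> \<zero>\<^bsub>k\<^esub>" using c h0 by auto
    then have "a \<in> Units k" using a k.field_Units by blast
    then have "inv\<^bsub>k\<^esub> a \<in> carrier k" "inv\<^bsub>k\<^esub> a \<otimes>\<^bsub>k\<^esub> a = \<one>\<^bsub>k\<^esub>" by auto
    then have "h (inv\<^bsub>k\<^esub> a) \<otimes>\<^bsub>R\<^esub> c = \<one>\<^bsub>R\<^esub>" using H(2)[of "inv\<^bsub>k\<^esub> a" a] H(4) a by simp
    then show ?thesis using \<open>inv\<^bsub>k\<^esub> a \<in> carrier k\<close> by blast
  qed
qed

lemma field_image_F_finite:
  assumes k: "field k" and R: "cring R" and h: "h \<in> ring_hom k R" and M: "Module.module R M"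
    and B: "B \<subseteq> carrier k" "carrier k \<subseteq> lspan ((\<lambda>a. a [^]\<^bsub>k\<^esub> (q::nat)) ` carrier k) (self_module k) B"
    and c: "c \<in> h ` carrier k" and y: "y \<in> carrier M"
  shows "c \<odot>\<^bsub>M\<^esub> y \<in> lspan ((\<lambda>a. a [^]\<^bsub>R\<^esub> q) ` h ` carrier k) M ((\<lambda>b. b \<odot>\<^bsub>M\<^esub> y) ` h ` B)"
proof -
  interpret k: field k by fact
  interpret Module.module R M by fact
  note H = ring_hom_memE[OF h]
  obtain a where a: "a \<in> carrier k" "c = h a" using c by blast
  have "h a \<odot>\<^bsub>M\<^esub> y \<in> lspan ((\<lambda>a. a [^]\<^bsub>R\<^esub> q) ` h ` carrier k) M ((\<lambda>b. b \<odot>\<^bsub>M\<^esub> y) ` h ` B)"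
    using module_self[OF k.is_cring]
  proof (rule lspan_hom[where \<phi> = "\<lambda>x. h x \<odot>\<^bsub>M\<^esub> y"])
    show "a \<in> lspan ((\<lambda>a. a [^]\<^bsub>k\<^esub> q) ` carrier k) (self_module k) B" using a B by blast
    have "h \<zero>\<^bsub>k\<^esub> = \<zero>\<^bsub>R\<^esub>" using ring_hom_zero[OF h k.ring_axioms R.ring_axioms] .
    then show "h \<zero>\<^bsub>self_module k\<^esub> \<odot>\<^bsub>M\<^esub> y = \<zero>\<^bsub>M\<^esub>" using y by (simp add: self_module_simps)
  next
    fix x b assume "x \<in> (\<lambda>a. a [^]\<^bsub>k\<^esub> q) ` carrier k" and b: "b \<in> B"
    then obtain d where d: "d \<in> carrier k" "x = d [^]\<^bsub>k\<^esub> q" by blast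
    have bk: "b \<in> carrier k" using b B by blast
    have "h (x \<otimes>\<^bsub>k\<^esub> b) \<odot>\<^bsub>M\<^esub> y = (h d [^]\<^bsub>R\<^esub> q) \<odot>\<^bsub>M\<^esub> (h b \<odot>\<^bsub>M\<^esub> y)"
      using H(2)[of x b] d bk ring_hom_nat_pow[OF h k.is_cring R d(1), of q] H(1) y by (simp add: smult_assoc1)
    then show "\<exists>a'\<in>(\<lambda>a. a [^]\<^bsub>R\<^esub> q) ` h ` carrier k. \<exists>g'\<in>(\<lambda>b. b \<odot>\<^bsub>M\<^esub> y) ` h ` B.
        h (x \<odot>\<^bsub>self_module k\<^esub> b) \<odot>\<^bsub>M\<^esub> y = a' \<odot>\<^bsub>M\<^esub> g'"
      using d b unfolding self_module_simps by blast
  qed (use B H y in \<open>auto simp: self_module_simps smult_l_distr\<close>)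
  then show ?thesis using a by simp
qed


section \<open>Charts around the points of the scheme\<close>

text \<open>All functions on a nonempty open subset of the spectrum of \<open>k\<close> are constants, so the composition of
  \<open>k \<rightarrow> \<O>(V) \<rightarrow> \<O>(U)\<close> has the same image as the second map.\<close>

lemma finite_type_over_field_chart:
  assumes V0: "rs_open S V0" and k: "field k"
    and ft: "finite_type_morphism (open_subspace S V0) (Spec k) \<phi>" and x: "x \<in> V0"
  shows "\<exists>U h T. x \<in> U \<and> affine_open S U \<and> h \<in> ring_hom k (rs_sec S U) \<and> finite T \<and>
    T \<subseteq> carrier (rs_sec S U) \<and> carrier (rs_sec S U) = generate_ring (rs_sec S U) (h ` carrier k \<union> T)"
proof -
  let ?S = "open_subspace S V0"
  have top: "topspace (rs_top ?S) = V0" and op: "openin (rs_top ?S) V \<longleftrightarrow> rs_open S V \<and> V \<subseteq> V0" for V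
    using V0 openin_subset[OF V0] by (auto simp: open_subspace_def openin_open_subtopology)
  have cont: "continuous_map (rs_top ?S) (rs_top (Spec k)) (fst \<phi>)"
    using ft unfolding finite_type_morphism_def lrs_morphism_def rs_morphism_def by blast
  obtain \<V> where \<V>: "\<Union>\<V> = rs_points (Spec k)" and local: "\<forall>V\<in>\<V>. affine_open (Spec k) V \<and>
        (\<exists>\<U>. finite \<U> \<and> \<Union>\<U> = rs_preimage ?S \<phi> V \<and> (\<forall>U\<in>\<U>. affine_open ?S U \<and>
           ring_hom_finite_type (rs_sec (Spec k) V) (rs_sec ?S U)
             (\<lambda>a. rs_res ?S (rs_preimage ?S \<phi> V) U (snd \<phi> V a))))"
    using ft[unfolded finite_type_morphism_def, THEN conjunct2] by (elim exE conjE)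
  have "fst \<phi> x \<in> rs_points (Spec k)" using cont x top unfolding continuous_map_def by blast
  then obtain V where V: "V \<in> \<V>" "fst \<phi> x \<in> V" using \<V> by blast
  obtain \<U> where \<U>: "\<Union>\<U> = rs_preimage ?S \<phi> V" and charts: "\<forall>U\<in>\<U>. affine_open ?S U \<and>
           ring_hom_finite_type (rs_sec (Spec k) V) (rs_sec ?S U)
             (\<lambda>a. rs_res ?S (rs_preimage ?S \<phi> V) U (snd \<phi> V a))"
    using local V(1) by meson
  have "x \<in> rs_preimage ?S \<phi> V" using x V top unfolding rs_preimage_def by simp
  then obtain U where U: "U \<in> \<U>" "x \<in> U" using \<U> by blast
  have UV0: "rs_open S U" "U \<subseteq> V0" using charts U op unfolding affine_open_def by blast+
  have "open_subspace ?S U = open_subspace S U"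
    using UV0 by (simp add: open_subspace_def subtopology_subtopology Int_absorb1)
  then have affine: "affine_open S U" using charts U UV0 unfolding affine_open_def by metis
  define g where "g = (\<lambda>a. rs_res ?S (rs_preimage ?S \<phi> V) U (snd \<phi> V a))"
  have "ring_hom_finite_type (rs_sec (Spec k) V) (rs_sec S U) g"
    using charts U unfolding g_def by (simp add: open_subspace_def)
  then obtain T where g: "g \<in> ring_hom (rs_sec (Spec k) V) (rs_sec S U)"
    and T: "finite T" "T \<subseteq> carrier (rs_sec S U)"
    and gen: "carrier (rs_sec S U) = generate_ring (rs_sec S U) (g ` carrier (rs_sec (Spec k) V) \<union> T)"
    unfolding ring_hom_finite_type_def by blast
  have "openin (zariski_topology k) V" using local V(1) unfolding affine_open_def by (simp add: Spec_simps)
  note const = Spec_field_constants[OF k this]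
  let ?h = "g \<circ> (\<lambda>a. frac_section k V a \<one>\<^bsub>k\<^esub>)"
  have "?h \<in> ring_hom k (rs_sec S U)"
    using const(1) g ring_hom_trans by blast
  moreover have "?h ` carrier k = g ` carrier (rs_sec (Spec k) V)"
    unfolding const(2) image_comp ..
  ultimately show ?thesis using affine U T gen by metis
qed

lemma lspan_carrier_update: "lspan A (M\<lparr>carrier := X'\<rparr>) G = lspan A M G"
proof
  show "lspan A (M\<lparr>carrier := X'\<rparr>) G \<subseteq> lspan A M G"
  proof
    fix x assume "x \<in> lspan A (M\<lparr>carrier := X'\<rparr>) G"
    then show "x \<in> lspan A M G"
      by induction (auto intro: lspan.intros)
  qed
  show "lspan A M G \<subseteq> lspan A (M\<lparr>carrier := X'\<rparr>) G"
  proof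
    fix x assume "x \<in> lspan A M G"
    then show "x \<in> lspan A (M\<lparr>carrier := X'\<rparr>) G"
      by induction (use lspan.intros[where M = "M\<lparr>carrier := X'\<rparr>" and A = A and G = G] in auto)
  qed
qed

lemma ms_generated_imp_generated_over:
  assumes M: "module_sheaf S M" and gen: "ms_generated S M U J g" and U: "rs_open S U"
  shows "generated_over S M (\<lambda>V. carrier (ms_sec M V)) U (g ` J)"
proof (rule generated_overI)
  fix V s y assume V: "rs_open S V" "V \<subseteq> U" and s: "s \<in> carrier (ms_sec M V)" and y: "y \<in> V"
  have "\<exists>W K. rs_open S W \<and> y \<in> W \<and> W \<subseteq> V \<and> finite K \<and> K \<subseteq> J \<and>
      (\<exists>c\<in>K \<rightarrow> carrier (rs_sec S W).
         ms_res M V W s = (\<Oplus>\<^bsub>ms_sec M W\<^esub>j\<in>K. c j \<odot>\<^bsub>ms_sec M W\<^esub> ms_res M U W (g j)))"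
    using gen[unfolded ms_generated_def, THEN conjunct2, rule_format, of V s y] V s y by simp
  then obtain W K c where W: "rs_open S W" "y \<in> W" "W \<subseteq> V" and K: "finite K" "K \<subseteq> J"
    and c: "c \<in> K \<rightarrow> carrier (rs_sec S W)"
    and eq: "ms_res M V W s = (\<Oplus>\<^bsub>ms_sec M W\<^esub>j\<in>K. c j \<odot>\<^bsub>ms_sec M W\<^esub> ms_res M U W (g j))" by blast
  interpret Module.module "rs_sec S W" "ms_sec M W"
    using M[unfolded module_sheaf_def, THEN conjunct1] W(1) by simp
  have WU: "W \<subseteq> U" using W V by blast
  have "g ` J \<subseteq> carrier (ms_sec M U)" using gen unfolding ms_generated_def by blast
  then have "ms_res M U W ` g ` J \<subseteq> carrier (ms_sec M W)"
    using sheaf_on_closed[OF M[unfolded module_sheaf_def, THEN conjunct2, THEN conjunct2] U W(1) WU] by blast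
  then have "ms_res M V W s \<in> lspan (carrier (rs_sec S W)) (ms_sec M W) (ms_res M U W ` g ` J)"
    unfolding eq using K c by (intro finsum_in_lspan) auto
  then show "\<exists>W. rs_open S W \<and> y \<in> W \<and> W \<subseteq> V \<and>
      ms_res M V W s \<in> lspan (carrier (rs_sec S W)) (ms_sec M W) (ms_res M U W ` g ` J)"
    using W by blast
qed

lemma generated_over_restrict_module:
  assumes "module_sheaf S (restrict_module M N)" "ms_generated S (restrict_module M N) U J g" "rs_open S U"
  shows "generated_over S M N U (g ` J)"
  using ms_generated_imp_generated_over[OF assms]
  by (simp add: generated_over_def restrict_module_def lspan_carrier_update)

text \<open>Generators of \<open>M\<close>, \<open>N\<close> and \<open>I\<close> near \<open>x\<close> are restricted to a common neighbourhood.\<close>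

lemma (in ideal_and_submodule) exists_generators:
  assumes x: "x \<in> U0" "rs_open S U0" and x_point: "x \<in> rs_points S"
    and M_coh: "coherent S M" and N_coh: "coherent S (restrict_module M N)"
    and I_qcoh: "quasi_coherent S (restrict_module (structure_module S) I)" and I_princ: "locally_principal S I"
  shows "\<exists>W f H G. x \<in> W \<and> W \<subseteq> U0 \<and> generators_over S M I N W f H \<and> finite H \<and>
    finite G \<and> G \<subseteq> carrier (ms_sec M W) \<and> generated_over S M (\<lambda>V. carrier (ms_sec M V)) W G"
proof -
  let ?N = "restrict_module M N" and ?I = "restrict_module (structure_module S) I"
  have shN: "module_sheaf S ?N" using N_coh unfolding coherent_def by blast
  have shI: "module_sheaf S ?I" using I_qcoh unfolding quasi_coherent_def by blast
  obtain U1 and n1 :: nat and g1 where U1: "rs_open S U1" "x \<in> U1" and g1: "ms_generated S M U1 {..<n1} g1"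
    using M_coh[unfolded coherent_def, THEN conjunct2, THEN conjunct1] x_point by blast
  obtain U2 and n2 :: nat and g2 where U2: "rs_open S U2" "x \<in> U2" and g2: "ms_generated S ?N U2 {..<n2} g2"
    using N_coh[unfolded coherent_def, THEN conjunct2, THEN conjunct1] x_point by blast
  obtain U3 f where U3: "rs_open S U3" "x \<in> U3" and f: "ms_generated S ?I U3 {()} (\<lambda>_. f)"
    using I_princ x_point unfolding locally_principal_def by blast
  let ?W = "U0 \<inter> U1 \<inter> U2 \<inter> U3"
  have W: "rs_open S ?W" "x \<in> ?W" using x U1 U2 U3 by auto
  have sub: "?W \<subseteq> U1" "?W \<subseteq> U2" "?W \<subseteq> U3" by auto
  let ?G = "ms_res M U1 ?W ` g1 ` {..<n1}" and ?H = "ms_res M U2 ?W ` g2 ` {..<n2}" and ?f = "rs_res S U3 ?W f"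
  have g1M: "g1 ` {..<n1} \<subseteq> carrier (ms_sec M U1)" using g1 unfolding ms_generated_def by blast
  have g2N: "g2 ` {..<n2} \<subseteq> N U2" using g2 unfolding ms_generated_def restrict_module_def by auto
  have fI: "f \<in> I U3" using f unfolding ms_generated_def restrict_module_def by auto
  have g2M: "g2 ` {..<n2} \<subseteq> carrier (ms_sec M U2)" using g2N N_closed[OF U2(1)] by blast
  have fO: "{f} \<subseteq> carrier (ms_sec (structure_module S) U3)" using fI I_closed[OF U3(1)] by auto
  have "generators_over S M I N ?W ?f ?H"
  proof (intro generators_over.intro generators_over_axioms.intro)
    show "ideal_and_submodule S M I N" by (rule ideal_and_submodule_axioms)
    show "?f \<in> I ?W" using I_restrict[OF U3(1) W(1) sub(3)] fI by blast
    show "?H \<subseteq> N ?W" using N_restrict[OF U2(1) W(1) sub(2)] g2N by blast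
    have "generated_over S (structure_module S) I U3 {f}"
      using generated_over_restrict_module[OF shI f U3(1)] by simp
    then show "generated_over S (structure_module S) I ?W {?f}"
      using struct_sheaf.generated_over_restrict[OF _ U3(1) fO W(1) sub(3)] by simp
    show "generated_over S M N ?W ?H"
      using generated_over_restrict[OF generated_over_restrict_module[OF shN g2 U2(1)] U2(1) g2M W(1) sub(2)] .
  qed (rule W(1))
  moreover have "generated_over S M (\<lambda>V. carrier (ms_sec M V)) ?W ?G"
    using generated_over_restrict[OF ms_generated_imp_generated_over[OF sheaf g1 U1(1)] U1(1) g1M W(1) sub(1)] .
  moreover have "?G \<subseteq> carrier (ms_sec M ?W)" using mres_closed[OF U1(1) W(1) sub(1)] g1M by blast
  moreover have "finite ?H" "finite ?G" by auto
  moreover have "?W \<subseteq> U0" by auto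
  ultimately show ?thesis using W(2)
    by (intro exI[of _ ?W] exI[of _ ?f] exI[of _ ?H] exI[of _ ?G] conjI)
qed

theorem proposition2p12:
  fixes p q e :: nat
    and S :: "('x, 'a) ringed_space"
    and I :: "'x set \<Rightarrow> 'a set"
    and M :: "('x, 'a, 'b) module_sheaf"
    and C :: "'x set \<Rightarrow> 'b \<Rightarrow> 'b"
    and N :: "'x set \<Rightarrow> 'b set"
    and J :: "'i set"
    and U :: "'i \<Rightarrow> 'x set"
    and k :: "'i \<Rightarrow> 'k ring"
  assumes "Factorial_Ring.prime p" and "e > 0" and "q = p ^ e"
    and "noetherian_scheme S" and "F_finite_scheme p S"
    and "ideal_sheaf S I"
    and "quasi_coherent S (restrict_module (structure_module S) I)"
    and "locally_principal S I"
    and "cartier_module q S M C" and "coherent S M"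
    and "sub_sheaf S M N" and "coherent S (restrict_module M N)"
    and "\<And>i. i \<in> J \<Longrightarrow> rs_open S (U i)"
    and "(\<Union>i\<in>J. U i) = rs_points S"
    and "\<And>i. i \<in> J \<Longrightarrow> F_finite_field p (k i)"
    and "\<And>i. i \<in> J \<Longrightarrow> \<exists>\<phi>. finite_type_morphism (open_subspace S (U i)) (Spec (k i)) \<phi>"
  shows "\<exists>L::nat. \<forall>m\<ge>1. card (cartier_nu S M C I N m \<inter> {0..<q ^ m}) \<le> L"
proof -
  have ringed: "ringed_space S"
    using assms(4) unfolding noetherian_scheme_def scheme_def locally_ringed_space_def by blast
  have sheaf: "module_sheaf S M" using assms(10) unfolding coherent_def by blast
  have q: "q \<ge> 2"
  proof -
    have "p \<ge> 2" using assms(1) by (rule prime_ge_2_nat)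
    moreover have "p ^ 1 \<le> p ^ e" using assms(2) \<open>p \<ge> 2\<close> by (intro power_increasing) auto
    ultimately show ?thesis using assms(3) by simp
  qed
  interpret cartier_sheaf S M q C using ringed sheaf q assms(9) by unfold_locales
  interpret ideal_and_submodule S M I N using assms(6,11) by unfold_locales
  \<comment> \<open>The exponents at which the two image sheaves differ on \<open>D\<close>.\<close>
  let ?bad = "\<lambda>D m. {n \<in> {0..<q ^ m}. \<not> (image_le m (INn n) (INn (Suc n)) D \<and> image_le m (INn (Suc n)) (INn n) D)}"
  define bounded where "bounded D L \<longleftrightarrow> (\<forall>m. card (?bad D m) \<le> L)" for D and L :: nat
  have charts: "\<exists>D L. rs_open S D \<and> x \<in> D \<and> bounded D L" if x: "x \<in> rs_points S" for x
  proof -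
    obtain i where i: "i \<in> J" "x \<in> U i" using x assms(14) by blast
    have kF: "F_finite_field p (k i)" and k: "field (k i)"
      using assms(15)[OF i(1)] F_finite_fieldD(1) by auto
    obtain \<phi> where "finite_type_morphism (open_subspace S (U i)) (Spec (k i)) \<phi>"
      using assms(16)[OF i(1)] by blast
    then obtain V h T where V: "x \<in> V" "affine_open S V" and h: "h \<in> ring_hom (k i) (rs_sec S V)"
      and T: "finite T" "T \<subseteq> carrier (rs_sec S V)"
      and gen: "carrier (rs_sec S V) = generate_ring (rs_sec S V) (h ` carrier (k i) \<union> T)"
      using finite_type_over_field_chart[OF assms(13)[OF i(1)] k _ i(2)] by blast
    obtain B where B: "finite B" "B \<subseteq> carrier (k i)"
      "carrier (k i) \<subseteq> lspan ((\<lambda>a. a [^]\<^bsub>k i\<^esub> q) ` carrier (k i)) (self_module (k i)) B"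
      using F_finite_field_power[OF kF, of e] unfolding assms(3) by blast
    have Vo: "rs_open S V" using V unfolding affine_open_def by blast
    have R: "cring (rs_sec S V)" using cring_sec[OF Vo] .
    have hB: "h ` B \<subseteq> carrier (rs_sec S V)" using ring_hom_memE(1)[OF h] B by blast
    interpret chart: cartier_chart S M q C V "h ` carrier (k i)" T "h ` B" I N
    proof (intro cartier_chart.intro affine_chart.intro affine_chart_axioms.intro)
      show "cartier_sheaf S M q C" by (rule cartier_sheaf_axioms)
      show "ideal_and_submodule S M I N" by (rule ideal_and_submodule_axioms)
      show "subring (h ` carrier (k i)) (rs_sec S V)" by (rule field_image_scalars(1)[OF k R h])
      show "\<exists>d\<in>h ` carrier (k i). d \<otimes>\<^bsub>rs_sec S V\<^esub> c = \<one>\<^bsub>rs_sec S V\<^esub>"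
        if "c \<in> h ` carrier (k i)" "c \<noteq> \<zero>\<^bsub>rs_sec S V\<^esub>" for c
        using field_image_scalars(2)[OF k R h that] .
      show "c \<odot>\<^bsub>M'\<^esub> y \<in> lspan ((\<lambda>a. a [^]\<^bsub>rs_sec S V\<^esub> q) ` h ` carrier (k i)) M' ((\<lambda>b. b \<odot>\<^bsub>M'\<^esub> y) ` h ` B)"
        if "Module.module (rs_sec S V) M'" "c \<in> h ` carrier (k i)" "y \<in> carrier M'" for M' :: "('a, 'b) module" and c y
        using field_image_F_finite[OF k R h that(1) B(2,3) that(2,3)] .
    qed (use V T gen B hB in auto)
    obtain W f H G where "x \<in> W" "W \<subseteq> V" "generators_over S M I N W f H" "finite H"
      "finite G" "G \<subseteq> carrier (ms_sec M W)"
      "generated_over S M (\<lambda>V. carrier (ms_sec M V)) W G"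
      using exists_generators[OF V(1) Vo x assms(10,12,7,8)] by blast
    then show ?thesis unfolding bounded_def using chart.jumps_bounded_near_point[of W f H x G] by blast
  qed
  have "compactin (rs_top S) (rs_points S)"
  proof -
    obtain \<U> where \<U>: "finite \<U>" "\<forall>V\<in>\<U>. affine_open S V \<and> noetherian_ring (rs_sec S V)" "\<Union>\<U> = rs_points S"
      using assms(4) unfolding noetherian_scheme_def by auto
    have "compactin (rs_top S) (\<Union>\<U>)"
      using \<U>(1)
    proof (rule compactin_Union)
      fix V assume "V \<in> \<U>"
      then show "compactin (rs_top S) V" using \<U>(2) affine_open_compactin by blast
    qed
    then show ?thesis using \<U>(3) by simp
  qed
  moreover have "rs_points S \<subseteq> \<Union>{D. rs_open S D \<and> (\<exists>L. bounded D L)}" using charts by blast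
  ultimately obtain \<F> where \<F>: "finite \<F>" "\<F> \<subseteq> {D. rs_open S D \<and> (\<exists>L. bounded D L)}" "rs_points S \<subseteq> \<Union>\<F>"
    using compactinD[of "rs_top S" "rs_points S" "{D. rs_open S D \<and> (\<exists>L. bounded D L)}"] by blast
  obtain L where L: "\<forall>D\<in>\<F>. bounded D (L D)"
    using bchoice[of \<F> bounded] \<F>(2) by blast
  have "card (cartier_nu S M C I N m \<inter> {0..<q ^ m}) \<le> (\<Sum>D\<in>\<F>. L D)" for m
  proof -
    have "cartier_nu S M C I N m \<inter> {0..<q ^ m} \<subseteq> (\<Union>D\<in>\<F>. ?bad D m)"
    proof (rule subsetI, rule ccontr)
      fix n assume n: "n \<in> cartier_nu S M C I N m \<inter> {0..<q ^ m}" and "n \<notin> (\<Union>D\<in>\<F>. ?bad D m)"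
      then have le: "image_le m (INn n) (INn (Suc n)) D" "image_le m (INn (Suc n)) (INn n) D"
        if "D \<in> \<F>" for D using that by auto
      have open_D: "rs_open S D" if "D \<in> \<F>" for D using that \<F>(2) by blast
      have "cartier_image S M C m (INn n) V = cartier_image S M C m (INn (Suc n)) V" if V: "rs_open S V" for V
      proof
        show "cartier_image S M C m (INn n) V \<subseteq> cartier_image S M C m (INn (Suc n)) V"
          using le(1) open_D by (intro cartier_image_subset[OF \<F>(3) _ ideal_mult_closed INn_restrict V]) auto
        show "cartier_image S M C m (INn (Suc n)) V \<subseteq> cartier_image S M C m (INn n) V"
          using le(2) open_D by (intro cartier_image_subset[OF \<F>(3) _ ideal_mult_closed INn_restrict V]) auto
      qed
      then show False using n unfolding cartier_nu_def by blast
    qed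
    moreover have "finite (\<Union>D\<in>\<F>. ?bad D m)" using \<F>(1) by simp
    ultimately have "card (cartier_nu S M C I N m \<inter> {0..<q ^ m}) \<le> card (\<Union>D\<in>\<F>. ?bad D m)"
      by (intro card_mono)
    also have "\<dots> \<le> (\<Sum>D\<in>\<F>. card (?bad D m))" using \<F>(1) by (intro card_UN_le)
    also have "\<dots> \<le> (\<Sum>D\<in>\<F>. L D)" using L unfolding bounded_def by (intro sum_mono) blast
    finally show ?thesis .
  qed
  then show ?thesis by blast
qed

end
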